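(* Let $\mathcal{S} \subset \mathcal{R}$ be an aperiodic inclusion of ergodic pmp equivalence relations on a standard probability space $(X, \mu)$ with an ergodic index cocycle $\Omega : \mathcal{R} \to \mathrm{Sym}(I)$. (i) Let $\mathcal{U} \subset \mathcal{T}$ be an inclusion of ergodic pmp equivalence relations on a standard probability space $(Y, \eta)$ and let $\varphi : (X, \mu) \to (Y, \eta)$ be a pmp Borel isomorphism such that $(\varphi \times \varphi)(\mathcal{S}) = \mathcal{U}$ and $(\varphi \times \varphi)(\mathcal{R}) = \mathcal{T}$. Then $\Omega \circ (\varphi^{-1} \times \varphi^{-1}) : \mathcal{T} \to \mathrm{Sym}(I)$ is an ergodic index cocycle for the inclusion $\mathcal{U} \subset \mathcal{T}$. Therefore $\mathcal{U} \subset \mathcal{T}$ is aperiodic, and moreover $H(\mathcal{S} \subset \mathcal{R}) \cong H(\mathcal{U} \subset \mathcal{T})$. (ii) Let $U \subset X$ be a non-negligible Borel subset. Then the restriction $\Omega_U = \Omega|_{\mathcal{R}|_U} : \mathcal{R}|_U \to \mathrm{Sym}(I)$ is an ergodic index cocycle for the inclusion $\mathcal{S}|_U \subset \mathcal{R}|_U$. Therefore $\mathcal{S}|_U \subset \mathcal{R}|_U$ is aperiodic, and moreover $H(\mathcal{S}|_U \subset \mathcal{R}|_U) \cong H(\mathcal{S} \subset \mathcal{R})$. Therefore $H(\mathcal{S} \subset \mathcal{R})$ is a stable orbit equivalence invariant of the inclusion $\mathcal{S} \subset \mathcal{R}$; that is, if $\mathcal{S} \subset \mathcal{R}$ on $(X,\mu)$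 and $\mathcal{U} \subset \mathcal{T}$ on $(Y,\eta)$ are aperiodic inclusions of ergodic pmp equivalence relations and there are non-negligible Borel subsets $U \subset X$, $V \subset Y$ and a pmp Borel isomorphism $\varphi : (U, \mu_U) \to (V, \eta_V)$ with $(\varphi \times \varphi)(\mathcal{S}|_U) = \mathcal{U}|_V$ and $(\varphi \times \varphi)(\mathcal{R}|_U) = \mathcal{T}|_V$, then $H(\mathcal{S} \subset \mathcal{R}) \cong H(\mathcal{U} \subset \mathcal{T})$.
   Context: All sets and maps are Borel and relations hold up to measure zero. A pmp equivalence relation $\mathcal{R}$ on a standard probability space $(X,\mu)$ is a countable Borel equivalence relation such that every Borel automorphism of $X$ with graph contained in $\mathcal{R}$ preserves $\mu$; these automorphisms form the full group $[\mathcal{R}]$. $\mathcal{R}$ is ergodic if every $\mathcal{R}$-invariant Borel set has measure $0$ or $1$. For $U\subset X$ non-negligible, $\mathcal{R}|_U = \mathcal{R} \cap (U\times U)$ is a pmp equivalence relation on $(U, \mu_U)$, $\mu_U = \mu|_U/\mu(U)$. The measure $\nu$ on $\mathcal{R}$ is $\nu(\mathcal{V}) = \int_X |\{y : (x,y) \in \mathcal{V}\}|\,d\mu(x)$. A $1$-cocycle for $\mathcal{R}$ with values in a topological group $G$ is a Borel map $\Omega : \mathcal{R} \to G$ with $\Omega(x,z) = \Omega(x,y)\Omega(y,z)$ for almost every $(x,y,z)$ with $(x,y),(y,z) \in \mathcal{R}$. A Polish group is non-Archimedian if it has a neighbourhood basis of the identity consisting of open subgroups; e.g. $\mathrm{Sym}(I)$,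 for $I$ a countable set, with the topology of pointwise convergence. A $1$-cocycle $\Omega : \mathcal{R} \to G$ with values in a non-Archimedian Polish group is called ergodic for $\mathcal{R}$ if for every open subgroup $K \leq G$ the subequivalence relation $\{(x,y) \in \mathcal{R} : \Omega(x,y) \in K\}$ has the same invariant Borel sets (mod null sets) as $\mathcal{R}$. If $\mathcal{R}$ is ergodic and $\Omega$ is an ergodic $1$-cocycle, $H(\Omega) \leq G$ denotes the essential image of $\Omega$, i.e. the smallest closed subset $F \subset G$ with $\nu(\Omega^{-1}(G \setminus F)) = 0$; it is a closed subgroup of $G$. Index cocycles: for an inclusion $\mathcal{S} \subset \mathcal{R}$ of ergodic pmp equivalence relations on $(X,\mu)$, there is a countable family $(c_i)_{i \in I}$ in $[\mathcal{R}]$ (choice functions) such that $\mathrm{id}_X \in \{c_i\}_{i\in I}$ and $[x]_{\mathcal{R}} = \bigsqcup_{i \in I} [c_i(x)]_{\mathcal{S}}$ for almost every $x$. The associated index cocycle is the $1$-cocycle $\Omega : \mathcal{R} \to \mathrm{Sym}(I)$ given by $\Omega(x,y)(i) = j \Leftrightarrow [c_j(x)]_{\mathcal{S}} = [c_i(y)]_{\mathcal{S}}$. Its cohomology class does not depend on the family. The inclusion $\mathcal{S} \subset \mathcal{R}$ is called aperiodic if it admits an ergodic index cocycle $\Omega$; then $H(\mathcal{S} \subset \mathcal{R}) := H(\Omega)$ for some (or any) ergodic index cocycle $\Omega$, which is well defined up to conjugacy in $\mathrm{Sym}(I)$. The symbol $\cong$ denotes isomorphism of topological groups (continuous with continuous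 inverse). *)

theory Defs
  imports "HOL-Analysis.Analysis" "HOL-Probability.Probability_Measure" "HOL-Algebra.Bij"
begin

definition borel_of :: "'a topology \<Rightarrow> 'a measure" where
  "borel_of T = sigma (topspace T) {A. openin T A}"

text \<open>A standard Borel space is a Borel subset of a Polish space with the relative Borel structure.
  No atomlessness is required of a standard probability space.\<close>

definition standard_borel :: "'a measure \<Rightarrow> bool" where
  "standard_borel M \<longleftrightarrow>
     (\<exists>T. completely_metrizable_space T \<and> second_countable T \<and>
          space M \<in> sets (borel_of T) \<and> sets M = sets (restrict_space (borel_of T) (space M)))"

definition standard_prob_space :: "'a measure \<Rightarrow> bool" where
  "standard_prob_space M \<longleftrightarrow> prob_space M \<and> standard_borel M"

definition borel_automorphism :: "'a measure \<Rightarrow> ('a \<Rightarrow> 'a) \<Rightarrow> bool" where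
  "borel_automorphism M f \<longleftrightarrow>
     bij_betw f (space M) (space M) \<and> f \<in> M \<rightarrow>\<^sub>M M \<and> the_inv_into (space M) f \<in> M \<rightarrow>\<^sub>M M"

definition countable_borel_equiv :: "'a measure \<Rightarrow> ('a \<times> 'a) set \<Rightarrow> bool" where
  "countable_borel_equiv M R \<longleftrightarrow>
     R \<in> sets (M \<Otimes>\<^sub>M M) \<and> equiv (space M) R \<and> (\<forall>x\<in>space M. countable (R `` {x}))"

definition full_group :: "'a measure \<Rightarrow> ('a \<times> 'a) set \<Rightarrow> ('a \<Rightarrow> 'a) set" where
  "full_group M R = {f. borel_automorphism M f \<and> (\<forall>x\<in>space M. (x, f x) \<in> R)}"

definition pmp_equiv :: "'a measure \<Rightarrow> ('a \<times> 'a) set \<Rightarrow> bool" where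
  "pmp_equiv M R \<longleftrightarrow> countable_borel_equiv M R \<and> (\<forall>f\<in>full_group M R. distr M M f = M)"

text \<open>The measure \<open>\<nu>\<close> on a countable Borel equivalence relation. A set \<open>V\<close> is \<open>\<nu>\<close>-null iff
  \<open>V `` {x} = {}\<close> for almost every \<open>x\<close>. Accordingly, below, ``for almost every \<open>(x, y) \<in> R\<close>'' is
  written \<open>AE x in M. \<forall>y. (x, y) \<in> R \<longrightarrow> \<dots>\<close>, similarly for triples, and
  inclusions and equalities of relations up to null sets are expressed through the classes of
  almost every \<open>x\<close>.\<close>

definition rel_nu :: "'a measure \<Rightarrow> ('a \<times> 'a) set \<Rightarrow> ennreal" where
  "rel_nu M V = (\<integral>\<^sup>+x. emeasure (count_space UNIV) (V `` {x}) \<partial>M)"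

definition rel_subset_ae :: "'a measure \<Rightarrow> ('a \<times> 'a) set \<Rightarrow> ('a \<times> 'a) set \<Rightarrow> bool" where
  "rel_subset_ae M V W \<longleftrightarrow> (AE x in M. V `` {x} \<subseteq> W `` {x})"

definition rel_eq_ae :: "'a measure \<Rightarrow> ('a \<times> 'a) set \<Rightarrow> ('a \<times> 'a) set \<Rightarrow> bool" where
  "rel_eq_ae M V W \<longleftrightarrow> (AE x in M. V `` {x} = W `` {x})"

definition invariant_borel_set :: "'a measure \<Rightarrow> ('a \<times> 'a) set \<Rightarrow> 'a set \<Rightarrow> bool" where
  "invariant_borel_set M V A \<longleftrightarrow>
     A \<in> sets M \<and> (AE x in M. \<forall>y. (x, y) \<in> V \<longrightarrow> (x \<in> A \<longleftrightarrow> y \<in> A))"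

definition ergodic_rel :: "'a measure \<Rightarrow> ('a \<times> 'a) set \<Rightarrow> bool" where
  "ergodic_rel M R \<longleftrightarrow>
     (\<forall>A. invariant_borel_set M R A \<longrightarrow> emeasure M A = 0 \<or> emeasure M A = 1)"

definition ergodic_pmp_inclusion :: "'a measure \<Rightarrow> ('a \<times> 'a) set \<Rightarrow> ('a \<times> 'a) set \<Rightarrow> bool" where
  "ergodic_pmp_inclusion M S R \<longleftrightarrow>
     standard_prob_space M \<and>
     pmp_equiv M S \<and> ergodic_rel M S \<and>
     pmp_equiv M R \<and> ergodic_rel M R \<and> rel_subset_ae M S R"

text \<open>The probability space \<open>(U, \<mu>\<^sub>U)\<close>.\<close>

definition cond_space :: "'a measure \<Rightarrow> 'a set \<Rightarrow> 'a measure" where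
  "cond_space M U = restrict_space (uniform_measure M U) U"

definition restrict_rel :: "('a \<times> 'a) set \<Rightarrow> 'a set \<Rightarrow> ('a \<times> 'a) set" where
  "restrict_rel R U = R \<inter> U \<times> U"

text \<open>A cocycle is a map on \<open>R\<close> defined up to null sets: it has to agree almost everywhere with a
  Borel map on \<open>R\<close>, and its values outside \<open>R\<close> are irrelevant.\<close>

definition cocycle ::
  "'a measure \<Rightarrow> ('a \<times> 'a) set \<Rightarrow> ('g, 'm) monoid_scheme \<Rightarrow> 'g topology \<Rightarrow> ('a \<times> 'a \<Rightarrow> 'g) \<Rightarrow> bool" where
  "cocycle M R G T \<Omega> \<longleftrightarrow>
     (\<exists>\<Omega>'. \<Omega>' \<in> restrict_space (M \<Otimes>\<^sub>M M) R \<rightarrow>\<^sub>M borel_of T \<and>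
           (AE x in M. \<forall>y. (x, y) \<in> R \<longrightarrow> \<Omega> (x, y) = \<Omega>' (x, y))) \<and>
     (AE x in M. \<forall>y z. (x, y) \<in> R \<longrightarrow> (y, z) \<in> R \<longrightarrow> \<Omega> (x, z) = \<Omega> (x, y) \<otimes>\<^bsub>G\<^esub> \<Omega> (y, z))"

definition ergodic_cocycle ::
  "'a measure \<Rightarrow> ('a \<times> 'a) set \<Rightarrow> ('g, 'm) monoid_scheme \<Rightarrow> 'g topology \<Rightarrow> ('a \<times> 'a \<Rightarrow> 'g) \<Rightarrow> bool" where
  "ergodic_cocycle M R G T \<Omega> \<longleftrightarrow>
     cocycle M R G T \<Omega> \<and>
     (\<forall>K. subgroup K G \<and> openin T K \<longrightarrow>
        (\<forall>A. invariant_borel_set M {p \<in> R. \<Omega> p \<in> K} A \<longleftrightarrow> invariant_borel_set M R A))"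

definition essential_image ::
  "'a measure \<Rightarrow> ('a \<times> 'a) set \<Rightarrow> 'g topology \<Rightarrow> ('a \<times> 'a \<Rightarrow> 'g) \<Rightarrow> 'g set" where
  "essential_image M R T \<Omega> =
     (LEAST F. closedin T F \<and> rel_nu M {p \<in> R. \<Omega> p \<in> topspace T - F} = 0)"

text \<open>The topology of pointwise convergence on the carrier of \<open>BijGroup I\<close>, i.e. on \<open>Sym(I)\<close>.\<close>

definition sym_topology :: "'i set \<Rightarrow> ('i \<Rightarrow> 'i) topology" where
  "sym_topology I = subtopology (product_topology (\<lambda>_. discrete_topology I) I) (Bij I)"

definition choice_functions ::
  "'a measure \<Rightarrow> ('a \<times> 'a) set \<Rightarrow> ('a \<times> 'a) set \<Rightarrow> 'i set \<Rightarrow> ('i \<Rightarrow> 'a \<Rightarrow> 'a) \<Rightarrow> bool" where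
  "choice_functions M S R I c \<longleftrightarrow>
     countable I \<and> (\<forall>i\<in>I. c i \<in> full_group M R) \<and>
     (\<exists>i\<in>I. \<forall>x\<in>space M. c i x = x) \<and>
     (AE x in M. R `` {x} = (\<Union>i\<in>I. S `` {c i x}) \<and> disjoint_family_on (\<lambda>i. S `` {c i x}) I)"

definition index_cocycle ::
  "'a measure \<Rightarrow> ('a \<times> 'a) set \<Rightarrow> ('a \<times> 'a) set \<Rightarrow> 'i set \<Rightarrow> ('a \<times> 'a \<Rightarrow> 'i \<Rightarrow> 'i) \<Rightarrow> bool" where
  "index_cocycle M S R I \<Omega> \<longleftrightarrow>
     cocycle M R (BijGroup I) (sym_topology I) \<Omega> \<and>
     (\<exists>c. choice_functions M S R I c \<and>
        (AE x in M. \<forall>y. (x, y) \<in> R \<longrightarrow>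
           (\<forall>i\<in>I. \<forall>j\<in>I. \<Omega> (x, y) i = j \<longleftrightarrow> S `` {c j x} = S `` {c i y})))"

definition ergodic_index_cocycle ::
  "'a measure \<Rightarrow> ('a \<times> 'a) set \<Rightarrow> ('a \<times> 'a) set \<Rightarrow> 'i set \<Rightarrow> ('a \<times> 'a \<Rightarrow> 'i \<Rightarrow> 'i) \<Rightarrow> bool" where
  "ergodic_index_cocycle M S R I \<Omega> \<longleftrightarrow>
     index_cocycle M S R I \<Omega> \<and> ergodic_cocycle M R (BijGroup I) (sym_topology I) \<Omega>"

text \<open>Every countable index set can be replaced by a set of natural numbers.\<close>

definition aperiodic_inclusion :: "'a measure \<Rightarrow> ('a \<times> 'a) set \<Rightarrow> ('a \<times> 'a) set \<Rightarrow> bool" where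
  "aperiodic_inclusion M S R \<longleftrightarrow>
     ergodic_pmp_inclusion M S R \<and> (\<exists>(I :: nat set) \<Omega>. ergodic_index_cocycle M S R I \<Omega>)"

text \<open>\<open>H(S \<subset> R)\<close> is only defined up to conjugacy, through the choice of an ergodic index cocycle.
  \<open>represents_H M S R I H\<close> says that \<open>H\<close>, a subgroup of \<open>Sym(I)\<close>, is \<open>H(\<Omega>)\<close> for some such choice.
  Statements about \<open>H(S \<subset> R)\<close> are made for all representatives.\<close>

definition represents_H ::
  "'a measure \<Rightarrow> ('a \<times> 'a) set \<Rightarrow> ('a \<times> 'a) set \<Rightarrow> 'i set \<Rightarrow> ('i \<Rightarrow> 'i) set \<Rightarrow> bool" where
  "represents_H M S R I H \<longleftrightarrow>
     (\<exists>\<Omega>. ergodic_index_cocycle M S R I \<Omega> \<and> H = essential_image M R (sym_topology I) \<Omega>)"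

text \<open>Isomorphism of topological groups between subgroups \<open>H\<close> of \<open>Sym(I)\<close> and \<open>K\<close> of \<open>Sym(J)\<close>.\<close>

definition perm_group_iso ::
  "'i set \<Rightarrow> ('i \<Rightarrow> 'i) set \<Rightarrow> 'j set \<Rightarrow> ('j \<Rightarrow> 'j) set \<Rightarrow> bool" where
  "perm_group_iso I H J K \<longleftrightarrow>
     (\<exists>f. f \<in> iso (BijGroup I\<lparr>carrier := H\<rparr>) (BijGroup J\<lparr>carrier := K\<rparr>) \<and>
          homeomorphic_map (subtopology (sym_topology I) H) (subtopology (sym_topology J) K) f)"

text \<open>A pmp Borel isomorphism is only defined up to null sets: \<open>X0\<close> is the conull domain of \<open>\<phi>\<close>, and
  \<open>\<phi> ` X0\<close> is its conull range. Its inverse is \<open>the_inv_into X0 \<phi>\<close>.\<close>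

definition pmp_iso :: "'a measure \<Rightarrow> 'b measure \<Rightarrow> 'a set \<Rightarrow> ('a \<Rightarrow> 'b) \<Rightarrow> bool" where
  "pmp_iso M N X0 \<phi> \<longleftrightarrow>
     X0 \<in> sets M \<and> (AE x in M. x \<in> X0) \<and>
     \<phi> ` X0 \<in> sets N \<and> (AE y in N. y \<in> \<phi> ` X0) \<and>
     inj_on \<phi> X0 \<and>
     \<phi> \<in> restrict_space M X0 \<rightarrow>\<^sub>M N \<and>
     the_inv_into X0 \<phi> \<in> restrict_space N (\<phi> ` X0) \<rightarrow>\<^sub>M M \<and>
     distr (restrict_space M X0) N \<phi> = N"

definition rel_image :: "'a set \<Rightarrow> ('a \<Rightarrow> 'b) \<Rightarrow> ('a \<times> 'a) set \<Rightarrow> ('b \<times> 'b) set" where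
  "rel_image X0 \<phi> R = map_prod \<phi> \<phi> ` (restrict_rel R X0)"

end

theory Submission
  imports Defs
begin

text \<open>
  Everything rests on one recurrence principle (\<open>cocycle_recurrence\<close>). Let \<open>\<Omega>\<close> be an ergodic
  cocycle of an ergodic relation \<open>R\<close>, let \<open>F\<close> be a finite set of indices and \<open>A\<close> a non-negligible
  set. Then almost every point \<open>x\<close> is \<open>R\<close>-related to a point \<open>z\<close> of \<open>A\<close> such that \<open>\<Omega> (x, z)\<close> fixes
  \<open>F\<close> pointwise. Indeed the set of these \<open>x\<close> is invariant under the subrelation on which \<open>\<Omega>\<close> lies in
  the stabilizer of \<open>F\<close>, hence under \<open>R\<close>, and it contains almost all of \<open>A\<close>. The principle allows
  both ends of a pair \<open>(x, y)\<close> to be moved into a prescribed set while the values of \<open>\<Omega> (x, y)\<close> on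
  \<open>F\<close> are kept.

  This has three consequences. The restriction of an ergodic cocycle to a set \<open>U\<close> is ergodic, and
  its essential image does not shrink, because the values on pairs of \<open>U\<close> approximate all values
  (\<open>ergodic_cocycle_MU\<close>, \<open>essential_image_MU\<close>). Moreover the group \<open>H\<close> is independent of the ergodic
  index cocycle up to conjugacy (\<open>ergodic_index_cocycle_image_unique\<close>): two index cocycles are
  intertwined by bijections \<open>u x\<close> between the index sets, and after both ends of a pair have been
  moved to points where \<open>u\<close> agrees on a finite set with \<open>u x0\<close>, conjugation by \<open>u x0\<close> carries a value
  of one cocycle to a value of the other. The claims about \<open>H\<close> follow by transporting or restricting
  one representative and comparing it with another one there.

  The index cocycle itself is easily transported by an isomorphism (\<open>ergodic_index_cocycle_push\<close>).
  For a subset \<open>U\<close> the choice functions have to take values in \<open>U\<close>. The sets \<open>c i ` U\<close> and \<open>U\<close> have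
  equal measure, so the ergodic relation \<open>S\<close> contains a partial isomorphism between them up to null
  sets (\<open>ergodic_partial_iso\<close>), and composing it with \<open>c i\<close> does not change the \<open>S\<close>-classes
  (\<open>choice_functions_restrict\<close>).

  All of this presupposes that saturations are measurable, that saturations of null sets are null,
  and that a relation contains many partial isomorphisms. These are almost everywhere versions of
  the theorems of Lusin and Novikov and of Feldman and Moore. A standard Borel space is a measurable
  retract of the real line (\<open>standard_borel_real_retract\<close>), so they can be proved for Borel sets in
  the plane: such a set is a projection of a closed set, hence capacitable (\<open>capacity_compact\<close>), which
  makes its projection measurable and provides compact graphs inside it. If the fibres are
  countable, a non-negligible part of such a graph is injective
  (\<open>positive_injective_compact\<close>), because an essential fibre has an isolated point. The resulting
  partial isomorphisms preserve the measure, since pieces of them extend to involutions in the full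
  group (\<open>partial_iso_emeasure\<close>), and a null set with a non-null saturation would contain the range of
  one of them with a non-null domain (\<open>null_saturation\<close>).
\<close>


section \<open>Capacitability of Borel sets in the plane\<close>

text \<open>Closedness in the product with the Baire space, in terms of sequences: convergence in
  the second component means that every coordinate is eventually constant.\<close>

definition seq_closed :: "('p::topological_space \<times> (nat \<Rightarrow> nat)) set \<Rightarrow> bool" where
  "seq_closed F \<longleftrightarrow> (\<forall>p \<sigma> q \<tau>. (\<forall>n. (p n, \<sigma> n) \<in> F) \<and> p \<longlonglongrightarrow> q \<and>
      (\<forall>i. \<forall>\<^sub>F n in sequentially. \<sigma> n i = \<tau> i) \<longrightarrow> (q, \<tau>) \<in> F)"

definition souslin :: "'p::topological_space set \<Rightarrow> bool" where
  "souslin V \<longleftrightarrow> (\<exists>F. seq_closed F \<and> V = fst ` F)"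

lemma seq_closedD:
  assumes "seq_closed F" "\<And>n. (p n, \<sigma> n) \<in> F" "p \<longlonglongrightarrow> q"
    "\<And>i. \<forall>\<^sub>F n in sequentially. \<sigma> n i = \<tau> i"
  shows "(q, \<tau>) \<in> F"
  using assms unfolding seq_closed_def by blast

lemma souslin_closed:
  fixes V :: "'p::metric_space set"
  assumes "closed V"
  shows "souslin V"
proof -
  have "seq_closed (V \<times> (UNIV :: (nat \<Rightarrow> nat) set))"
    using assms unfolding seq_closed_def by (auto intro: closed_sequentially)
  then show ?thesis unfolding souslin_def by (intro exI[of _ "V \<times> UNIV"]) auto
qed

text \<open>The first term of the sequence records which of the sets is meant, the remaining terms
  are a witness for that set.\<close>

lemma souslin_UN:
  fixes V :: "nat \<Rightarrow> 'p::metric_space set"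
  assumes "\<And>n. souslin (V n)"
  shows "souslin (\<Union>n. V n)"
proof -
  obtain F where F: "\<And>n. seq_closed (F n)" "\<And>n. V n = fst ` F n"
    using assms unfolding souslin_def by metis
  define E where "E = {(p, \<sigma>). (p, \<lambda>i. \<sigma> (Suc i)) \<in> F (\<sigma> 0)}"
  have "seq_closed E"
    unfolding seq_closed_def
  proof (intro allI impI)
    fix p \<sigma> q and \<tau> :: "nat \<Rightarrow> nat"
    assume *: "(\<forall>n. (p n, \<sigma> n) \<in> E) \<and> p \<longlonglongrightarrow> q \<and> (\<forall>i. \<forall>\<^sub>F n in sequentially. \<sigma> n i = \<tau> i)"
    then obtain N where N: "\<And>n. n \<ge> N \<Longrightarrow> \<sigma> n 0 = \<tau> 0"
      unfolding eventually_sequentially by metis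
    have "(q, \<lambda>i. \<tau> (Suc i)) \<in> F (\<tau> 0)"
    proof (rule seq_closedD[OF F(1)])
      show "(p (n + N), \<lambda>i. \<sigma> (n + N) (Suc i)) \<in> F (\<tau> 0)" for n
      proof -
        have "(p (n + N), \<lambda>i. \<sigma> (n + N) (Suc i)) \<in> F (\<sigma> (n + N) 0)"
          using * unfolding E_def by blast
        then show ?thesis by (simp add: N)
      qed
      show "(\<lambda>n. p (n + N)) \<longlonglongrightarrow> q" using * by (simp add: LIMSEQ_ignore_initial_segment)
      show "\<forall>\<^sub>F n in sequentially. \<sigma> (n + N) (Suc i) = \<tau> (Suc i)" for i
        using * by (subst eventually_sequentially_seg) auto
    qed
    then show "(q, \<tau>) \<in> E" by (simp add: E_def)
  qed
  moreover have "(\<Union>n. V n) = fst ` E"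
  proof (intro equalityI subsetI)
    fix x assume "x \<in> (\<Union>n. V n)"
    then obtain n \<sigma> where "(x, \<sigma>) \<in> F n" using F(2) by auto
    then have "(x, case_nat n \<sigma>) \<in> E" by (simp add: E_def)
    then show "x \<in> fst ` E" by force
  next
    fix x assume "x \<in> fst ` E"
    then show "x \<in> (\<Union>n. V n)" using F(2) by (force simp: E_def)
  qed
  ultimately show ?thesis unfolding souslin_def by blast
qed

text \<open>A single sequence is split by the pairing function into one witness for each of the
  sets.\<close>

lemma souslin_INT:
  fixes V :: "nat \<Rightarrow> 'p::metric_space set"
  assumes "\<And>n. souslin (V n)"
  shows "souslin (\<Inter>n. V n)"
proof -
  obtain F where F: "\<And>n. seq_closed (F n)" "\<And>n. V n = fst ` F n"
    using assms unfolding souslin_def by metis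
  define E where "E = {(p, \<sigma>). \<forall>n. (p, \<lambda>i. \<sigma> (prod_encode (n, i))) \<in> F n}"
  have "seq_closed E"
    unfolding seq_closed_def
  proof (intro allI impI)
    fix p \<sigma> q and \<tau> :: "nat \<Rightarrow> nat"
    assume *: "(\<forall>n. (p n, \<sigma> n) \<in> E) \<and> p \<longlonglongrightarrow> q \<and> (\<forall>i. \<forall>\<^sub>F n in sequentially. \<sigma> n i = \<tau> i)"
    have "(q, \<lambda>i. \<tau> (prod_encode (m, i))) \<in> F m" for m
      by (rule seq_closedD[OF F(1), of p "\<lambda>n i. \<sigma> n (prod_encode (m, i))"]) (use * in \<open>auto simp: E_def\<close>)
    then show "(q, \<tau>) \<in> E" by (simp add: E_def)
  qed
  moreover have "(\<Inter>n. V n) = fst ` E"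
  proof (intro equalityI subsetI)
    fix x assume "x \<in> (\<Inter>n. V n)"
    then have "\<forall>n. \<exists>\<sigma>. (x, \<sigma>) \<in> F n" using F(2) by force
    then obtain s where s: "\<And>n. (x, s n) \<in> F n" by metis
    have "(x, \<lambda>k. s (fst (prod_decode k)) (snd (prod_decode k))) \<in> E" using s by (simp add: E_def)
    then show "x \<in> fst ` E" by force
  next
    fix x assume "x \<in> fst ` E"
    then show "x \<in> (\<Inter>n. V n)" using F(2) by (force simp: E_def)
  qed
  ultimately show ?thesis unfolding souslin_def by blast
qed

lemma souslin_open:
  fixes V :: "'p::euclidean_space set"
  assumes "open V"
  shows "souslin V"
proof -
  obtain C :: "nat \<Rightarrow> 'p set" where C: "\<And>n. compact (C n)" "\<And>n. C n \<subseteq> V" "\<Union> (range C) = V"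
    using open_Union_compact_subsets[OF assms] by metis
  then show ?thesis using souslin_UN[of C] souslin_closed compact_imp_closed by metis
qed

text \<open>The class of Souslin sets is not closed under complements, so the induction over the
  Borel sets carries the property for the set and for its complement together.\<close>

lemma souslin_borel:
  fixes V :: "'p::euclidean_space set"
  assumes "V \<in> sets borel"
  shows "souslin V"
proof -
  have "V \<in> sigma_sets UNIV {S. open S}" using assms by (simp add: borel_def)
  then have "souslin V \<and> souslin (- V)"
  proof induction
    case (Basic a)
    then show ?case using souslin_open[of a] souslin_closed[of "- a"] by auto
  next
    case Empty
    then show ?case by (simp add: souslin_closed)
  next
    case (Compl a)
    then show ?case by (simp add: Compl_eq_Diff_UNIV double_diff)
  next
    case (Union a)
    then show ?case using souslin_UN[of a] souslin_INT[of "\<lambda>n. - a n"] by (simp add: Compl_UN)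
  qed
  then show ?thesis ..
qed

text \<open>Tychonoff for a product of finite sets, realised as a compact set of real
  sequences.\<close>

lemma bounded_nat_sequences_subconverge:
  fixes \<sigma> :: "nat \<Rightarrow> nat \<Rightarrow> nat"
  assumes "\<And>n i. \<sigma> n i \<le> b i"
  shows "\<exists>r. strict_mono r \<and> (\<exists>\<tau>. \<forall>i. \<forall>\<^sub>F n in sequentially. \<sigma> (r n) i = \<tau> i)"
proof -
  define K :: "(nat \<Rightarrow> real) set" where "K = PiE UNIV (\<lambda>i. {0..real (b i)})"
  have "compactin (product_topology (\<lambda>i. euclidean) UNIV) K"
    unfolding K_def by (subst compactin_PiE) auto
  then have "compact K" by (simp add: euclidean_product_topology)
  then have "seq_compact K" by (simp add: compact_eq_seq_compact_metric)
  moreover have "\<forall>n. (\<lambda>i. real (\<sigma> n i)) \<in> K" using assms by (auto simp: K_def)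
  ultimately obtain l r where l: "l \<in> K" "strict_mono r" "((\<lambda>n i. real (\<sigma> n i)) \<circ> r) \<longlonglongrightarrow> l"
    unfolding seq_compact_def by metis
  have lim: "(\<lambda>n. real (\<sigma> (r n) i)) \<longlonglongrightarrow> l i" for i
  proof -
    have "continuous_on UNIV (\<lambda>f::nat \<Rightarrow> real. f i)" by (rule continuous_on_product_coordinates)
    then show ?thesis using continuous_on_tendsto_compose[OF _ l(3), of UNIV "\<lambda>f. f i"] by (simp add: comp_def)
  qed
  have "\<exists>t. \<forall>\<^sub>F n in sequentially. \<sigma> (r n) i = t" for i
  proof -
    from LIMSEQ_imp_Cauchy[OF lim[of i]] obtain N where
      N: "\<And>m n. m \<ge> N \<Longrightarrow> n \<ge> N \<Longrightarrow> dist (real (\<sigma> (r m) i)) (real (\<sigma> (r n) i)) < 1"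
      unfolding Cauchy_def by (metis zero_less_one)
    have "\<sigma> (r n) i = \<sigma> (r N) i" if "n \<ge> N" for n
      using N[OF that order_refl] by (simp add: dist_real_def)
    then show ?thesis unfolding eventually_sequentially by blast
  qed
  then have "\<exists>\<tau>. \<forall>i. \<forall>\<^sub>F n in sequentially. \<sigma> (r n) i = \<tau> i"
    by (intro choice allI)
  then show ?thesis using l(2) by blast
qed

lemma fst_INT_decseq_compact:
  fixes C :: "nat \<Rightarrow> (real \<times> real) set"
  assumes "\<And>n. compact (C n)" "decseq C"
  shows "fst ` (\<Inter>n. C n) = (\<Inter>n. fst ` C n)"
proof (intro equalityI subsetI)
  fix x assume x: "x \<in> (\<Inter>n. fst ` C n)"
  have "(\<Inter>n. C n \<inter> {x} \<times> UNIV) \<noteq> {}"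
  proof (rule compact_nest)
    show "compact (C n \<inter> {x} \<times> UNIV)" for n
      by (intro compact_Int_closed assms closed_Times) auto
    show "C n \<inter> {x} \<times> UNIV \<noteq> {}" for n
    proof -
      have "x \<in> fst ` C n" using x by blast
      then show ?thesis by force
    qed
    show "C n \<inter> {x} \<times> UNIV \<subseteq> C m \<inter> {x} \<times> UNIV" if "m \<le> n" for m n
      using decseqD[OF assms(2) that] by auto
  qed
  then obtain z where "z \<in> (\<Inter>n. C n \<inter> {x} \<times> UNIV)" by blast
  then have z: "\<And>n. z \<in> C n" "fst z = x" by auto
  then have "z \<in> (\<Inter>n. C n)" by blast
  then show "x \<in> fst ` (\<Inter>n. C n)" using z(2) by (intro image_eqI[of x fst z]) auto
qed auto

text \<open>Choquet's argument. The outer measure of the projection is continuous along increasing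
  unions, so bounds \<open>b n\<close> for the size of the point and for the successive terms of its
  witness can be imposed one after the other without losing more than the given margin. The closures
  of the bounded pieces are compact and decreasing. Their intersection lies in the set because
  bounded witnesses have convergent subsequences, and its projection has the right measure because
  the measure is continuous along decreasing sequences.\<close>

theorem capacity_compact:
  fixes V :: "(real \<times> real) set"
  assumes V: "V \<in> sets borel" and \<mu>: "finite_measure \<mu>" "sets \<mu> = sets borel"
    and c: "c < outer_measure_of \<mu> (fst ` V)"
  obtains C where "compact C" "C \<subseteq> V" "c \<le> emeasure \<mu> (fst ` C)"
proof -
  interpret finite_measure \<mu> by fact
  have sp: "space \<mu> = UNIV" using sets_eq_imp_space_eq[OF \<mu>(2)] by simp
  obtain F where F: "seq_closed F" "V = fst ` F" using souslin_borel[OF V] unfolding souslin_def by blast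
  \<comment> \<open>Entry 0 bounds the point itself, entry \<open>Suc i\<close> is term
    \<open>i\<close> of the witness.\<close>
  define q :: "(real \<times> real) \<times> (nat \<Rightarrow> nat) \<Rightarrow> nat \<Rightarrow> nat" where
    "q = (\<lambda>z. case_nat (nat \<lceil>norm (fst z)\<rceil>) (snd z))"
  define \<pi> :: "((real \<times> real) \<times> (nat \<Rightarrow> nat)) set \<Rightarrow> real set" where "\<pi> = (\<lambda>A. fst ` fst ` A)"
  have "\<exists>A. \<forall>n. ((n = 0 \<longrightarrow> A n = F) \<and> c < outer_measure_of \<mu> (\<pi> (A n))) \<and> (\<exists>m. A (Suc n) = {z \<in> A n. q z n \<le> m})"
  proof (rule dependent_nat_choice)
    show "\<exists>A. ((0::nat) = 0 \<longrightarrow> A = F) \<and> c < outer_measure_of \<mu> (\<pi> A)" using c F(2) by (auto simp: \<pi>_def)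
  next
    fix A and n :: nat
    assume A: "(n = 0 \<longrightarrow> A = F) \<and> c < outer_measure_of \<mu> (\<pi> A)"
    have "(\<Union>m. \<pi> {z \<in> A. q z n \<le> m}) = \<pi> A" by (force simp: \<pi>_def)
    moreover have "(SUP m. outer_measure_of \<mu> (\<pi> {z \<in> A. q z n \<le> m})) = outer_measure_of \<mu> (\<Union>m. \<pi> {z \<in> A. q z n \<le> m})"
    proof (rule SUP_outer_measure_of_incseq)
      show "incseq (\<lambda>m. \<pi> {z \<in> A. q z n \<le> m})" unfolding incseq_def \<pi>_def
        by (intro allI impI image_mono) auto
    qed (simp add: sp)
    ultimately obtain m where "c < outer_measure_of \<mu> (\<pi> {z \<in> A. q z n \<le> m})"
      using A by (metis (no_types, lifting) less_SUP_iff)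
    then show "\<exists>B. ((Suc n = 0 \<longrightarrow> B = F) \<and> c < outer_measure_of \<mu> (\<pi> B)) \<and> (\<exists>m. B = {z \<in> A. q z n \<le> m})"
      by auto
  qed
  then obtain A where A0: "A 0 = F" and Ac: "\<And>n. c < outer_measure_of \<mu> (\<pi> (A n))"
    and ex: "\<forall>n. \<exists>m. A (Suc n) = {z \<in> A n. q z n \<le> m}" by blast
  obtain b where AS: "\<And>n. A (Suc n) = {z \<in> A n. q z n \<le> b n}"
    using choice[OF ex] by blast
  have A: "A n = {z \<in> F. \<forall>i<n. q z i \<le> b i}" for n
    by (induction n) (auto simp: A0 AS less_Suc_eq)
  define C where "C n = closure (fst ` A (Suc n))" for n
  have C_compact: "compact (C n)" for n
  proof -
    have "norm p \<le> real (b 0)" if "p \<in> fst ` A (Suc n)" for p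
    proof -
      obtain z where "z \<in> A (Suc n)" "p = fst z" using \<open>p \<in> fst ` A (Suc n)\<close> by blast
      then have "q z 0 \<le> b 0" unfolding A by blast
      then show ?thesis using \<open>p = fst z\<close> by (simp add: q_def nat_le_iff ceiling_le_iff)
    qed
    then have "bounded (fst ` A (Suc n))" unfolding bounded_iff by blast
    then show ?thesis by (simp add: C_def)
  qed
  have C_dec: "decseq C" unfolding C_def decseq_def
    by (intro allI impI closure_mono image_mono) (auto simp: A)
  have C_V: "(\<Inter>n. C n) \<subseteq> V"
  proof
    fix p assume p: "p \<in> (\<Inter>n. C n)"
    have "\<exists>z\<in>A (Suc n). dist (fst z) p < inverse (Suc n)" for n
    proof -
      have "p \<in> closure (fst ` A (Suc n))" using p by (auto simp: C_def)
      then show ?thesis unfolding closure_approachable by (metis (no_types, lifting) imageE inverse_positive_iff_positive of_nat_0_less_iff zero_less_Suc)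
    qed
    then obtain z where z: "\<And>n. z n \<in> A (Suc n)" "\<And>n. dist (fst (z n)) p < inverse (Suc n)" by metis
    \<comment> \<open>The \<open>n\<close>-th witness is only bounded in its first
      \<open>n\<close> terms; truncation bounds all of them and does not affect the limit.\<close>
    have "\<exists>r. strict_mono r \<and> (\<exists>\<tau>. \<forall>i. \<forall>\<^sub>F n in sequentially. min (snd (z (r n)) i) (b (Suc i)) = \<tau> i)"
      by (rule bounded_nat_sequences_subconverge[of _ "\<lambda>i. b (Suc i)"]) simp
    then obtain r \<tau> where r: "strict_mono r" "\<And>i. \<forall>\<^sub>F n in sequentially. min (snd (z (r n)) i) (b (Suc i)) = \<tau> i"
      by blast
    have "(\<lambda>n. fst (z n)) \<longlonglongrightarrow> p"
    proof (rule tendsto_dist_iff[THEN iffD2], rule real_tendsto_sandwich[where f = "\<lambda>_. 0" and h = "\<lambda>n. inverse (real (Suc n))"])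
      show "\<forall>\<^sub>F n in sequentially. 0 \<le> dist (fst (z n)) p" by simp
      show "\<forall>\<^sub>F n in sequentially. dist (fst (z n)) p \<le> inverse (real (Suc n))"
        by (rule always_eventually) (use z(2) less_imp_le in blast)
      show "((\<lambda>_. 0::real) \<longlongrightarrow> 0) sequentially" by simp
      show "(\<lambda>n. inverse (real (Suc n))) \<longlonglongrightarrow> 0" by (rule LIMSEQ_inverse_real_of_nat)
    qed
    then have l: "(\<lambda>n. fst (z (r n))) \<longlonglongrightarrow> p" using LIMSEQ_subseq_LIMSEQ[OF _ r(1), of "\<lambda>n. fst (z n)"] unfolding comp_def by blast
    have "(p, \<tau>) \<in> F"
    proof (rule seq_closedD[OF F(1) _ l])
      show "(fst (z (r n)), snd (z (r n))) \<in> F" for n using z(1)[of "r n"] by (simp add: A)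
      show "\<forall>\<^sub>F n in sequentially. snd (z (r n)) i = \<tau> i" for i
        using r(2)[of i] eventually_ge_at_top[of "Suc i"]
      proof eventually_elim
        case (elim n)
        have "Suc i < Suc (r n)" using elim seq_suble[OF r(1), of n] by simp
        then have "q (z (r n)) (Suc i) \<le> b (Suc i)" using z(1)[of "r n"] unfolding A by blast
        then show ?case using elim by (simp add: q_def)
      qed
    qed
    then show "p \<in> V" using F(2) by force
  qed
  have cmp: "compact (fst ` K)" if "compact K" for K :: "(real \<times> real) set"
    using that by (intro compact_continuous_image continuous_intros)
  have "c \<le> emeasure \<mu> (fst ` C n)" for n
  proof -
    have "\<pi> (A (Suc n)) \<subseteq> fst ` C n" unfolding \<pi>_def C_def using closure_subset by blast
    then have "outer_measure_of \<mu> (\<pi> (A (Suc n))) \<le> outer_measure_of \<mu> (fst ` C n)" by (rule outer_measure_of_mono)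
    also have "\<dots> = emeasure \<mu> (fst ` C n)" using borel_compact[OF cmp[OF C_compact]] \<mu>(2) by (intro outer_measure_of_eq) simp
    finally show ?thesis using Ac[of "Suc n"] by simp
  qed
  then have "c \<le> (INF n. emeasure \<mu> (fst ` C n))" by (rule INF_greatest)
  also have "\<dots> = emeasure \<mu> (\<Inter>n. fst ` C n)"
  proof (rule INF_emeasure_decseq)
    show "range (\<lambda>n. fst ` C n) \<subseteq> sets \<mu>" using borel_compact[OF cmp[OF C_compact]] \<mu>(2) by blast
    show "decseq (\<lambda>n. fst ` C n)" using C_dec unfolding decseq_def by (meson image_mono)
  qed simp
  also have "\<dots> = emeasure \<mu> (fst ` (\<Inter>n. C n))" by (simp add: fst_INT_decseq_compact[OF C_compact C_dec])
  finally have "c \<le> emeasure \<mu> (fst ` (\<Inter>n. C n))" .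
  moreover have "compact (\<Inter>n. C n)" using C_compact by (intro compact_Inter) auto
  ultimately show ?thesis using that C_V by blast
qed

section \<open>Measurable projections and injective compact graphs\<close>

lemma emeasure_hull_null:
  assumes "outer_measure_of \<mu> A = 0" "A \<subseteq> space \<mu>"
  shows "AE x in \<mu>. x \<notin> A"
proof -
  obtain E where "E \<in> sets \<mu>" "A \<subseteq> E" "emeasure \<mu> E = 0"
    using outer_measure_of_attain[OF assms(2)] assms(1) by metis
  then show ?thesis by (intro AE_I'[of E]) auto
qed

lemma compact_fst_image: "compact C \<Longrightarrow> compact (fst ` (C :: (real \<times> real) set))"
  by (intro compact_continuous_image continuous_intros)

lemma borel_fst_compact: "compact C \<Longrightarrow> fst ` (C :: (real \<times> real) set) \<in> sets borel"
  by (intro borel_compact compact_fst_image)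

lemma compact_snd_image: "compact C \<Longrightarrow> compact (snd ` (C :: (real \<times> real) set))"
  by (intro compact_continuous_image continuous_intros)

text \<open>The projections of countably many compact subsets exhaust the outer measure of the
  projection, by capacitability.\<close>

lemma projection_measurable_real:
  fixes V :: "(real \<times> real) set"
  assumes V: "V \<in> sets borel" and \<mu>: "finite_measure \<mu>" "sets \<mu> = sets borel"
  obtains D where "D \<in> sets borel" "D \<subseteq> fst ` V" "AE x in \<mu>. x \<in> fst ` V \<longrightarrow> x \<in> D"
proof -
  interpret finite_measure \<mu> by fact
  have sp: "space \<mu> = UNIV" using sets_eq_imp_space_eq[OF \<mu>(2)] by simp
  define S where "S = {emeasure \<mu> (fst ` C) |C. compact C \<and> C \<subseteq> V}"
  have "emeasure \<mu> (fst ` {}) \<in> S" unfolding S_def by (intro CollectI exI[of _ "{}"]) simp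
  then obtain f :: "nat \<Rightarrow> ennreal" where f: "range f \<subseteq> S" "Sup S = (SUP i. f i)"
    using ennreal_Sup_countable_SUP[of S] by blast
  then have "\<forall>n. \<exists>C. compact C \<and> C \<subseteq> V \<and> f n = emeasure \<mu> (fst ` C)" unfolding S_def by auto
  then obtain C where C: "\<And>n. compact (C n)" "\<And>n. C n \<subseteq> V" "\<And>n. f n = emeasure \<mu> (fst ` C n)" by metis
  define D where "D = (\<Union>n. fst ` C n)"
  have D: "D \<in> sets borel" unfolding D_def using borel_fst_compact[OF C(1)] by (intro sets.countable_UN) blast
  have DV: "D \<subseteq> fst ` V" unfolding D_def using C(2) by blast
  obtain E where E: "E \<in> sets \<mu>" "fst ` V \<subseteq> E" "outer_measure_of \<mu> (fst ` V) = emeasure \<mu> E"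
    using outer_measure_of_attain[of "fst ` V" \<mu>] sp by auto
  have "emeasure \<mu> E \<le> emeasure \<mu> D"
  proof (rule dense_le)
    fix c assume "c < emeasure \<mu> E"
    then obtain K where "compact K" "K \<subseteq> V" "c \<le> emeasure \<mu> (fst ` K)"
      using capacity_compact[OF V \<mu>] E(3) by metis
    then have "c \<le> Sup S" unfolding S_def by (intro Sup_upper2) auto
    also have "Sup S \<le> emeasure \<mu> D" unfolding f(2)
      by (intro SUP_least) (use C D \<mu>(2) in \<open>auto simp: D_def intro!: emeasure_mono\<close>)
    finally show "c \<le> emeasure \<mu> D" .
  qed
  moreover have "emeasure \<mu> (E - D) = emeasure \<mu> E - emeasure \<mu> D"
    using D E DV \<mu>(2) by (intro emeasure_Diff) auto
  ultimately have "emeasure \<mu> (E - D) = 0"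
    using emeasure_finite[of E] by (simp add: diff_eq_0_iff_ennreal less_top[symmetric])
  then have "E - D \<in> null_sets \<mu>" using D E \<mu>(2) by (auto intro!: null_setsI)
  then have "AE x in \<mu>. x \<notin> E - D" by (rule AE_not_in)
  then have "AE x in \<mu>. x \<in> fst ` V \<longrightarrow> x \<in> D" using E(2) by (auto elim!: eventually_mono)
  then show ?thesis using that D DV by blast
qed

lemma positive_compact:
  fixes V :: "(real \<times> real) set"
  assumes V: "V \<in> sets borel" and \<mu>: "finite_measure \<mu>" "sets \<mu> = sets borel"
    and pos: "\<not> (AE x in \<mu>. x \<notin> fst ` V)"
  obtains C where "compact C" "C \<subseteq> V" "0 < emeasure \<mu> (fst ` C)"
proof -
  have sp: "space \<mu> = UNIV" using sets_eq_imp_space_eq[OF \<mu>(2)] by simp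
  have "outer_measure_of \<mu> (fst ` V) \<noteq> 0" using pos emeasure_hull_null[of \<mu> "fst ` V"] sp by auto
  then have "0 < outer_measure_of \<mu> (fst ` V)" by (simp add: zero_less_iff_neq_zero)
  then obtain c where "0 < c" "c < outer_measure_of \<mu> (fst ` V)" using dense by blast
  then show ?thesis using capacity_compact[OF V \<mu>, of c] that by (metis order_less_le_trans)
qed

lemma borel_pairI:
  fixes A B :: "real set"
  assumes "A \<in> sets borel" "B \<in> sets borel"
  shows "A \<times> B \<in> sets (borel :: (real \<times> real) measure)"
  unfolding borel_prod[symmetric] using assms by (rule pair_measureI)

text \<open>A compact set contains the graph of the lower envelope of its fibres. This graph is only
  Borel, so capacitability is applied to it once more.\<close>

lemma positive_compact_graph:
  fixes V :: "(real \<times> real) set"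
  assumes V: "V \<in> sets borel" and \<mu>: "finite_measure \<mu>" "sets \<mu> = sets borel"
    and pos: "\<not> (AE x in \<mu>. x \<notin> fst ` V)"
  obtains C where "compact C" "C \<subseteq> V" "0 < emeasure \<mu> (fst ` C)" "inj_on fst C"
proof -
  obtain C where C: "compact C" "C \<subseteq> V" "0 < emeasure \<mu> (fst ` C)"
    using positive_compact[OF assms] by blast
  define G where "G = C - (\<Union>q\<in>\<rat>. (fst ` (C \<inter> UNIV \<times> {..q})) \<times> {q<..})"
  have "fst ` (C \<inter> UNIV \<times> {..q}) \<in> sets borel" for q :: real
    by (intro borel_fst_compact compact_Int_closed C closed_Times) auto
  then have G: "G \<in> sets borel" unfolding G_def
    using borel_compact[OF C(1)] countable_rat by (intro sets.Diff sets.countable_UN') (auto intro!: borel_pairI)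
  have inj: "inj_on fst G"
  proof -
    have *: False if 1: "(x, y) \<in> G" and 2: "(x, y') \<in> G" and "y < y'" for x y y'
    proof -
      obtain q where q: "q \<in> \<rat>" "y < q" "q < y'" using Rats_dense_in_real[OF \<open>y < y'\<close>] by blast
      have "(x, y) \<in> C" using 1 by (simp add: G_def)
      then have "x \<in> fst ` (C \<inter> UNIV \<times> {..q})" using q by (intro image_eqI[of _ _ "(x, y)"]) auto
      then have "(x, y') \<in> (\<Union>q\<in>\<rat>. (fst ` (C \<inter> UNIV \<times> {..q})) \<times> {q<..})" using q by blast
      then show False using 2 by (simp add: G_def)
    qed
    then show ?thesis by (intro inj_onI) (metis linorder_neqE_linordered_idom prod.collapse)
  qed
  have "fst ` C \<subseteq> fst ` G"
  proof
    fix x assume "x \<in> fst ` C"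
    then have ne: "C \<inter> {x} \<times> UNIV \<noteq> {}" by force
    have "compact (C \<inter> {x} \<times> UNIV)" by (intro compact_Int_closed C closed_Times) auto
    then have "compact (snd ` (C \<inter> {x} \<times> UNIV))" by (rule compact_snd_image)
    then obtain y where y: "y \<in> snd ` (C \<inter> {x} \<times> UNIV)" "\<forall>t\<in>snd ` (C \<inter> {x} \<times> UNIV). y \<le> t"
      using compact_attains_inf ne by (metis image_is_empty)
    then have "(x, y) \<in> C" by auto
    moreover have "\<And>t. (x, t) \<in> C \<Longrightarrow> y \<le> t" using y(2) by force
    ultimately have "(x, y) \<in> G" unfolding G_def by fastforce
    then show "x \<in> fst ` G" by force
  qed
  then have "\<not> (AE x in \<mu>. x \<notin> fst ` G)"
  proof (intro notI)
    assume "fst ` C \<subseteq> fst ` G" "AE x in \<mu>. x \<notin> fst ` G"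
    then have "AE x in \<mu>. x \<notin> fst ` C" by (auto elim!: eventually_mono)
    then have "emeasure \<mu> (fst ` C) = 0"
      using borel_fst_compact[OF C(1)] \<mu>(2) by (subst (asm) AE_iff_null_sets[symmetric]) auto
    then show False using C(3) by simp
  qed
  then obtain C' where "compact C'" "C' \<subseteq> G" "0 < emeasure \<mu> (fst ` C')" using positive_compact[OF G \<mu>] by blast
  then show ?thesis using that[of C'] C(2) inj inj_on_subset unfolding G_def by blast
qed

text \<open>Take the set where the Radon--Nikodym derivative of \<open>m\<close> does not
  vanish.\<close>

lemma essential_support:
  assumes \<rho>: "finite_measure \<rho>" and m: "sets m = sets \<rho>" "finite_measure m"
    and le: "\<And>A. A \<in> sets \<rho> \<Longrightarrow> emeasure m A \<le> emeasure \<rho> A"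
  obtains E where "E \<in> sets \<rho>" "emeasure m (space \<rho> - E) = 0"
    "\<And>A. A \<in> sets \<rho> \<Longrightarrow> A \<subseteq> E \<Longrightarrow> emeasure m A = 0 \<Longrightarrow> emeasure \<rho> A = 0"
proof -
  interpret finite_measure \<rho> by fact
  have "absolutely_continuous \<rho> m"
    unfolding absolutely_continuous_def
  proof
    fix A assume "A \<in> null_sets \<rho>"
    then show "A \<in> null_sets m" using le[of A] m(1) by (auto simp: null_sets_def)
  qed
  then have d: "density \<rho> (RN_deriv \<rho> m) = m" using m(1) by (intro density_RN_deriv) auto
  define E where "E = {x \<in> space \<rho>. RN_deriv \<rho> m x \<noteq> 0}"
  have E: "E \<in> sets \<rho>" unfolding E_def by measurable
  have null: "A \<in> null_sets m \<longleftrightarrow> A \<in> sets \<rho> \<and> (AE x in \<rho>. x \<in> A \<longrightarrow> RN_deriv \<rho> m x = 0)" for A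
    by (subst d[symmetric], subst null_sets_density_iff) auto
  show ?thesis
  proof (rule that[OF E])
    have "space \<rho> - E \<in> null_sets m" using E by (subst null) (auto simp: E_def)
    then show "emeasure m (space \<rho> - E) = 0" by auto
    fix A assume A: "A \<in> sets \<rho>" "A \<subseteq> E" "emeasure m A = 0"
    then have "A \<in> null_sets m" using m(1) by auto
    then have "AE x in \<rho>. x \<in> A \<longrightarrow> RN_deriv \<rho> m x = 0" by (simp add: null)
    then have "AE x in \<rho>. x \<notin> A" using A(2) by (auto simp: E_def elim!: eventually_mono)
    then show "emeasure \<rho> A = 0" using A(1) by (subst (asm) AE_iff_null_sets[symmetric]) auto
  qed
qed

text \<open>By the Baire category theorem: otherwise the complements of the points of the set would
  be dense in it, with empty intersection.\<close>

lemma countable_closed_isolated: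
  fixes S :: "real set"
  assumes "closed S" "countable S" "S \<noteq> {}"
  obtains y a b where "y \<in> S" "a \<in> \<rat>" "b \<in> \<rat>" "a < y" "y < b" "S \<inter> {a<..<b} = {y}"
proof -
  have "\<exists>y\<in>S. \<not> y islimpt S"
  proof (rule ccontr)
    assume "\<not> ?thesis"
    then have lim: "\<And>y. y \<in> S \<Longrightarrow> y islimpt S" by blast
    have "S \<subseteq> closure (\<Inter>((\<lambda>y. S - {y}) ` S))"
    proof (rule Baire[OF assms(1)])
      fix T assume "T \<in> (\<lambda>y. S - {y}) ` S"
      then obtain y where y: "y \<in> S" "T = S - {y}" by blast
      have "openin (top_of_set S) T" unfolding y(2) openin_open by (intro exI[of _ "- {y}"]) auto
      moreover have "S \<subseteq> closure T"
      proof
        fix z assume "z \<in> S"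
        then show "z \<in> closure T" using lim[OF y(1)] y
          by (cases "z = y") (auto simp: islimpt_in_closure intro: subsetD[OF closure_subset])
      qed
      ultimately show "openin (top_of_set S) T \<and> S \<subseteq> closure T" ..
    qed (use assms(2) in simp)
    moreover have "\<Inter>((\<lambda>y. S - {y}) ` S) = {}" using assms(3) by blast
    ultimately show False using assms(3) by simp
  qed
  then obtain y U where y: "y \<in> S" "open U" "y \<in> U" "\<And>z. z \<in> S \<Longrightarrow> z \<in> U \<Longrightarrow> z = y"
    unfolding islimpt_def by blast
  obtain e where e: "e > 0" "\<And>z. dist z y < e \<Longrightarrow> z \<in> U"
    using y(2,3) unfolding open_dist by blast
  obtain a where a: "a \<in> \<rat>" "y - e < a" "a < y" using Rats_dense_in_real[of "y - e" y] e by auto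
  obtain b where b: "b \<in> \<rat>" "y < b" "b < y + e" using Rats_dense_in_real[of y "y + e"] e by auto
  have "S \<inter> {a<..<b} = {y}"
  proof (intro equalityI subsetI)
    fix z assume "z \<in> S \<inter> {a<..<b}"
    moreover from this have "dist z y < e" using a b by (auto simp: dist_real_def)
    ultimately show "z \<in> {y}" using y(4) e(2) by auto
  qed (use y(1) a(3) b(2) in simp)
  then show ?thesis by (rule that[OF y(1) a(1) b(1) a(3) b(2)])
qed

lemma AE_rational_pairs:
  fixes P :: "real \<Rightarrow> real \<Rightarrow> 'a \<Rightarrow> bool"
  assumes "\<And>a b. a \<in> \<rat> \<Longrightarrow> b \<in> \<rat> \<Longrightarrow> AE x in M. P a b x"
  shows "AE x in M. \<forall>a\<in>\<rat>. \<forall>b\<in>\<rat>. P a b x"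
  by (intro AE_ball_countable' countable_rat assms)

lemma finite_measure_densityI:
  assumes "finite_measure \<mu>" "A \<in> sets \<mu>"
  shows "finite_measure (density \<mu> (indicator A))"
proof (rule finite_measureI)
  have "emeasure (density \<mu> (indicator A)) (space \<mu>) = emeasure \<mu> (A \<inter> space \<mu>)"
    using assms(2) by (intro emeasure_restricted) auto
  then show "emeasure (density \<mu> (indicator A)) (space (density \<mu> (indicator A))) \<noteq> \<infinity>"
    using finite_measure.emeasure_finite[OF assms(1), of "A \<inter> space \<mu>"] by simp
qed

text \<open>Let \<open>f\<close> be the function whose graph is the compact set obtained so far. Its
  fibres are countable. The set \<open>E a b\<close> consists of the values that \<open>f\<close>
  takes on the interval from \<open>a\<close> to \<open>b\<close> with positive mass, and the
  essential fibre over \<open>t\<close> (the set of \<open>y\<close> with \<open>(t, y) \<in>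
  Supp\<close>) consists of the points all of whose neighbourhoods have positive mass over
  \<open>t\<close>. It is a closed subset of the fibre, so it is countable and has an isolated
  point. Hence for some rational interval the set \<open>W a b\<close> of those \<open>t\<close> for
  which the interval contains exactly one point of the essential fibre is not null. Above \<open>W a
  b\<close> almost all of the mass in the interval sits at these single points, and \<open>f\<close>
  is injective on them. The genuine fibre would not do: its isolated points may form a null
  set.\<close>

theorem positive_injective_compact:
  fixes V :: "(real \<times> real) set"
  assumes V: "V \<in> sets borel" and \<mu>: "finite_measure \<mu>" "sets \<mu> = sets borel"
    and pos: "\<not> (AE x in \<mu>. x \<notin> fst ` V)"
    and ctbl: "\<And>y. countable {x. (x, y) \<in> V}"
  obtains C where "compact C" "C \<subseteq> V" "0 < emeasure \<mu> (fst ` C)" "inj_on fst C" "inj_on snd C"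
proof -
  have sp: "space \<mu> = UNIV" using sets_eq_imp_space_eq[OF \<mu>(2)] by simp
  obtain C where C: "compact C" "C \<subseteq> V" "0 < emeasure \<mu> (fst ` C)" "inj_on fst C"
    using positive_compact_graph[OF V \<mu> pos] by blast
  define K where "K = fst ` C"
  have K: "K \<in> sets borel" unfolding K_def by (rule borel_fst_compact[OF C(1)])
  define f where "f x = (if x \<in> K then THE y. (x, y) \<in> C else 0)" for x
  have f_eq: "f x = y" if "(x, y) \<in> C" for x y
  proof -
    have "(THE y. (x, y) \<in> C) = y"
      using that C(4) by (intro the_equality) (auto dest: inj_onD[of fst C "(x, _)" "(x, y)"])
    moreover have "x \<in> K" unfolding K_def using that by force
    ultimately show ?thesis by (simp add: f_def)
  qed
  have fC: "(x, f x) \<in> C" if "x \<in> K" for x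
    using that f_eq unfolding K_def by auto
  have f[measurable]: "f \<in> borel_measurable borel"
  proof (rule borel_measurableI_ge)
    fix a :: real
    have "{x \<in> space borel. a \<le> f x} = fst ` (C \<inter> UNIV \<times> {a..}) \<union> (if a \<le> 0 then - K else {})"
      (is "?L = ?R")
    proof (intro equalityI subsetI)
      fix x assume "x \<in> ?L"
      then show "x \<in> ?R" using fC[of x] by (cases "x \<in> K") (force simp: f_def)+
    next
      fix x assume "x \<in> ?R"
      then consider y where "(x, y) \<in> C" "a \<le> y" | "a \<le> 0" "x \<notin> K" by (auto split: if_splits)
      then show "x \<in> ?L"
      proof cases
        case 1
        then show ?thesis using f_eq[of x y] by simp
      next
        case 2
        then show ?thesis by (simp add: f_def)
      qed
    qed
    moreover have "fst ` (C \<inter> UNIV \<times> {a..}) \<in> sets borel"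
      by (intro borel_fst_compact compact_Int_closed C closed_Times) auto
    ultimately show "{x \<in> space borel. a \<le> f x} \<in> sets borel" using K by simp
  qed
  have f\<mu>: "f \<in> borel_measurable \<mu>" using f measurable_cong_sets[OF \<mu>(2) refl] by blast
  define m where "m p = distr (density \<mu> (indicator (K \<inter> p))) borel f" for p :: "real set"
  have m: "emeasure (m p) A = emeasure \<mu> (K \<inter> p \<inter> f -` A)"
    if "p \<in> sets borel" "A \<in> sets borel" for p A
  proof -
    have "f -` A \<in> sets borel" using measurable_sets[OF f that(2)] by simp
    then show ?thesis using that K \<mu>(2) f\<mu> unfolding m_def
      by (simp add: emeasure_distr emeasure_restricted sp)
  qed
  have m_sets[simp]: "sets (m p) = sets borel" "space (m p) = UNIV" for p by (simp_all add: m_def)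
  have m_fin: "finite_measure (m p)" if "p \<in> sets borel" for p
    unfolding m_def using that K \<mu> f\<mu>
    by (intro finite_measure.finite_measure_distr finite_measure_densityI) simp_all
  define \<rho> where "\<rho> = m UNIV"
  have \<rho>: "finite_measure \<rho>" "sets \<rho> = sets borel" "space \<rho> = UNIV" using m_fin by (simp_all add: \<rho>_def)
  have m_le: "emeasure (m p) A \<le> emeasure \<rho> A" if "p \<in> sets borel" "A \<in> sets borel" for p A
  proof -
    have "f -` A \<in> sets borel" using measurable_sets[OF f that(2)] by simp
    then show ?thesis unfolding \<rho>_def using that K \<mu>(2) by (subst (1 2) m) (auto intro!: emeasure_mono)
  qed
  define is_supp where "is_supp a b E \<longleftrightarrow> E \<in> sets borel \<and> emeasure (m {a<..<b}) (- E) = 0 \<and>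
      (\<forall>A\<in>sets borel. A \<subseteq> E \<longrightarrow> emeasure (m {a<..<b}) A = 0 \<longrightarrow> emeasure \<rho> A = 0)" for a b E
  have is_supp: "\<exists>E. is_supp a b E" for a b
  proof (rule essential_support[OF \<rho>(1), of "m {a<..<b}"])
    fix E assume "E \<in> sets \<rho>" "emeasure (m {a<..<b}) (space \<rho> - E) = 0"
      "\<And>A. A \<in> sets \<rho> \<Longrightarrow> A \<subseteq> E \<Longrightarrow> emeasure (m {a<..<b}) A = 0 \<Longrightarrow> emeasure \<rho> A = 0"
    then have "is_supp a b E" unfolding is_supp_def \<rho>(2,3) Compl_eq_Diff_UNIV by blast
    then show ?thesis by blast
  qed (use m_fin \<rho> m_le in simp_all)
  define E where "E a b = (SOME E. is_supp a b E)" for a b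
  have "is_supp a b (E a b)" for a b unfolding E_def by (rule someI_ex[OF is_supp])
  then have E[measurable]: "\<And>a b. E a b \<in> sets borel"
    and E0: "\<And>a b. emeasure (m {a<..<b}) (- E a b) = 0"
    and E1: "\<And>a b A. A \<in> sets borel \<Longrightarrow> A \<subseteq> E a b \<Longrightarrow> emeasure (m {a<..<b}) A = 0 \<Longrightarrow> emeasure \<rho> A = 0"
    unfolding is_supp_def by blast+
  define Supp where "Supp = (\<Inter>a\<in>\<rat>. \<Inter>b\<in>\<rat>. E a b \<times> UNIV \<union> UNIV \<times> - {a<..<b})"
  have Supp: "Supp \<in> sets borel" unfolding Supp_def
    using countable_rat by (intro sets.countable_INT'' sets.Un borel_pairI) auto
  have Supp_iff: "(t, y) \<in> Supp \<longleftrightarrow> (\<forall>a\<in>\<rat>. \<forall>b\<in>\<rat>. a < y \<longrightarrow> y < b \<longrightarrow> t \<in> E a b)" for t y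
    unfolding Supp_def by auto
  have N1: "AE x in \<mu>. x \<in> K \<longrightarrow> (f x, x) \<in> Supp"
  proof -
    have "AE x in \<mu>. x \<in> K \<longrightarrow> a < x \<longrightarrow> x < b \<longrightarrow> f x \<in> E a b" for a b
    proof (rule AE_I')
      have "f -` (- E a b) \<in> sets borel" using measurable_sets[OF f, of "- E a b"] by simp
      moreover have "emeasure \<mu> (K \<inter> {a<..<b} \<inter> f -` (- E a b)) = 0"
        using E0[of a b] m[of "{a<..<b}" "- E a b"] by simp
      ultimately show "K \<inter> {a<..<b} \<inter> f -` (- E a b) \<in> null_sets \<mu>"
        using K \<mu>(2) by (intro null_setsI) simp_all
    qed auto
    then have "AE x in \<mu>. \<forall>a\<in>\<rat>. \<forall>b\<in>\<rat>. x \<in> K \<longrightarrow> a < x \<longrightarrow> x < b \<longrightarrow> f x \<in> E a b"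
      by (intro AE_rational_pairs)
    then show ?thesis unfolding Supp_iff by (rule eventually_mono) blast
  qed
  have N2: "AE t in \<rho>. \<forall>y. (t, y) \<in> Supp \<longrightarrow> (y, t) \<in> C"
  proof -
    have "AE t in \<rho>. t \<in> E a b \<longrightarrow> t \<in> snd ` (C \<inter> {a..b} \<times> UNIV)" for a b
    proof -
      have S: "snd ` (C \<inter> {a..b} \<times> UNIV) \<in> sets borel"
        by (intro borel_compact compact_snd_image compact_Int_closed C closed_Times) auto
      have "False" if "x \<in> K" "a < x" "x < b" "f x \<notin> snd ` (C \<inter> {a..b} \<times> UNIV)" for x
      proof -
        have "(x, f x) \<in> C \<inter> {a..b} \<times> UNIV" using fC that by simp
        then show False using that(4) by (metis image_eqI snd_conv)
      qed
      then have "K \<inter> {a<..<b} \<inter> f -` (E a b - snd ` (C \<inter> {a..b} \<times> UNIV)) = {}" by auto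
      then have "emeasure (m {a<..<b}) (E a b - snd ` (C \<inter> {a..b} \<times> UNIV)) = 0"
        using S by (subst m) (simp_all add: sets.Diff E)
      then have "emeasure \<rho> (E a b - snd ` (C \<inter> {a..b} \<times> UNIV)) = 0"
        using S by (intro E1[of _ a b]) auto
      then show ?thesis using S \<rho>
        by (intro AE_I'[of "E a b - snd ` (C \<inter> {a..b} \<times> UNIV)"]) (auto intro!: null_setsI)
    qed
    then have "AE t in \<rho>. \<forall>a\<in>\<rat>. \<forall>b\<in>\<rat>. t \<in> E a b \<longrightarrow> t \<in> snd ` (C \<inter> {a..b} \<times> UNIV)"
      by (intro AE_rational_pairs)
    then show ?thesis
    proof (rule eventually_mono, intro allI impI)
      fix t y assume *: "\<forall>a\<in>\<rat>. \<forall>b\<in>\<rat>. t \<in> E a b \<longrightarrow> t \<in> snd ` (C \<inter> {a..b} \<times> UNIV)" and ty: "(t, y) \<in> Supp"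
      have "(y, t) \<in> closure C"
      proof (rule closure_approachable[THEN iffD2], intro allI impI)
        fix e :: real assume "e > 0"
        obtain a where a: "a \<in> \<rat>" "y - e < a" "a < y" using Rats_dense_in_real[of "y - e" y] \<open>e > 0\<close> by auto
        obtain b where b: "b \<in> \<rat>" "y < b" "b < y + e" using Rats_dense_in_real[of y "y + e"] \<open>e > 0\<close> by auto
        have "t \<in> E a b" using ty a b unfolding Supp_iff by blast
        then obtain x where x: "(x, t) \<in> C" "a \<le> x" "x \<le> b" using * a(1) b(1) by force
        then show "\<exists>z\<in>C. dist z (y, t) < e" using a b
          by (intro bexI[of _ "(x, t)"]) (auto simp: dist_prod_def dist_real_def)
      qed
      then show "(y, t) \<in> C" using compact_imp_closed[OF C(1)] by simp
    qed
  qed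
  define is_D where "is_D a b D \<longleftrightarrow> D \<in> sets borel \<and> D \<subseteq> fst ` (Supp \<inter> UNIV \<times> {a<..<b}) \<and>
      (AE t in \<rho>. t \<in> fst ` (Supp \<inter> UNIV \<times> {a<..<b}) \<longrightarrow> t \<in> D)" for a b :: real and D
  have is_D: "\<exists>D. is_D a b D" for a b :: real
  proof -
    have "Supp \<inter> UNIV \<times> {a<..<b} \<in> sets borel" using Supp by (intro sets.Int borel_pairI) auto
    from projection_measurable_real[OF this \<rho>(1,2)] show ?thesis unfolding is_D_def by blast
  qed
  define D where "D a b = (SOME D. is_D a b D)" for a b
  have "is_D a b (D a b)" for a b unfolding D_def by (rule someI_ex[OF is_D])
  then have D[measurable]: "\<And>a b. D a b \<in> sets borel"
    and D1: "\<And>a b. D a b \<subseteq> fst ` (Supp \<inter> UNIV \<times> {a<..<b})"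
    and D2: "\<And>a b. AE t in \<rho>. t \<in> fst ` (Supp \<inter> UNIV \<times> {a<..<b}) \<longrightarrow> t \<in> D a b"
    unfolding is_D_def by blast+
  have D3: "AE t in \<rho>. \<forall>a\<in>\<rat>. \<forall>b\<in>\<rat>. t \<in> fst ` (Supp \<inter> UNIV \<times> {a<..<b}) \<longrightarrow> t \<in> D a b"
    by (intro AE_rational_pairs D2)
  \<comment> \<open>\<open>D a b\<close> replaces the set of \<open>t\<close> whose essential
    fibre meets the interval; two points of the fibre would be separated by a rational
    \<open>s\<close>.\<close>
  define W where "W a b = E a b \<inter> D a b - (\<Union>s\<in>\<rat>. D a s \<inter> D s b)" for a b
  have W[measurable]: "W a b \<in> sets borel" for a b unfolding W_def
    using countable_rat by (intro sets.Diff sets.Int sets.countable_UN') auto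
  have pull: "AE x in \<mu>. x \<in> K \<longrightarrow> P (f x)" if ae: "AE t in \<rho>. P t" for P
  proof -
    obtain N where N: "{t \<in> space \<rho>. \<not> P t} \<subseteq> N" "emeasure \<rho> N = 0" "N \<in> sets \<rho>"
      using AE_E[OF ae] by blast
    have "f -` N \<in> sets borel" using measurable_sets[OF f, of N] N(3) \<rho> by simp
    then have "K \<inter> f -` N \<in> null_sets \<mu>"
      using N(2,3) K \<mu>(2) \<rho>(2) m[of UNIV N] by (auto intro!: null_setsI simp: \<rho>_def)
    then show ?thesis using N(1) \<rho>(3) by (intro AE_I'[of "K \<inter> f -` N"]) auto
  qed
  have N3: "AE t in \<rho>. \<exists>y. (t, y) \<in> Supp"
  proof -
    obtain D0 where D0: "D0 \<in> sets borel" "D0 \<subseteq> fst ` Supp" "AE t in \<rho>. t \<in> fst ` Supp \<longrightarrow> t \<in> D0"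
      using projection_measurable_real[OF Supp \<rho>(1,2)] by metis
    have "AE x in \<mu>. x \<notin> K \<inter> f -` (- D0)"
      using N1 pull[OF D0(3)]
    proof eventually_elim
      case (elim x)
      then show ?case by force
    qed
    moreover have "f -` (- D0) \<in> sets borel" using measurable_sets[OF f, of "- D0"] D0(1) by simp
    ultimately have "emeasure \<mu> (K \<inter> f -` (- D0)) = 0"
      using K \<mu>(2) by (subst (asm) AE_iff_null_sets[symmetric]) auto
    then have "emeasure \<rho> (- D0) = 0" using m[of UNIV "- D0"] D0(1) by (simp add: \<rho>_def)
    then have "AE t in \<rho>. t \<notin> - D0" using D0(1) \<rho>(2) by (intro AE_not_in null_setsI) auto
    then show ?thesis by (rule eventually_mono) (use D0(2) in force)
  qed
  have NW: "AE t in \<rho>. \<exists>a\<in>\<rat>. \<exists>b\<in>\<rat>. t \<in> W a b"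
    using N2 D3 N3
  proof eventually_elim
    case (elim t)
    define S where "S = {y. (t, y) \<in> Supp}"
    have "closed S"
    proof -
      have "S = (\<Inter>a\<in>\<rat>. \<Inter>b\<in>\<rat>. {y. a < y \<longrightarrow> y < b \<longrightarrow> t \<in> E a b})"
        unfolding S_def Supp_iff by blast
      moreover have "closed {y. a < y \<longrightarrow> y < b \<longrightarrow> t \<in> E a b}" for a b
      proof (cases "t \<in> E a b")
        case False
        then have "{y. a < y \<longrightarrow> y < b \<longrightarrow> t \<in> E a b} = {..a} \<union> {b..}" by auto
        then show ?thesis by (simp add: closed_Un)
      qed simp
      ultimately show ?thesis by (simp add: closed_INT)
    qed
    moreover have "countable S"
      using elim(1) C(2) by (intro countable_subset[OF _ ctbl[of t]]) (auto simp: S_def)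
    moreover have "S \<noteq> {}" using elim(3) by (simp add: S_def)
    ultimately obtain y a b where y: "y \<in> S" "a \<in> \<rat>" "b \<in> \<rat>" "a < y" "y < b" "S \<inter> {a<..<b} = {y}"
      using countable_closed_isolated by blast
    have "t \<in> E a b" using y unfolding S_def Supp_iff by blast
    moreover have "t \<in> D a b"
    proof -
      have "t \<in> fst ` (Supp \<inter> UNIV \<times> {a<..<b})"
        using y by (intro image_eqI[of _ _ "(t, y)"]) (auto simp: S_def)
      then show ?thesis using elim(2) y by blast
    qed
    moreover have False if "s \<in> \<rat>" "t \<in> D a s" "t \<in> D s b" for s
    proof -
      have "t \<in> fst ` (Supp \<inter> UNIV \<times> {a<..<s})" "t \<in> fst ` (Supp \<inter> UNIV \<times> {s<..<b})"
        using D1 that(2,3) by blast+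
      then obtain u v where uv: "(t, u) \<in> Supp" "a < u" "u < s" "(t, v) \<in> Supp" "s < v" "v < b"
        by auto
      then have "u \<in> S \<inter> {a<..<b}" "v \<in> S \<inter> {a<..<b}" by (auto simp: S_def)
      then have "u = y" "v = y" using y(6) by auto
      then show False using uv by simp
    qed
    ultimately have "t \<in> W a b" unfolding W_def by blast
    then show ?case using y(2,3) by blast
  qed
  have "\<exists>a\<in>\<rat>. \<exists>b\<in>\<rat>. emeasure \<rho> (W a b) \<noteq> 0"
  proof (rule ccontr)
    assume "\<not> ?thesis"
    then have "AE t in \<rho>. t \<notin> W a b" if "a \<in> \<rat>" "b \<in> \<rat>" for a b
      using \<rho>(2) W that by (intro AE_not_in null_setsI) auto
    then have "AE t in \<rho>. \<forall>a\<in>\<rat>. \<forall>b\<in>\<rat>. t \<notin> W a b"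
      by (rule AE_rational_pairs)
    with NW have "AE t in \<rho>. False" by eventually_elim blast
    then have "emeasure \<rho> UNIV = 0" using \<rho>(3) by (auto elim!: AE_E intro: emeasure_eq_0)
    then show False using C(3) m[of UNIV UNIV] by (simp add: \<rho>_def K_def)
  qed
  then obtain a b where ab: "a \<in> \<rat>" "b \<in> \<rat>" "emeasure \<rho> (W a b) \<noteq> 0" by blast
  have "emeasure (m {a<..<b}) (W a b) \<noteq> 0"
    using E1[of "W a b" a b] W ab(3) by (auto simp: W_def)
  then have J0: "emeasure \<mu> (K \<inter> {a<..<b} \<inter> f -` W a b) \<noteq> 0" using m[of "{a<..<b}" "W a b"] W by simp
  have fW: "f -` W a b \<in> sets borel" using measurable_sets[OF f W] by simp
  define ok where "ok x \<longleftrightarrow> (f x, x) \<in> Supp \<and>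
    (\<forall>a\<in>\<rat>. \<forall>b\<in>\<rat>. f x \<in> fst ` (Supp \<inter> UNIV \<times> {a<..<b}) \<longrightarrow> f x \<in> D a b)" for x
  have "AE x in \<mu>. x \<in> K \<longrightarrow> ok x"
    using N1 pull[OF D3] unfolding ok_def by eventually_elim blast
  then obtain N where "{x \<in> space \<mu>. \<not> (x \<in> K \<longrightarrow> ok x)} \<subseteq> N" "emeasure \<mu> N = 0" "N \<in> sets \<mu>"
    by (rule AE_E)
  then have N: "N \<in> null_sets \<mu>" and N_ok: "\<And>x. x \<in> K \<Longrightarrow> x \<notin> N \<Longrightarrow> ok x"
    using sp by auto
  define J where "J = K \<inter> {a<..<b} \<inter> f -` W a b - N"
  have J: "J \<in> sets borel" unfolding J_def using K fW null_setsD2[OF N] \<mu>(2) by simp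
  have "emeasure \<mu> J \<noteq> 0"
    unfolding J_def using J0 N K fW \<mu>(2) by (subst emeasure_Diff_null_set) simp_all
  have J_inj: "x = x'" if x: "x \<in> J" "x' \<in> J" "f x = f x'" for x x'
  proof -
    have False if "u \<in> J" "v \<in> J" "f u = f v" "u < v" for u v
    proof -
      obtain s where s: "s \<in> \<rat>" "u < s" "s < v" using Rats_dense_in_real[OF \<open>u < v\<close>] by blast
      have uv: "u \<in> K" "u \<notin> N" "v \<in> K" "v \<notin> N" "a < u" "v < b" "f u \<in> W a b" using that by (auto simp: J_def)
      have "f u \<in> fst ` (Supp \<inter> UNIV \<times> {a<..<s})"
        using N_ok[OF uv(1,2)] uv s unfolding ok_def by (intro image_eqI[of _ _ "(f u, u)"]) simp_all
      then have "f u \<in> D a s" using N_ok[OF uv(1,2)] ab s unfolding ok_def by blast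
      moreover have "f v \<in> fst ` (Supp \<inter> UNIV \<times> {s<..<b})"
        using N_ok[OF uv(3,4)] uv s unfolding ok_def by (intro image_eqI[of _ _ "(f v, v)"]) simp_all
      then have "f v \<in> D s b" using N_ok[OF uv(3,4)] ab s unfolding ok_def by blast
      ultimately show False using uv(7) s(1) that(3) unfolding W_def by auto
    qed
    then show ?thesis using x by (metis linorder_neqE_linordered_idom)
  qed
  have V': "C \<inter> J \<times> UNIV \<in> sets borel" using borel_compact[OF C(1)] J by (intro sets.Int borel_pairI) auto
  have "J \<subseteq> fst ` (C \<inter> J \<times> UNIV)"
  proof
    fix x assume "x \<in> J"
    then show "x \<in> fst ` (C \<inter> J \<times> UNIV)"
      using fC[of x] by (intro image_eqI[of _ _ "(x, f x)"]) (auto simp: J_def)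
  qed
  then have "\<not> (AE x in \<mu>. x \<notin> fst ` (C \<inter> J \<times> UNIV))"
  proof (intro notI)
    assume "J \<subseteq> fst ` (C \<inter> J \<times> UNIV)" "AE x in \<mu>. x \<notin> fst ` (C \<inter> J \<times> UNIV)"
    then have "AE x in \<mu>. x \<notin> J" by (auto elim!: eventually_mono)
    then have "emeasure \<mu> J = 0"
      using J \<mu>(2) by (subst (asm) AE_iff_null_sets[symmetric]) auto
    then show False using \<open>emeasure \<mu> J \<noteq> 0\<close> by simp
  qed
  then obtain C' where C': "compact C'" "C' \<subseteq> C \<inter> J \<times> UNIV" "0 < emeasure \<mu> (fst ` C')"
    using positive_compact[OF V' \<mu>] by blast
  show ?thesis
  proof (rule that[OF C'(1) _ C'(3)])
    show "C' \<subseteq> V" using C'(2) C(2) by blast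
    show "inj_on fst C'" using C'(2) by (intro inj_on_subset[OF C(4)]) blast
    show "inj_on snd C'"
    proof (rule inj_onI)
      fix p q assume *: "p \<in> C'" "q \<in> C'" "snd p = snd q"
      obtain x t x' where pq: "p = (x, t)" "q = (x', t)" using *(3) by (cases p; cases q) auto
      then have "x \<in> J" "x' \<in> J" "f x = t" "f x' = t" using * C'(2) f_eq[of x t] f_eq[of x' t] by auto
      then show "p = q" using J_inj[of x x'] pq by simp
    qed
  qed
qed

section \<open>Standard Borel spaces as retracts of the real line\<close>

lemma sets_borel_of: "sets (borel_of T) = sigma_sets (topspace T) {A. openin T A}"
  unfolding borel_of_def by (intro sets_measure_of) (auto dest: openin_subset)

lemma space_borel_of[simp]: "space (borel_of T) = topspace T"
  unfolding borel_of_def by (intro space_measure_of) (auto dest: openin_subset)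

lemma metrizable_euclidean_fun: "metrizable_space (euclidean :: (nat \<Rightarrow> real) topology)"
  by (metis Met_TC.metrizable_space_mtopology mtopology_is_euclidean)

text \<open>The distances to the points of a countable dense set determine a point and its
  neighbourhoods. The image is a completely metrizable subspace of a metrizable space, hence a
  countable intersection of open sets.\<close>

lemma polish_embedding:
  fixes T :: "'a topology"
  assumes T: "completely_metrizable_space T" "second_countable T" "topspace T \<noteq> {}"
  obtains h :: "'a \<Rightarrow> nat \<Rightarrow> real"
  where "homeomorphic_map T (top_of_set (h ` topspace T)) h" "h ` topspace T \<in> sets borel"
proof -
  obtain X d where X: "Metric_space X d" "T = Metric_space.mtopology X d"
    using T(1) unfolding completely_metrizable_space_def by blast
  interpret Metric_space X d by fact
  have top: "topspace T = X" by (simp add: X(2))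
  obtain Q where Q: "countable Q" "Q \<subseteq> X" "T closure_of Q = X"
    using second_countable_imp_separable_space[OF T(2)] unfolding separable_space_def top by blast
  have "Q \<noteq> {}" using Q(3) T(3) top by force
  define q where "q = from_nat_into Q"
  have q: "q n \<in> X" for n using from_nat_into[OF \<open>Q \<noteq> {}\<close>] Q(2) unfolding q_def by blast
  have dense: "\<exists>n. d x (q n) < e" if xe: "x \<in> X" "e > 0" for x e
  proof -
    have "x \<in> mtopology closure_of Q" using Q(3) xe(1) X(2) by simp
    then obtain y where "y \<in> Q" "d x y < e"
      using xe(2) unfolding metric_closure_of by (auto simp: in_mball)
    then show ?thesis using from_nat_into_surj[OF Q(1)] unfolding q_def by metis
  qed
  define h where "h x n = d x (q n)" for x n
  have inj: "inj_on h X"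
  proof (rule inj_onI)
    fix x y assume xy: "x \<in> X" "y \<in> X" "h x = h y"
    show "x = y"
    proof (rule ccontr)
      assume "x \<noteq> y"
      then have "d x y > 0" using xy by simp
      then obtain n where n: "d x (q n) < d x y / 2" using dense[OF xy(1), of "d x y / 2"] by auto
      have "d x (q n) = d y (q n)" using fun_cong[OF xy(3), of n] by (simp add: h_def)
      then show False using n triangle[OF xy(1) q[of n] xy(2)] commute[of y "q n"] by simp
    qed
  qed
  have cont: "continuous_map T (top_of_set (h ` X)) h"
    unfolding continuous_map_in_subtopology
  proof
    have "continuous_map T euclideanreal (\<lambda>x. h x n)" for n
      unfolding X(2) h_def
    proof -
      have "(\<lambda>x. d x (q n)) = d (q n)" by (simp add: commute fun_eq_iff)
      then show "continuous_map mtopology euclideanreal (\<lambda>x. d x (q n))"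
        using continuous_on_mdist[of "q n" "metric (X, d)"] q[of n] by (simp add: mtopology_of_def)
    qed
    then have "continuous_map T (product_topology (\<lambda>n. euclideanreal) UNIV) h"
      by (simp add: continuous_map_componentwise_UNIV)
    then show "continuous_map T euclidean h" by (simp add: euclidean_product_topology)
  qed (simp add: top image_subset_iff_funcset)
  have opn: "open_map T (top_of_set (h ` X)) h"
    unfolding open_map_def
  proof (intro allI impI)
    fix U assume U: "openin T U"
    have UX: "U \<subseteq> X" using openin_subset[OF U] top by simp
    have "\<exists>V. open V \<and> h x \<in> V \<and> h ` X \<inter> V \<subseteq> h ` U" if "x \<in> U" for x
    proof -
      have "x \<in> X" using that UX by blast
      obtain r where r: "r > 0" "mball x r \<subseteq> U" 
      proof -
        have "\<forall>x. x \<in> U \<longrightarrow> (\<exists>r>0. mball x r \<subseteq> U)" using U unfolding X(2) openin_mtopology by simp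
        then show ?thesis using that \<open>x \<in> U\<close> by blast
      qed
      obtain n where n: "d x (q n) < r / 2" using dense[OF \<open>x \<in> X\<close>, of "r / 2"] r(1) by auto
      have "open ((\<lambda>f::nat \<Rightarrow> real. f n) -` {..<r / 2})"
        by (intro open_vimage open_lessThan) (rule continuous_on_product_coordinates)
      moreover have "h ` X \<inter> (\<lambda>f. f n) -` {..<r / 2} \<subseteq> h ` U"
      proof
        fix z assume "z \<in> h ` X \<inter> (\<lambda>f. f n) -` {..<r / 2}"
        then obtain y where y: "y \<in> X" "z = h y" "d y (q n) < r / 2" by (auto simp: h_def)
        have "d x y < r" using triangle[OF \<open>x \<in> X\<close> q[of n] y(1)] n y(3) commute[of y "q n"] by simp
        then have "y \<in> U" using r(2) y(1) \<open>x \<in> X\<close> by (auto simp: in_mball)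
        then show "z \<in> h ` U" using y(2) by blast
      qed
      ultimately show ?thesis using n by (intro exI[of _ "(\<lambda>f. f n) -` {..<r / 2}"]) (auto simp: h_def)
    qed
    then obtain V where V: "\<And>x. x \<in> U \<Longrightarrow> open (V x)" "\<And>x. x \<in> U \<Longrightarrow> h x \<in> V x"
        "\<And>x. x \<in> U \<Longrightarrow> h ` X \<inter> V x \<subseteq> h ` U" by metis
    have "h ` U = h ` X \<inter> (\<Union>x\<in>U. V x)"
    proof (rule equalityI)
      show "h ` U \<subseteq> h ` X \<inter> (\<Union>x\<in>U. V x)" using UX V(2) by blast
      show "h ` X \<inter> (\<Union>x\<in>U. V x) \<subseteq> h ` U" using V(3) by blast
    qed
    then show "openin (top_of_set (h ` X)) (h ` U)"
      using V(1) by (simp add: openin_open_Int open_UN)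
  qed
  have hom: "homeomorphic_map T (top_of_set (h ` X)) h"
    using cont opn by (rule bijective_open_imp_homeomorphic_map) (simp_all add: top inj)
  then have "completely_metrizable_space (top_of_set (h ` X))"
    using T(1) homeomorphic_completely_metrizable_space homeomorphic_map_imp_homeomorphic_space by blast
  then have "gdelta_in euclidean (h ` X)"
    by (intro completely_metrizable_space_imp_gdelta_in metrizable_euclidean_fun) auto
  then obtain \<U> where \<U>: "countable \<U>" "\<And>U. U \<in> \<U> \<Longrightarrow> open U" "\<Inter>\<U> = h ` X"
    unfolding gdelta_in_alt intersection_of_def by auto
  have "\<Inter>\<U> \<in> sets borel"
  proof (cases "\<U> = {}")
    case False
    have "(\<Inter>U\<in>\<U>. U) \<in> sets borel"
      using \<U>(1,2) False by (intro sets.countable_INT') auto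
    then show ?thesis by simp
  qed simp
  then show ?thesis using hom \<U>(3) top by (intro that[of h]) simp_all
qed

lemma homeomorphic_map_image_borel:
  assumes h: "homeomorphic_map T (top_of_set (h ` topspace T)) h" "h ` topspace T \<in> sets borel"
    and A: "A \<in> sets (borel_of T)"
  shows "h ` A \<in> sets borel"
proof -
  have inj: "inj_on h (topspace T)" using h(1) by (rule homeomorphic_imp_injective_map)
  have "A \<in> sigma_sets (topspace T) {A. openin T A}" using A by (simp add: sets_borel_of)
  then show ?thesis
  proof induction
    case (Basic U)
    then have "openin (top_of_set (h ` topspace T)) (h ` U)"
      using homeomorphic_imp_open_map[OF h(1)] by (simp add: open_map_def)
    then obtain W where "open W" "h ` U = h ` topspace T \<inter> W" unfolding openin_open by blast
    then show ?case using h(2) by simp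
  next
    case (Compl B)
    then have "B \<subseteq> topspace T" using sigma_sets_into_sp[of "{A. openin T A}" "topspace T" B] openin_subset by blast
    then have "h ` (topspace T - B) = h ` topspace T - h ` B" using inj by (simp add: inj_on_image_set_diff)
    then show ?case using Compl h(2) by simp
  next
    case (Union B)
    then show ?case by (simp add: image_UN)
  qed simp
qed

lemma homeomorphic_map_measurable:
  assumes h: "homeomorphic_map T (top_of_set (h ` topspace T)) h"
  shows "h \<in> borel_measurable (borel_of T)"
proof (rule borel_measurableI)
  fix S :: "'b set" assume "open S"
  have "continuous_map T euclidean h"
    using homeomorphic_imp_continuous_map[OF h] by (rule continuous_map_into_fulltopology)
  then have "openin T {x \<in> topspace T. h x \<in> S}"
    using \<open>open S\<close> by (intro openin_continuous_map_preimage) auto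
  moreover have "{x \<in> topspace T. h x \<in> S} = h -` S \<inter> space (borel_of T)" by auto
  ultimately show "h -` S \<inter> space (borel_of T) \<in> sets (borel_of T)"
    by (simp add: sets_borel_of)
qed

text \<open>The remainders in the binary expansion of a number in the unit interval.\<close>

primrec doubling :: "nat \<Rightarrow> real \<Rightarrow> real" where
  "doubling 0 y = y"
| "doubling (Suc n) y = 2 * doubling n y - of_bool (1 / 2 \<le> doubling n y)"

definition binary_digit :: "nat \<Rightarrow> real \<Rightarrow> bool" where
  "binary_digit n y \<longleftrightarrow> 1 / 2 \<le> doubling n y"

text \<open>Successive removal of the leading term of a Cantor sum: the term is present iff the
  remainder is at least 1, because all later terms together contribute at most one half.\<close>

primrec tripling :: "nat \<Rightarrow> real \<Rightarrow> real" where
  "tripling 0 z = z"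
| "tripling (Suc n) z = 3 * (tripling n z - of_bool (1 \<le> tripling n z))"

definition cantor_sum :: "(nat \<Rightarrow> bool) \<Rightarrow> real" where
  "cantor_sum b = (\<Sum>n. of_bool (b n) * (1 / 3) ^ n)"

lemma doubling_range: "0 \<le> y \<Longrightarrow> y < 1 \<Longrightarrow> 0 \<le> doubling n y \<and> doubling n y < 1"
  by (induction n) auto

lemma binary_expansion:
  assumes "0 \<le> y" "y < 1"
  shows "(\<lambda>n. of_bool (binary_digit n y) * (1 / 2) ^ Suc n) sums y"
proof -
  have "(\<Sum>i<n. of_bool (binary_digit i y) * (1 / 2) ^ Suc i) = y - doubling n y * (1 / 2) ^ n" for n
    by (induction n) (auto simp: binary_digit_def field_simps)
  moreover have "(\<lambda>n. doubling n y * (1 / 2) ^ n) \<longlonglongrightarrow> 0"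
  proof (rule Lim_null_comparison)
    show "\<forall>\<^sub>F n in sequentially. norm (doubling n y * (1 / 2) ^ n) \<le> (1 / 2) ^ n"
    proof (rule always_eventually, rule allI)
      show "norm (doubling n y * (1 / 2) ^ n) \<le> (1 / 2) ^ n" for n
        using doubling_range[OF assms, of n] by (simp add: abs_mult mult_left_le_one_le)
    qed
    show "(\<lambda>n. (1 / 2 :: real) ^ n) \<longlonglongrightarrow> 0" by (rule LIMSEQ_power_zero) simp
  qed
  then have "(\<lambda>n. y - doubling n y * (1 / 2) ^ n) \<longlonglongrightarrow> y - 0"
    by (intro tendsto_diff tendsto_const)
  ultimately show ?thesis unfolding sums_def by (simp only: diff_zero)
qed

lemma summable_cantor: "summable (\<lambda>n. of_bool (b n) * (1 / 3 :: real) ^ n)"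
  by (rule summable_comparison_test'[of "\<lambda>n. (1 / 3) ^ n" 0]) (auto simp: summable_geometric_iff)

lemma cantor_sum_Suc: "cantor_sum b = of_bool (b 0) + cantor_sum (\<lambda>n. b (Suc n)) / 3"
proof -
  have "cantor_sum b = of_bool (b 0) + (\<Sum>n. of_bool (b (Suc n)) * (1 / 3) ^ Suc n)"
    unfolding cantor_sum_def using suminf_split_head[OF summable_cantor[of b]] by simp
  also have "(\<Sum>n. of_bool (b (Suc n)) * (1 / 3) ^ Suc n) = cantor_sum (\<lambda>n. b (Suc n)) / 3"
    unfolding cantor_sum_def using suminf_mult[OF summable_cantor[of "\<lambda>n. b (Suc n)"], of "1 / 3"]
    by (simp add: mult_ac)
  finally show ?thesis .
qed

lemma cantor_sum_bounds: "0 \<le> cantor_sum b" "cantor_sum b \<le> 3 / 2"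
proof -
  show "0 \<le> cantor_sum b" unfolding cantor_sum_def by (intro suminf_nonneg summable_cantor) simp
  have "cantor_sum b \<le> (\<Sum>n. (1 / 3) ^ n)"
    unfolding cantor_sum_def by (intro suminf_le summable_cantor) (auto simp: summable_geometric_iff)
  then show "cantor_sum b \<le> 3 / 2" by (simp add: suminf_geometric)
qed

lemma tripling_cantor_sum: "tripling n (cantor_sum b) = cantor_sum (\<lambda>i. b (i + n))"
proof (induction n)
  case (Suc n)
  define c where "c = (\<lambda>i. b (i + n))"
  have "1 \<le> cantor_sum c \<longleftrightarrow> c 0"
    using cantor_sum_Suc[of c] cantor_sum_bounds[of "\<lambda>n. c (Suc n)"] by (cases "c 0") auto
  then show ?case using Suc cantor_sum_Suc[of c] by (simp add: c_def)
qed simp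

lemma cantor_sum_digit: "1 \<le> tripling n (cantor_sum b) \<longleftrightarrow> b n"
  using cantor_sum_Suc[of "\<lambda>i. b (i + n)"] cantor_sum_bounds[of "\<lambda>i. b (Suc i + n)"]
  by (cases "b n") (auto simp: tripling_cantor_sum)

lemma measurable_doubling[measurable]: "doubling n \<in> borel_measurable borel"
  by (induction n) auto

lemma measurable_tripling[measurable]: "tripling n \<in> borel_measurable borel"
  by (induction n) auto

text \<open>The coordinates are squashed into the unit interval, and their interleaved binary digits
  become the coefficients of one Cantor sum. Cantor sums avoid the ambiguity of binary expansions,
  so the digits can be read off again.\<close>

lemma real_sequence_retract:
  obtains e :: "(nat \<Rightarrow> real) \<Rightarrow> real" and r :: "real \<Rightarrow> nat \<Rightarrow> real"
  where "e \<in> borel_measurable borel" "r \<in> borel_measurable borel" "\<And>x. r (e x) = x"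
proof -
  define s where "s x = 1 / (1 + exp x)" for x :: real
  have s: "0 \<le> s x" "s x < 1" "ln (1 / s x - 1) = x" for x
    by (simp_all add: s_def add_pos_pos less_imp_le)
  define dig where "dig x m = binary_digit (snd (prod_decode m)) (s (x (fst (prod_decode m))))" for x :: "nat \<Rightarrow> real" and m
  define e where "e x = cantor_sum (dig x)" for x
  define r :: "real \<Rightarrow> nat \<Rightarrow> real" where "r z k = ln (1 / (\<Sum>n. of_bool (1 \<le> tripling (prod_encode (k, n)) z) * (1 / 2) ^ Suc n) - 1)" for z k
  have [measurable]: "(\<lambda>x::nat \<Rightarrow> real. x k) \<in> borel_measurable borel" for k
    by (intro borel_measurable_continuous_onI continuous_on_product_coordinates)
  have e: "e \<in> borel_measurable borel"
    unfolding e_def cantor_sum_def dig_def binary_digit_def s_def by measurable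
  have r: "r \<in> borel_measurable borel"
  proof (rule measurable_coordinatewise_then_product)
    show "(\<lambda>x. r x k) \<in> borel_measurable borel" for k unfolding r_def by measurable
  qed
  have "r (e x) k = x k" for x k
  proof -
    have "(\<Sum>n. of_bool (1 \<le> tripling (prod_encode (k, n)) (e x)) * (1 / 2) ^ Suc n)
      = (\<Sum>n. of_bool (binary_digit n (s (x k))) * (1 / 2 :: real) ^ Suc n)"
      unfolding e_def cantor_sum_digit by (simp add: dig_def)
    also have "\<dots> = s (x k)" using binary_expansion[OF s(1,2)] by (rule sums_unique[symmetric])
    finally show ?thesis by (simp add: r_def s(3))
  qed
  then show ?thesis using that e r by blast
qed

text \<open>A measurable left inverse makes the image of the coding Borel: it is the set where the
  retraction followed by the coding is the identity.\<close>

theorem standard_borel_real_retract: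
  assumes M: "standard_borel M" "space M \<noteq> {}"
  obtains e :: "'a \<Rightarrow> real" and r where "e \<in> borel_measurable M" "r \<in> borel \<rightarrow>\<^sub>M M"
    "\<forall>x\<in>space M. r (e x) = x"
proof -
  obtain T where T: "completely_metrizable_space T" "second_countable T"
    and spT: "space M \<in> sets (borel_of T)" and setsT: "sets M = sets (restrict_space (borel_of T) (space M))"
    using M(1) unfolding standard_borel_def by blast
  have sub: "space M \<subseteq> topspace T" using sets.sets_into_space[OF spT] by simp
  then have "topspace T \<noteq> {}" using M(2) by blast
  then obtain h :: "'a \<Rightarrow> nat \<Rightarrow> real" where h: "homeomorphic_map T (top_of_set (h ` topspace T)) h"
    "h ` topspace T \<in> sets borel"
    using polish_embedding[OF T] by blast
  obtain e :: "(nat \<Rightarrow> real) \<Rightarrow> real" and r where er: "e \<in> borel_measurable borel" "r \<in> borel_measurable borel" "\<And>x. r (e x) = x"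
    using real_sequence_retract by blast
  note [measurable] = er(1,2)
  have inj: "inj_on h (space M)" using homeomorphic_imp_injective_map[OF h(1)] sub by (rule inj_on_subset)
  have hM: "h \<in> borel_measurable M"
    using measurable_restrict_space1[OF homeomorphic_map_measurable[OF h(1)], of "space M"]
      measurable_cong_sets[OF setsT refl] by blast
  have hA: "h ` A \<in> sets borel" if A: "A \<in> sets M" for A
  proof -
    have "A \<in> sets (borel_of T)"
    proof -
      obtain B where "B \<in> sets (borel_of T)" "A = space M \<inter> B"
        using A unfolding setsT sets_restrict_space by auto
      then show ?thesis using sets.Int[OF spT] by simp
    qed
    then show ?thesis by (rule homeomorphic_map_image_borel[OF h])
  qed
  obtain x0 where x0: "x0 \<in> space M" using M(2) by blast
  define g where "g z = (if z \<in> h ` space M then the_inv_into (space M) h z else x0)" for z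
  have g_h: "g (h x) = x" if "x \<in> space M" for x
    using that inj by (simp add: g_def the_inv_into_f_f)
  have g_sp: "g z \<in> space M" for z
    using x0 inj by (auto simp: g_def the_inv_into_f_f)
  have g: "g \<in> borel \<rightarrow>\<^sub>M M"
  proof (rule measurableI)
    fix A assume A: "A \<in> sets M"
    have "g -` A = h ` A \<union> (if x0 \<in> A then - h ` space M else {})"
      using sets.sets_into_space[OF A] inj by (auto simp: g_def the_inv_into_f_f g_h split: if_splits)
    then show "g -` A \<inter> space borel \<in> sets borel" using hA[OF A] hA[OF sets.top] by simp
  qed (rule g_sp)
  show ?thesis
  proof (rule that[of "e \<circ> h" "g \<circ> r"])
    show "e \<circ> h \<in> borel_measurable M" using hM er(1) by (rule measurable_comp)
    show "g \<circ> r \<in> borel \<rightarrow>\<^sub>M M" using er(2) g by (rule measurable_comp)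
  qed (simp add: er(3) g_h)
qed

section \<open>Partial isomorphisms inside a relation\<close>

lemma fst_imageI: "(a, b) \<in> S \<Longrightarrow> a \<in> fst ` S"
  by force

lemma snd_imageI: "(a, b) \<in> S \<Longrightarrow> b \<in> snd ` S"
  by force

lemma measurable_pair_map:
  assumes "f \<in> A \<rightarrow>\<^sub>M B" "g \<in> C \<rightarrow>\<^sub>M D"
  shows "map_prod f g \<in> A \<Otimes>\<^sub>M C \<rightarrow>\<^sub>M B \<Otimes>\<^sub>M D"
proof -
  have "(\<lambda>p. (f (fst p), g (snd p))) \<in> A \<Otimes>\<^sub>M C \<rightarrow>\<^sub>M B \<Otimes>\<^sub>M D"
    using assms by measurable
  then show ?thesis by (simp add: map_prod_def case_prod_beta')
qed

text \<open>The image of a relation under the coding of its points by real numbers, written through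
  the retraction so that it is visibly Borel.\<close>

definition coded_relation :: "('a \<Rightarrow> real) \<Rightarrow> (real \<Rightarrow> 'a) \<Rightarrow> ('a \<times> 'a) set \<Rightarrow> (real \<times> real) set" where
  "coded_relation e r V = {(a, b). (r a, r b) \<in> V \<and> e (r a) = a \<and> e (r b) = b}"

lemma coded_relation_iff:
  assumes "V \<subseteq> space M \<times> space M" "\<And>x. x \<in> space M \<Longrightarrow> r (e x) = x" "x \<in> space M" "y \<in> space M"
  shows "(e x, e y) \<in> coded_relation e r V \<longleftrightarrow> (x, y) \<in> V"
  using assms by (simp add: coded_relation_def)

lemma coded_relation_borel:
  assumes e: "e \<in> borel_measurable M" and r: "r \<in> borel \<rightarrow>\<^sub>M M" and V: "V \<in> sets (M \<Otimes>\<^sub>M M)"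
  shows "coded_relation e r V \<in> sets borel"
proof -
  have "map_prod r r \<in> borel \<Otimes>\<^sub>M borel \<rightarrow>\<^sub>M M \<Otimes>\<^sub>M M" by (rule measurable_pair_map[OF r r])
  from measurable_sets[OF this V] have 1: "map_prod r r -` V \<in> sets (borel :: (real \<times> real) measure)"
    unfolding borel_prod[symmetric] by (simp add: space_pair_measure)
  have "e \<circ> r \<in> borel_measurable borel" using r e by (rule measurable_comp)
  then have [measurable]: "(\<lambda>a. e (r a)) \<in> borel_measurable borel" by (simp add: comp_def)
  have "{a \<in> space borel. e (r a) = a} \<in> sets borel" by measurable
  then have 2: "{a. e (r a) = a} \<times> {a. e (r a) = a} \<in> sets borel" by (simp add: borel_pairI)
  have "coded_relation e r V = map_prod r r -` V \<inter> {a. e (r a) = a} \<times> {a. e (r a) = a}"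
    by (auto simp: coded_relation_def)
  then show ?thesis using 1 2 by simp
qed

lemma projection_measurable:
  fixes M :: "'a measure"
  assumes M: "standard_borel M" "finite_measure M" and V: "V \<in> sets (M \<Otimes>\<^sub>M M)"
  obtains D where "D \<in> sets M" "\<forall>x\<in>D. \<exists>y. (x, y) \<in> V" "AE x in M. (\<exists>y. (x, y) \<in> V) \<longrightarrow> x \<in> D"
proof (cases "space M = {}")
  case True
  then show ?thesis by (intro that[of "{}"]) (auto intro: AE_I2)
next
  case False
  obtain e :: "'a \<Rightarrow> real" and r where e: "e \<in> borel_measurable M" and r: "r \<in> borel \<rightarrow>\<^sub>M M" and re: "\<forall>x\<in>space M. r (e x) = x"
    by (rule standard_borel_real_retract[OF M(1) False])
  note er = e r bspec[OF re]
  have Vsp: "V \<subseteq> space M \<times> space M" using sets.sets_into_space[OF V] by (simp add: space_pair_measure)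
  define W where "W = coded_relation e r V"
  have W: "W \<in> sets borel" unfolding W_def by (rule coded_relation_borel[OF er(1,2) V])
  have fin: "finite_measure (distr M borel e)" by (rule finite_measure.finite_measure_distr[OF M(2) er(1)])
  obtain D where D: "D \<in> sets borel" "D \<subseteq> fst ` W" "AE a in distr M borel e. a \<in> fst ` W \<longrightarrow> a \<in> D"
    by (rule projection_measurable_real[OF W fin sets_distr])
  have iff: "e x \<in> fst ` W \<longleftrightarrow> (\<exists>y. (x, y) \<in> V)" if "x \<in> space M" for x
  proof
    assume "e x \<in> fst ` W"
    then obtain b where "(e x, b) \<in> W" by auto
    then show "\<exists>y. (x, y) \<in> V" using that er(3) by (auto simp: W_def coded_relation_def)
  next
    assume "\<exists>y. (x, y) \<in> V"
    then obtain y where y: "(x, y) \<in> V" by blast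
    then have "y \<in> space M" using Vsp by blast
    then have "(e x, e y) \<in> W" using y coded_relation_iff[OF Vsp er(3) that] by (simp add: W_def)
    then show "e x \<in> fst ` W" by force
  qed
  show ?thesis
  proof (rule that[of "e -` D \<inter> space M"])
    show "e -` D \<inter> space M \<in> sets M" using er(1) D(1) by (rule measurable_sets)
    show "\<forall>x\<in>e -` D \<inter> space M. \<exists>y. (x, y) \<in> V" using iff D(2) by blast
    have "AE x in M. e x \<in> fst ` W \<longrightarrow> e x \<in> D" using AE_distrD[OF er(1) D(3)] .
    then show "AE x in M. (\<exists>y. (x, y) \<in> V) \<longrightarrow> x \<in> e -` D \<inter> space M"
      using AE_space by eventually_elim (simp add: iff)
  qed
qed

text \<open>The projection is injective on the graph and therefore commutes with complements, so an
  induction over the Borel sets applies.\<close>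

lemma borel_compact_graph_preimage:
  fixes C :: "(real \<times> real) set"
  assumes C: "compact C" "inj_on fst C" and B: "B \<in> sets borel"
  shows "fst ` (C \<inter> UNIV \<times> B) \<in> sets borel"
proof -
  have "B \<in> sigma_sets UNIV {S. closed S}" using B by (simp add: borel_eq_closed)
  then show ?thesis
  proof induction
    case (Basic S)
    then show ?case by (intro borel_fst_compact compact_Int_closed C closed_Times) auto
  next
    case (Compl S)
    have "fst ` (C \<inter> UNIV \<times> (UNIV - S)) = fst ` C - fst ` (C \<inter> UNIV \<times> S)"
    proof -
      have "C \<inter> UNIV \<times> (UNIV - S) = C - (C \<inter> UNIV \<times> S)" by auto
      then show ?thesis using inj_on_image_set_diff[OF C(2), of C "C \<inter> UNIV \<times> S"] by simp
    qed
    then show ?case using Compl borel_fst_compact[OF C(1)] by simp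
  next
    case (Union S)
    have "fst ` (C \<inter> UNIV \<times> (\<Union>n. S n)) = (\<Union>n. fst ` (C \<inter> UNIV \<times> S n))" by blast
    then show ?case using Union by simp
  qed simp
qed

lemma borel_compact_graph_image:
  fixes C :: "(real \<times> real) set"
  assumes C: "compact C" "inj_on snd C" and B: "B \<in> sets borel"
  shows "snd ` (C \<inter> B \<times> UNIV) \<in> sets borel"
proof -
  have "compact (prod.swap ` C)"
    by (intro compact_continuous_image C continuous_on_swap)
  moreover have "inj_on fst (prod.swap ` C)" using C(2) by (auto simp: inj_on_def)
  ultimately have "fst ` (prod.swap ` C \<inter> UNIV \<times> B) \<in> sets borel"
    using B by (rule borel_compact_graph_preimage)
  moreover have "fst ` (prod.swap ` C \<inter> UNIV \<times> B) = snd ` (C \<inter> B \<times> UNIV)" by force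
  ultimately show ?thesis by simp
qed

text \<open>The condition on images says that the inverse is measurable on the range; in this form
  it passes to subsets, unions and compositions without mention of the inverse.\<close>

definition partial_iso :: "'a measure \<Rightarrow> ('a \<times> 'a) set \<Rightarrow> 'a set \<Rightarrow> ('a \<Rightarrow> 'a) \<Rightarrow> bool" where
  "partial_iso M R A g \<longleftrightarrow> A \<in> sets M \<and> inj_on g A \<and> (\<forall>x\<in>A. (x, g x) \<in> R) \<and>
     (\<forall>B\<in>sets M. {x \<in> A. g x \<in> B} \<in> sets M) \<and> (\<forall>B\<in>sets M. B \<subseteq> A \<longrightarrow> g ` B \<in> sets M)"

lemma partial_isoI:
  assumes "A \<in> sets M" "inj_on g A" "\<And>x. x \<in> A \<Longrightarrow> (x, g x) \<in> R"
    "\<And>B. B \<in> sets M \<Longrightarrow> {x \<in> A. g x \<in> B} \<in> sets M"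
    "\<And>B. B \<in> sets M \<Longrightarrow> B \<subseteq> A \<Longrightarrow> g ` B \<in> sets M"
  shows "partial_iso M R A g"
  using assms unfolding partial_iso_def by blast

lemma partial_isoD:
  assumes "partial_iso M R A g"
  shows "A \<in> sets M" "inj_on g A" "\<And>x. x \<in> A \<Longrightarrow> (x, g x) \<in> R"
    "\<And>B. B \<in> sets M \<Longrightarrow> {x \<in> A. g x \<in> B} \<in> sets M"
    "\<And>B. B \<in> sets M \<Longrightarrow> B \<subseteq> A \<Longrightarrow> g ` B \<in> sets M"
  using assms unfolding partial_iso_def by blast+

lemma partial_iso_subset:
  assumes g: "partial_iso M R A g" and B: "B \<in> sets M" "B \<subseteq> A"
  shows "partial_iso M R B g"
proof (rule partial_isoI)
  fix C assume "C \<in> sets M"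
  then have "B \<inter> {x \<in> A. g x \<in> C} \<in> sets M" using B(1) partial_isoD(4)[OF g] by (intro sets.Int) auto
  moreover have "B \<inter> {x \<in> A. g x \<in> C} = {x \<in> B. g x \<in> C}" using B(2) by blast
  ultimately show "{x \<in> B. g x \<in> C} \<in> sets M" by simp
next
  fix C assume C: "C \<in> sets M" "C \<subseteq> B"
  then have "C \<subseteq> A" using B(2) by simp
  with C(1) show "g ` C \<in> sets M" by (rule partial_isoD(5)[OF g])
qed (use B partial_isoD(2,3)[OF g] inj_on_subset in \<open>blast+\<close>)

lemma partial_iso_mono: "partial_iso M R A g \<Longrightarrow> R \<subseteq> R' \<Longrightarrow> partial_iso M R' A g"
  unfolding partial_iso_def by blast

text \<open>The compact injective graph on the real line is carried back to the space by the
  retraction.\<close>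

theorem partial_iso_exists:
  fixes M :: "'a measure"
  assumes M: "standard_borel M" "finite_measure M" and V: "V \<in> sets (M \<Otimes>\<^sub>M M)"
    and ctbl: "\<And>y. countable {x. (x, y) \<in> V}"
    and pos: "\<not> (AE x in M. \<forall>y. (x, y) \<notin> V)"
  obtains A g where "partial_iso M V A g" "0 < emeasure M A"
proof -
  have ne: "space M \<noteq> {}"
    using pos by (auto intro: AE_I2)
  obtain e :: "'a \<Rightarrow> real" and r where e: "e \<in> borel_measurable M" and r: "r \<in> borel \<rightarrow>\<^sub>M M" and re: "\<forall>x\<in>space M. r (e x) = x"
    by (rule standard_borel_real_retract[OF M(1) ne])
  note er = e r bspec[OF re]
  have Vsp: "V \<subseteq> space M \<times> space M" using sets.sets_into_space[OF V] by (simp add: space_pair_measure)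
  define W where "W = coded_relation e r V"
  have W: "W \<in> sets borel" unfolding W_def by (rule coded_relation_borel[OF er(1,2) V])
  have fin: "finite_measure (distr M borel e)" by (rule finite_measure.finite_measure_distr[OF M(2) er(1)])
  have W_pos: "\<not> (AE a in distr M borel e. a \<notin> fst ` W)"
  proof
    assume "AE a in distr M borel e. a \<notin> fst ` W"
    from AE_distrD[OF er(1) this] have "AE x in M. \<forall>y. (x, y) \<notin> V"
      using AE_space
    proof eventually_elim
      case (elim x)
      show ?case
      proof (intro allI notI)
        fix y assume y: "(x, y) \<in> V"
        then have "y \<in> space M" using Vsp by blast
        then have "(e x, e y) \<in> W" using y coded_relation_iff[OF Vsp er(3) elim(2)] by (simp add: W_def)
        then show False using elim(1) by force
      qed
    qed
    then show False using pos by simp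
  qed
  have W_ctbl: "countable {a. (a, b) \<in> W}" for b
  proof (rule countable_subset)
    show "{a. (a, b) \<in> W} \<subseteq> e ` {x. (x, r b) \<in> V}" by (force simp: W_def coded_relation_def)
  qed (simp add: ctbl)
  obtain C where C: "compact C" "C \<subseteq> W" "0 < emeasure (distr M borel e) (fst ` C)" "inj_on fst C" "inj_on snd C"
    by (rule positive_injective_compact[OF W fin sets_distr W_pos W_ctbl])
  have C_fun: "b = b'" if "(a, b) \<in> C" "(a, b') \<in> C" for a b b'
    using inj_onD[OF C(4), of "(a, b)" "(a, b')"] that by simp
  have C_inj: "a = a'" if "(a, b) \<in> C" "(a', b) \<in> C" for a a' b
    using inj_onD[OF C(5), of "(a, b)" "(a', b)"] that by simp
  have eB: "{b. e (r b) = b \<and> r b \<in> B} \<in> sets borel" if "B \<in> sets M" for B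
  proof -
    have "e \<circ> r \<in> borel_measurable borel" using er(2,1) by (rule measurable_comp)
    then have [measurable]: "(\<lambda>a. e (r a)) \<in> borel_measurable borel" by (simp add: comp_def)
    have "{b \<in> space borel. e (r b) = b} \<in> sets borel" by measurable
    moreover have "r -` B \<inter> space borel \<in> sets borel" using er(2) that by (rule measurable_sets)
    ultimately have "{b. e (r b) = b} \<inter> r -` B \<in> sets borel" by (intro sets.Int) simp_all
    moreover have "{b. e (r b) = b} \<inter> r -` B = {b. e (r b) = b \<and> r b \<in> B}" by blast
    ultimately show ?thesis by simp
  qed
  define A where "A = e -` fst ` C \<inter> space M"
  define g where "g x = r (THE b. (e x, b) \<in> C)" for x
  have A: "A \<in> sets M" unfolding A_def using er(1) borel_fst_compact[OF C(1)] by (rule measurable_sets)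
  have C_W: "r a \<in> space M" "r b \<in> space M" "e (r a) = a" "e (r b) = b" "(r a, r b) \<in> V" if "(a, b) \<in> C" for a b
    using that C(2) Vsp by (auto simp: W_def coded_relation_def)
  have g1: "g x = y" if "(e x, e y) \<in> C" "y \<in> space M" for x y
  proof -
    have "(THE b. (e x, b) \<in> C) = e y"
      using that(1) by (intro the_equality C_fun[of "e x"])
    then show ?thesis using er(3)[OF that(2)] by (simp add: g_def)
  qed
  have g2: "(e x, e (g x)) \<in> C" "g x \<in> space M" "(x, g x) \<in> V" if x: "x \<in> A" for x
  proof -
    obtain b where b: "(e x, b) \<in> C" using x by (auto simp: A_def)
    have "g x = r b" using g1[of x "r b"] b C_W[OF b] by simp
    then show "(e x, e (g x)) \<in> C" "g x \<in> space M" "(x, g x) \<in> V"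
      using b C_W[OF b] er(3)[of x] x by (auto simp: A_def)
  qed
  have "partial_iso M V A g"
  proof (rule partial_isoI)
    show "inj_on g A"
    proof (rule inj_onI)
      fix x y assume xy: "x \<in> A" "y \<in> A" "g x = g y"
      then have "(e x, e (g x)) \<in> C" "(e y, e (g x)) \<in> C" using g2(1)[of x] g2(1)[of y] by simp_all
      then have "e x = e y" by (rule C_inj)
      then have "r (e x) = r (e y)" by simp
      then show "x = y" using er(3) xy by (simp add: A_def)
    qed
    show "(x, g x) \<in> V" if "x \<in> A" for x by (rule g2(3)[OF that])
  next
    fix B assume B: "B \<in> sets M"
    have "{x \<in> A. g x \<in> B} = e -` fst ` (C \<inter> UNIV \<times> {b. e (r b) = b \<and> r b \<in> B}) \<inter> space M" (is "_ = ?P")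
    proof (intro equalityI subsetI)
      fix x assume "x \<in> {x \<in> A. g x \<in> B}"
      then have x: "x \<in> A" "g x \<in> B" by auto
      have "(e x, e (g x)) \<in> C \<inter> UNIV \<times> {b. e (r b) = b \<and> r b \<in> B}"
        using g2[OF x(1)] er(3) x(2) by simp
      then have "e x \<in> fst ` (C \<inter> UNIV \<times> {b. e (r b) = b \<and> r b \<in> B})" by (rule fst_imageI)
      then show "x \<in> ?P" using x(1) by (simp add: A_def)
    next
      fix x assume "x \<in> ?P"
      then obtain b where b: "(e x, b) \<in> C" "e (r b) = b" "r b \<in> B" "x \<in> space M" by auto
      then have "g x = r b" using g1[of x "r b"] C_W[OF b(1)] by simp
      moreover have "x \<in> A" using fst_imageI[OF b(1)] b(4) by (simp add: A_def)
      ultimately show "x \<in> {x \<in> A. g x \<in> B}" using b(3) by simp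
    qed
    then show "{x \<in> A. g x \<in> B} \<in> sets M"
      using measurable_sets[OF er(1) borel_compact_graph_preimage[OF C(1,4) eB[OF B]]] by simp
  next
    fix B assume B: "B \<in> sets M" "B \<subseteq> A"
    have "g ` B = e -` snd ` (C \<inter> {b. e (r b) = b \<and> r b \<in> B} \<times> UNIV) \<inter> space M" (is "_ = ?P")
    proof (intro equalityI subsetI)
      fix y assume "y \<in> g ` B"
      then obtain x where x: "x \<in> B" "y = g x" by blast
      have xA: "x \<in> A" using x B by blast
      have "(e x, e y) \<in> C \<inter> {b. e (r b) = b \<and> r b \<in> B} \<times> UNIV"
        using g2[OF xA] er(3)[of x] x xA by (simp add: A_def)
      then have "e y \<in> snd ` (C \<inter> {b. e (r b) = b \<and> r b \<in> B} \<times> UNIV)" by (rule snd_imageI)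
      then show "y \<in> ?P" using g2(2)[OF xA] x by simp
    next
      fix y assume "y \<in> ?P"
      then obtain a where a: "(a, e y) \<in> C" "e (r a) = a" "r a \<in> B" "y \<in> space M" by auto
      then have "g (r a) = y" using g1[of "r a" y] by simp
      then show "y \<in> g ` B" using a(3) by blast
    qed
    then show "g ` B \<in> sets M"
      using measurable_sets[OF er(1) borel_compact_graph_image[OF C(1,5) eB[OF B(1)]]] by simp
  qed (rule A)
  moreover have "0 < emeasure M A"
    using C(3) er(1) borel_fst_compact[OF C(1)] by (simp add: emeasure_distr A_def)
  ultimately show ?thesis by (rule that)
qed

section \<open>Measure preservation, saturations and recurrence\<close>

locale pmp_relation = prob_space M for M :: "'a measure" +
  fixes R :: "('a \<times> 'a) set"
  assumes std: "standard_borel M" and pmp: "pmp_equiv M R"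
begin

lemma R_sets: "R \<in> sets (M \<Otimes>\<^sub>M M)"
  using pmp unfolding pmp_equiv_def countable_borel_equiv_def by blast

lemma R_equiv: "equiv (space M) R"
  using pmp unfolding pmp_equiv_def countable_borel_equiv_def by blast

lemma R_space: "(x, y) \<in> R \<Longrightarrow> x \<in> space M" "(x, y) \<in> R \<Longrightarrow> y \<in> space M"
  using sets.sets_into_space[OF R_sets] by (auto simp: space_pair_measure)

lemma R_refl: "x \<in> space M \<Longrightarrow> (x, x) \<in> R"
  using R_equiv by (auto simp: equiv_def refl_on_def)

lemma R_sym: "(x, y) \<in> R \<Longrightarrow> (y, x) \<in> R"
  using R_equiv by (auto simp: equiv_def sym_def)

lemma R_trans: "(x, y) \<in> R \<Longrightarrow> (y, z) \<in> R \<Longrightarrow> (x, z) \<in> R"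
  using R_equiv unfolding equiv_def trans_def by blast

lemma R_countable: "countable {x. (x, y) \<in> R}"
proof (cases "y \<in> space M")
  case True
  then have "countable (R `` {y})"
    using pmp unfolding pmp_equiv_def countable_borel_equiv_def by blast
  moreover have "{x. (x, y) \<in> R} \<subseteq> R `` {y}" using R_sym by blast
  ultimately show ?thesis by (rule countable_subset[rotated])
next
  case False
  then have "{x. (x, y) \<in> R} = {}" using R_space(2) by blast
  then show ?thesis by (metis countable_empty)
qed

lemma partial_iso_space:
  assumes "partial_iso M R A g" "x \<in> A"
  shows "x \<in> space M" "g x \<in> space M"
  using partial_isoD(3)[OF assms] R_space by blast+

text \<open>A partial isomorphism that moves its domain off itself extends to an involution:
  exchange domain and range, and fix all other points. The involution belongs to the full group and
  so preserves the measure.\<close>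

lemma partial_iso_disjoint_emeasure:
  assumes g: "partial_iso M R A g" and disj: "g ` A \<inter> A = {}"
  shows "emeasure M (g ` A) = emeasure M A"
proof -
  note gD = partial_isoD[OF g]
  have gA: "g ` A \<in> sets M" using gD(1) by (intro gD(5)) simp_all
  define h where "h x = (if x \<in> A then g x else if x \<in> g ` A then the_inv_into A g x else x)" for x
  have h1: "h x = g x" "h (g x) = x" if "x \<in> A" for x
    using that disj gD(2) by (auto simp: h_def the_inv_into_f_f)
  have h2: "h x = x" if "x \<notin> A" "x \<notin> g ` A" for x using that by (simp add: h_def)
  have hh: "h (h x) = x" for x
  proof -
    consider "x \<in> A" | "x \<in> g ` A" | "x \<notin> A" "x \<notin> g ` A" by blast
    then show ?thesis
    proof cases
      case 2
      then obtain z where "z \<in> A" "x = g z" by blast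
      then show ?thesis using h1 by simp
    qed (use h1 h2 in simp_all)
  qed
  have hR: "(x, h x) \<in> R" if "x \<in> space M" for x
  proof -
    consider "x \<in> A" | "x \<in> g ` A" | "x \<notin> A" "x \<notin> g ` A" by blast
    then show ?thesis
    proof cases
      case 1
      then show ?thesis using gD(3) h1(1) by simp
    next
      case 2
      then obtain z where "z \<in> A" "x = g z" by blast
      then show ?thesis using h1(2) gD(3) R_sym by simp
    next
      case 3
      then show ?thesis using h2 R_refl[OF that] by simp
    qed
  qed
  have hsp: "h x \<in> space M" if "x \<in> space M" for x using R_space(2)[OF hR[OF that]] .
  have bij: "bij_betw h (space M) (space M)"
    using hh hsp by (intro bij_betw_byWitness[of _ h]) auto
  have meas: "h \<in> M \<rightarrow>\<^sub>M M"
  proof (rule measurableI)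
    fix B assume B: "B \<in> sets M"
    have "h -` B \<inter> space M = {x \<in> A. g x \<in> B} \<union> g ` (A \<inter> B) \<union> (B - A - g ` A)"
    proof (intro equalityI subsetI)
      fix x assume x: "x \<in> h -` B \<inter> space M"
      consider "x \<in> A" | "x \<in> g ` A" | "x \<notin> A" "x \<notin> g ` A" by blast
      then show "x \<in> {x \<in> A. g x \<in> B} \<union> g ` (A \<inter> B) \<union> (B - A - g ` A)"
      proof cases
        case 1
        then show ?thesis using x h1(1) by simp
      next
        case 2
        then obtain z where "z \<in> A" "x = g z" by blast
        then show ?thesis using h1(2) x by simp
      next
        case 3
        then show ?thesis using h2 x by simp
      qed
    next
      fix x assume "x \<in> {x \<in> A. g x \<in> B} \<union> g ` (A \<inter> B) \<union> (B - A - g ` A)"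
      then show "x \<in> h -` B \<inter> space M"
        using h1 h2 partial_iso_space[OF g] sets.sets_into_space[OF B] by auto
    qed
    moreover have "\<dots> \<in> sets M"
      using gD(4)[OF B] gD(5)[of "A \<inter> B"] gD(1) gA B by (intro sets.Un sets.Diff) auto
    ultimately show "h -` B \<inter> space M \<in> sets M" by simp
  qed (rule hsp)
  have "the_inv_into (space M) h x = h x" if "x \<in> space M" for x
    using bij hh hsp that by (intro the_inv_into_f_eq) (auto simp: bij_betw_def)
  then have "the_inv_into (space M) h \<in> M \<rightarrow>\<^sub>M M" using meas measurable_cong by (metis (no_types, lifting))
  then have "h \<in> full_group M R"
    using bij meas hR by (simp add: full_group_def borel_automorphism_def)
  then have "distr M M h = M" using pmp unfolding pmp_equiv_def by blast
  then have "emeasure M (g ` A) = emeasure M (h -` (g ` A) \<inter> space M)"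
    using emeasure_distr[OF meas gA] by simp
  also have "h -` (g ` A) \<inter> space M = A"
  proof (intro equalityI subsetI)
    fix x assume "x \<in> h -` (g ` A) \<inter> space M"
    then obtain z where "z \<in> A" "h x = g z" by auto
    then have "x = z" using h1(2)[of z] hh[of x] by simp
    then show "x \<in> A" using \<open>z \<in> A\<close> by simp
  qed (use h1 partial_iso_space[OF g] in auto)
  finally show ?thesis .
qed

lemma partial_iso_emeasure_UN:
  assumes g: "partial_iso M R A g" and P: "\<And>n::nat. P n \<in> sets M" "A = (\<Union>n. P n)"
    and pres: "\<And>n B. B \<in> sets M \<Longrightarrow> B \<subseteq> P n \<Longrightarrow> emeasure M (g ` B) = emeasure M B"
  shows "emeasure M (g ` A) = emeasure M A"
proof -
  have D: "disjointed P n \<in> sets M" for n using sets.range_disjointed_sets[of P M] P(1) by blast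
  have DA: "A = (\<Union>n. disjointed P n)" using P(2) by (simp add: UN_disjointed_eq)
  have inj: "inj_on g A" by (rule partial_isoD(2)[OF g])
  have gD: "g ` disjointed P n \<in> sets M" for n using D DA by (intro partial_isoD(5)[OF g]) auto
  have "emeasure M (g ` A) = emeasure M (\<Union>n. g ` disjointed P n)" by (subst DA) (simp add: image_UN)
  also have "\<dots> = (\<Sum>n. emeasure M (g ` disjointed P n))"
  proof (rule suminf_emeasure[symmetric])
    show "disjoint_family (\<lambda>n. g ` disjointed P n)"
      unfolding disjoint_family_on_def
    proof (intro ballI impI)
      fix m n :: nat assume "m \<noteq> n"
      then have "disjointed P m \<inter> disjointed P n = {}"
        using disjoint_family_disjointed[of P] by (auto simp: disjoint_family_on_def)
      then show "g ` disjointed P m \<inter> g ` disjointed P n = {}"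
        using inj_on_image_Int[OF inj, of "disjointed P m" "disjointed P n"] DA by blast
    qed
  qed (use gD in auto)
  also have "\<dots> = (\<Sum>n. emeasure M (disjointed P n))"
    using pres[OF D disjointed_subset] by simp
  also have "\<dots> = emeasure M A"
    using D by (subst DA, intro suminf_emeasure disjoint_family_disjointed) auto
  finally show ?thesis .
qed

text \<open>In terms of a real coding \<open>e\<close> of the points, a point that is not fixed is
  separated from its image by a rational number. The points separated by a given rational, in a
  given direction, form a set that is moved off itself.\<close>

lemma partial_iso_emeasure:
  assumes g: "partial_iso M R A g"
  shows "emeasure M (g ` A) = emeasure M A"
proof -
  obtain e :: "'a \<Rightarrow> real" and r where e[measurable]: "e \<in> borel_measurable M" and "r \<in> borel \<rightarrow>\<^sub>M M"
    and re: "\<forall>x\<in>space M. r (e x) = x"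
    by (rule standard_borel_real_retract[OF std not_empty])
  note gD = partial_isoD[OF g]
  have ge: "{x \<in> A. Q (g x)} \<in> sets M" if "{y \<in> space M. Q y} \<in> sets M" for Q
  proof -
    have "{x \<in> A. g x \<in> {y \<in> space M. Q y}} \<in> sets M" using gD(4)[OF that] .
    moreover have "{x \<in> A. g x \<in> {y \<in> space M. Q y}} = {x \<in> A. Q (g x)}"
      using partial_iso_space[OF g] by blast
    ultimately show ?thesis by simp
  qed
  have Ae: "{x \<in> A. Q x} \<in> sets M" if "{y \<in> space M. Q y} \<in> sets M" for Q
  proof -
    have "A \<inter> {y \<in> space M. Q y} \<in> sets M" using gD(1) that by (rule sets.Int)
    moreover have "A \<inter> {y \<in> space M. Q y} = {x \<in> A. Q x}" using sets.sets_into_space[OF gD(1)] by blast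
    ultimately show ?thesis by simp
  qed
  define q where "q = from_nat_into (\<rat> :: real set)"
  have q: "range q = \<rat>" unfolding q_def
    using countable_rat by (intro range_from_nat_into) auto
  define P1 where "P1 n = {x \<in> A. e x < q n} \<inter> {x \<in> A. q n < e (g x)}" for n
  define P2 where "P2 n = {x \<in> A. q n < e x} \<inter> {x \<in> A. e (g x) < q n}" for n
  define P where "P n = (if n = 0 then {x \<in> A. g x = x} else if n = 1 then (\<Union>n. P1 n) else (\<Union>n. P2 n))" for n :: nat
  have P1: "P1 n \<in> sets M" for n unfolding P1_def by (intro sets.Int Ae ge) measurable
  have P2: "P2 n \<in> sets M" for n unfolding P2_def by (intro sets.Int Ae ge) measurable
  have PA: "P n \<subseteq> A" for n by (auto simp: P_def P1_def P2_def)
  have between: "\<exists>n. a < q n \<and> q n < b" if ab: "a < b" for a b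
  proof -
    obtain s where "s \<in> \<rat>" "a < s" "s < b" using Rats_dense_in_real[OF ab] by blast
    moreover from this obtain n where "s = q n" using q by (metis rangeE)
    ultimately show ?thesis by blast
  qed
  have U1: "(\<Union>n. P1 n) = {x \<in> A. e x < e (g x)}"
  proof (intro equalityI subsetI)
    fix x assume x: "x \<in> {x \<in> A. e x < e (g x)}"
    then obtain n where "e x < q n" "q n < e (g x)" using between[of "e x" "e (g x)"] by blast
    then show "x \<in> (\<Union>n. P1 n)" using x by (auto simp: P1_def)
  qed (auto simp: P1_def)
  have U2: "(\<Union>n. P2 n) = {x \<in> A. e (g x) < e x}"
  proof (intro equalityI subsetI)
    fix x assume x: "x \<in> {x \<in> A. e (g x) < e x}"
    then obtain n where "e (g x) < q n" "q n < e x" using between[of "e (g x)" "e x"] by blast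
    then show "x \<in> (\<Union>n. P2 n)" using x by (auto simp: P2_def)
  qed (auto simp: P2_def)
  have P0: "{x \<in> A. g x = x} = A - (\<Union>n. P1 n) - (\<Union>n. P2 n)"
  proof -
    have "g x = x" if "x \<in> A" "e (g x) = e x" for x
    proof -
      have "r (e (g x)) = r (e x)" using that(2) by simp
      then show ?thesis using re partial_iso_space[OF g that(1)] by simp
    qed
    then show ?thesis unfolding U1 U2 by force
  qed
  show ?thesis
  proof (rule partial_iso_emeasure_UN[OF g, of P])
    show PS: "P n \<in> sets M" for n
    proof -
      have "(\<Union>n. P1 n) \<in> sets M" "(\<Union>n. P2 n) \<in> sets M" using P1 P2 by blast+
      then show ?thesis unfolding P_def P0 using gD(1) by simp
    qed
    show "A = (\<Union>n. P n)"
    proof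
      show "(\<Union>n. P n) \<subseteq> A" using PA by blast
      have "A \<subseteq> P 0 \<union> P 1 \<union> P 2" unfolding P_def P0 by auto
      then show "A \<subseteq> (\<Union>n. P n)" by blast
    qed
    fix n B assume B: "B \<in> sets M" "B \<subseteq> P n"
    have gB: "partial_iso M R B g" using B PA[of n] by (intro partial_iso_subset[OF g]) auto
    have half: "emeasure M (g ` B) = emeasure M B"
      if Q: "\<And>n. Q n \<in> sets M" "\<And>n. Q n \<subseteq> A" "\<And>n. g ` Q n \<inter> Q n = {}" "B \<subseteq> (\<Union>n. Q n)" for Q :: "nat \<Rightarrow> 'a set"
    proof (rule partial_iso_emeasure_UN[OF gB, of "\<lambda>n. B \<inter> Q n"])
      show "B \<inter> Q n \<in> sets M" for n using B Q by auto
      show "B = (\<Union>n. B \<inter> Q n)" using Q(4) by blast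
      fix n C assume C: "C \<in> sets M" "C \<subseteq> B \<inter> Q n"
      have "partial_iso M R C g" using C by (intro partial_iso_subset[OF gB]) auto
      moreover have "g ` C \<inter> C = {}" using C(2) Q(3)[of n] by blast
      ultimately show "emeasure M (g ` C) = emeasure M C" by (rule partial_iso_disjoint_emeasure)
    qed
    consider "n = 0" | "n = 1" | "n \<noteq> 0" "n \<noteq> 1" by blast
    then show "emeasure M (g ` B) = emeasure M B"
    proof cases
      case 1
      then have "g ` B = B" using B(2) by (force simp: P_def)
      then show ?thesis by simp
    next
      case 2
      show ?thesis
      proof (rule half[of P1])
        show "B \<subseteq> (\<Union>n. P1 n)" using B(2) 2 by (simp add: P_def)
      qed (use P1 in \<open>auto simp: P1_def\<close>)
    next
      case 3
      show ?thesis
      proof (rule half[of P2])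
        show "B \<subseteq> (\<Union>n. P2 n)" using B(2) 3 by (simp add: P_def)
      qed (use P2 in \<open>auto simp: P2_def\<close>)
    qed
  qed
qed

text \<open>Otherwise a set of positive measure outside \<open>N\<close> would be mapped into
  \<open>N\<close> by a partial isomorphism.\<close>

lemma null_saturation:
  assumes N: "N \<in> null_sets M"
  shows "AE x in M. \<forall>y. (x, y) \<in> R \<longrightarrow> y \<notin> N"
proof -
  define V where "V = R \<inter> (space M - N) \<times> N"
  have NS: "N \<in> sets M" using N by auto
  have V: "V \<in> sets (M \<Otimes>\<^sub>M M)" unfolding V_def using R_sets NS by (intro sets.Int pair_measureI) auto
  have ctbl: "countable {x. (x, y) \<in> V}" for y
    by (rule countable_subset[OF _ R_countable[of y]]) (auto simp: V_def)
  have "AE x in M. \<forall>y. (x, y) \<notin> V"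
  proof (rule ccontr)
    assume not_null: "\<not> ?thesis"
    obtain A g where g: "partial_iso M V A g" "0 < emeasure M A"
      by (rule partial_iso_exists[OF std finite_measure_axioms V ctbl not_null])
    have "partial_iso M R A g" using g(1) by (rule partial_iso_mono) (simp add: V_def)
    then have "emeasure M (g ` A) = emeasure M A" by (rule partial_iso_emeasure)
    moreover have "g ` A \<subseteq> N" using partial_isoD(3)[OF g(1)] by (auto simp: V_def)
    then have "emeasure M (g ` A) \<le> emeasure M N" using NS by (rule emeasure_mono)
    moreover have "emeasure M N = 0" using N by auto
    ultimately show False using g(2) by simp
  qed
  moreover have "AE x in M. x \<notin> N" using N by (rule AE_not_in)
  ultimately show ?thesis using AE_space by eventually_elim (auto simp: V_def)
qed

lemma AE_class:
  assumes "AE x in M. P x"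
  shows "AE x in M. \<forall>y. (x, y) \<in> R \<longrightarrow> P y"
proof -
  obtain N where N: "{x \<in> space M. \<not> P x} \<subseteq> N" "emeasure M N = 0" "N \<in> sets M"
    using AE_E[OF assms] by blast
  then have "N \<in> null_sets M" by auto
  from null_saturation[OF this] show ?thesis
  proof (rule eventually_mono, intro allI impI)
    fix x y assume xy: "\<forall>y. (x, y) \<in> R \<longrightarrow> y \<notin> N" "(x, y) \<in> R"
    then show "P y" using N(1) R_space(2)[OF xy(2)] by blast
  qed
qed

text \<open>Properties that hold almost everywhere may be assumed to hold everywhere on an exactly
  invariant conull Borel set. It is obtained by adding countably many null sets, each of which
  covers the saturation of the previous one.\<close>

lemma invariant_core:
  assumes "AE x in M. P x"
  obtains Y where "Y \<in> sets M" "AE x in M. x \<in> Y" "\<forall>x\<in>Y. P x" "\<forall>x\<in>Y. \<forall>y. (x, y) \<in> R \<longrightarrow> y \<in> Y"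
proof -
  obtain N where N: "{x \<in> space M. \<not> P x} \<subseteq> N" "emeasure M N = 0" "N \<in> sets M"
    using AE_E[OF assms] by blast
  have "\<exists>f. \<forall>n. (f n \<in> null_sets M \<and> N \<subseteq> f n) \<and> (\<forall>x\<in>space M. \<forall>y\<in>f n. (x, y) \<in> R \<longrightarrow> x \<in> f (Suc n))"
  proof (rule dependent_nat_choice)
    show "\<exists>B. B \<in> null_sets M \<and> N \<subseteq> B" using N(2,3) by (intro exI[of _ N]) auto
  next
    fix B and n :: nat assume B: "B \<in> null_sets M \<and> N \<subseteq> B"
    then have ae: "AE x in M. \<forall>y. (x, y) \<in> R \<longrightarrow> y \<notin> B" using null_saturation by blast
    obtain C where C: "{x \<in> space M. \<not> (\<forall>y. (x, y) \<in> R \<longrightarrow> y \<notin> B)} \<subseteq> C" "emeasure M C = 0" "C \<in> sets M"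
      using AE_E[OF ae] by blast
    then have "B \<union> C \<in> null_sets M" using B by (intro null_sets.Un null_setsI) auto
    then show "\<exists>D. (D \<in> null_sets M \<and> N \<subseteq> D) \<and> (\<forall>x\<in>space M. \<forall>y\<in>B. (x, y) \<in> R \<longrightarrow> x \<in> D)"
      using B C(1) by (intro exI[of _ "B \<union> C"]) auto
  qed
  then obtain f where f: "\<And>n. f n \<in> null_sets M" "\<And>n. N \<subseteq> f n"
    "\<And>n x y. x \<in> space M \<Longrightarrow> y \<in> f n \<Longrightarrow> (x, y) \<in> R \<Longrightarrow> x \<in> f (Suc n)" by blast
  have UN: "(\<Union>n. f n) \<in> null_sets M" using f(1) by (intro null_sets_UN) auto
  define Y where "Y = space M - (\<Union>n. f n)"
  show ?thesis
  proof (rule that[of Y])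
    show "Y \<in> sets M" unfolding Y_def using UN by auto
    show "AE x in M. x \<in> Y" using AE_not_in[OF UN] AE_space unfolding Y_def by eventually_elim blast
    show "\<forall>x\<in>Y. P x" using N(1) f(2) unfolding Y_def by blast
    show "\<forall>x\<in>Y. \<forall>y. (x, y) \<in> R \<longrightarrow> y \<in> Y"
    proof (intro ballI allI impI)
      fix x y assume x: "x \<in> Y" and xy: "(x, y) \<in> R"
      have "y \<notin> f n" for n
      proof
        assume "y \<in> f n"
        then have "x \<in> f (Suc n)" using f(3)[OF R_space(1)[OF xy] _ xy] by blast
        then show False using x by (auto simp: Y_def)
      qed
      then show "y \<in> Y" using R_space(2)[OF xy] by (simp add: Y_def)
    qed
  qed
qed

text \<open>The saturation of \<open>A\<close> is a projection, so it coincides almost everywhere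
  with a Borel set. This set is invariant and contains almost all of \<open>A\<close>.\<close>

lemma ergodic_recurrence:
  assumes E: "E \<in> sets (M \<Otimes>\<^sub>M M)" "E \<subseteq> R"
    and E_refl: "AE x in M. (x, x) \<in> E"
    and E_eq: "AE x in M. \<forall>y. (x, y) \<in> E \<longrightarrow> (\<forall>z. (x, z) \<in> E \<longleftrightarrow> (y, z) \<in> E)"
    and erg: "\<And>B. invariant_borel_set M E B \<Longrightarrow> emeasure M B = 0 \<or> emeasure M B = 1"
    and A: "A \<in> sets M" "emeasure M A > 0"
  shows "AE x in M. \<exists>z\<in>A. (x, z) \<in> E"
proof -
  define V where "V = E \<inter> space M \<times> A"
  have V: "V \<in> sets (M \<Otimes>\<^sub>M M)" unfolding V_def using E(1) A(1) by (intro sets.Int pair_measureI) auto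
  obtain B where B: "B \<in> sets M" and BV: "\<forall>x\<in>B. \<exists>y. (x, y) \<in> V"
    and VB: "AE x in M. (\<exists>y. (x, y) \<in> V) \<longrightarrow> x \<in> B"
    by (rule projection_measurable[OF std finite_measure_axioms V])
  have Vx: "(\<exists>y. (x, y) \<in> V) \<longleftrightarrow> (\<exists>z\<in>A. (x, z) \<in> E)" for x
    using E(2) R_space(1) by (auto simp: V_def)
  have iff: "AE x in M. x \<in> B \<longleftrightarrow> (\<exists>z\<in>A. (x, z) \<in> E)"
    using VB by (rule eventually_mono) (use BV Vx in blast)
  have "invariant_borel_set M E B"
    unfolding invariant_borel_set_def
  proof
    show "AE x in M. \<forall>y. (x, y) \<in> E \<longrightarrow> (x \<in> B \<longleftrightarrow> y \<in> B)"
      using iff AE_class[OF iff] E_eq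
    proof eventually_elim
      case (elim x)
      show ?case
      proof (intro allI impI)
        fix y assume xy: "(x, y) \<in> E"
        then have "y \<in> B \<longleftrightarrow> (\<exists>z\<in>A. (y, z) \<in> E)" using elim(2) E(2) by blast
        then show "x \<in> B \<longleftrightarrow> y \<in> B" using elim(1,3) xy by blast
      qed
    qed
  qed (rule B)
  then have "emeasure M B = 0 \<or> emeasure M B = 1" by (rule erg)
  moreover have "emeasure M A \<le> emeasure M B"
  proof (rule emeasure_mono_AE)
    show "AE x in M. x \<in> A \<longrightarrow> x \<in> B" using iff E_refl by eventually_elim blast
  qed (rule B)
  ultimately have "emeasure M B = 1" using A(2) by auto
  then have "AE x in M. x \<in> B" using B by (simp add: AE_in_set_eq_1 emeasure_eq_measure)
  then show ?thesis using iff by eventually_elim blast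
qed

end

section \<open>Full groups and exhaustion\<close>

lemma partial_iso_UN:
  fixes C :: "nat \<Rightarrow> 'a set"
  assumes g: "\<And>n. partial_iso M R (C n) (g n)"
    and dom: "disjoint_family C" and ran: "disjoint_family (\<lambda>n. g n ` C n)"
  obtains \<theta> where "partial_iso M R (\<Union>n. C n) \<theta>" "\<forall>n. \<forall>x\<in>C n. \<theta> x = g n x"
proof -
  define \<theta> where "\<theta> x = g (LEAST n. x \<in> C n) x" for x
  have \<theta>: "\<theta> x = g n x" if x: "x \<in> C n" for n x
  proof -
    have "(LEAST n. x \<in> C n) = n"
    proof (rule Least_equality)
      fix m assume "x \<in> C m"
      then have "C m \<inter> C n \<noteq> {}" using x by blast
      then have "m = n" using dom unfolding disjoint_family_on_def by blast
      then show "n \<le> m" by simp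
    qed (rule x)
    then show ?thesis by (simp add: \<theta>_def)
  qed
  have img: "\<theta> ` B = g n ` B" if "B \<subseteq> C n" for n B
    using \<theta> that by (intro image_cong) auto
  have "partial_iso M R (\<Union>n. C n) \<theta>"
  proof (rule partial_isoI)
    show "(\<Union>n. C n) \<in> sets M" using partial_isoD(1)[OF g] by (intro sets.countable_UN) auto
    show "inj_on \<theta> (\<Union>n. C n)"
    proof (rule inj_onI)
      fix x y assume "x \<in> (\<Union>n. C n)" "y \<in> (\<Union>n. C n)" and eq: "\<theta> x = \<theta> y"
      then obtain m n where mn: "x \<in> C m" "y \<in> C n" by blast
      have th: "\<theta> x = g m x" "\<theta> x = g n y" using \<theta>[OF mn(1)] \<theta>[OF mn(2)] eq by simp_all
      then have "\<theta> x \<in> g m ` C m \<inter> g n ` C n" using mn by blast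
      then have "m = n" using ran unfolding disjoint_family_on_def by blast
      then show "x = y" using mn th inj_onD[OF partial_isoD(2)[OF g, of m], of x y] by simp
    qed
    show "(x, \<theta> x) \<in> R" if "x \<in> (\<Union>n. C n)" for x
      using that \<theta> partial_isoD(3)[OF g] by auto
  next
    fix B assume B: "B \<in> sets M"
    have "{x \<in> \<Union>n. C n. \<theta> x \<in> B} = (\<Union>n. {x \<in> C n. g n x \<in> B})"
      using \<theta> by auto
    then show "{x \<in> \<Union>n. C n. \<theta> x \<in> B} \<in> sets M"
      using partial_isoD(4)[OF g B] by simp
  next
    fix B assume B: "B \<in> sets M" "B \<subseteq> (\<Union>n. C n)"
    have "\<theta> ` B = (\<Union>n. \<theta> ` (B \<inter> C n))" using B(2) by blast
    also have "\<dots> = (\<Union>n. g n ` (B \<inter> C n))" by (intro SUP_cong img) auto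
    also have "\<dots> \<in> sets M"
    proof (intro sets.countable_UN, rule image_subsetI)
      show "g n ` (B \<inter> C n) \<in> sets M" for n
        using B(1) partial_isoD(1)[OF g, of n] by (intro partial_isoD(5)[OF g]) auto
    qed
    finally show "\<theta> ` B \<in> sets M" .
  qed
  then show ?thesis using \<theta> by (intro that[of \<theta>]) auto
qed

lemma partial_iso_comp:
  assumes f: "partial_iso M Q A f" and g: "partial_iso M R B g" and AB: "f ` A \<subseteq> B"
    and V: "\<And>x y z. (x, y) \<in> Q \<Longrightarrow> (y, z) \<in> R \<Longrightarrow> (x, z) \<in> V"
  shows "partial_iso M V A (g \<circ> f)"
proof (rule partial_isoI)
  show "inj_on (g \<circ> f) A"
    using partial_isoD(2)[OF f] inj_on_subset[OF partial_isoD(2)[OF g] AB] by (rule comp_inj_on)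
  show "(x, (g \<circ> f) x) \<in> V" if "x \<in> A" for x
    using V[OF partial_isoD(3)[OF f that] partial_isoD(3)[OF g]] AB that by auto
next
  fix C assume "C \<in> sets M"
  then have "{x \<in> A. f x \<in> {y \<in> B. g y \<in> C}} \<in> sets M"
    by (intro partial_isoD(4)[OF f] partial_isoD(4)[OF g])
  moreover have "{x \<in> A. f x \<in> {y \<in> B. g y \<in> C}} = {x \<in> A. (g \<circ> f) x \<in> C}" using AB by auto
  ultimately show "{x \<in> A. (g \<circ> f) x \<in> C} \<in> sets M" by simp
next
  fix C assume C: "C \<in> sets M" "C \<subseteq> A"
  then have "f ` C \<in> sets M" by (rule partial_isoD(5)[OF f])
  moreover have "f ` C \<subseteq> B" using C(2) AB by blast
  ultimately show "(g \<circ> f) ` C \<in> sets M" unfolding image_comp[symmetric] by (rule partial_isoD(5)[OF g])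
qed (rule partial_isoD(1)[OF f])

lemma full_group_partial_iso:
  assumes f: "f \<in> full_group M R" and A: "A \<in> sets M"
  shows "partial_iso M R A f"
proof (rule partial_isoI)
  have bij: "bij_betw f (space M) (space M)" and meas: "f \<in> M \<rightarrow>\<^sub>M M"
    and inv: "the_inv_into (space M) f \<in> M \<rightarrow>\<^sub>M M" and R: "\<And>x. x \<in> space M \<Longrightarrow> (x, f x) \<in> R"
    using f by (auto simp: full_group_def borel_automorphism_def)
  have inj: "inj_on f (space M)" using bij by (rule bij_betw_imp_inj_on)
  have sp: "A \<subseteq> space M" using sets.sets_into_space[OF A] .
  show "inj_on f A" using inj sp by (rule inj_on_subset)
  show "(x, f x) \<in> R" if "x \<in> A" for x using R sp that by blast
  show "{x \<in> A. f x \<in> B} \<in> sets M" if B: "B \<in> sets M" for B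
  proof -
    have "A \<inter> (f -` B \<inter> space M) \<in> sets M" using A measurable_sets[OF meas B] by (rule sets.Int)
    moreover have "A \<inter> (f -` B \<inter> space M) = {x \<in> A. f x \<in> B}" using sp by blast
    ultimately show ?thesis by simp
  qed
  show "f ` B \<in> sets M" if B: "B \<in> sets M" "B \<subseteq> A" for B
  proof -
    have Bsp: "B \<subseteq> space M" using B(2) sp by simp
    have "f ` B = the_inv_into (space M) f -` B \<inter> space M"
    proof (intro equalityI subsetI)
      fix y assume "y \<in> f ` B"
      then show "y \<in> the_inv_into (space M) f -` B \<inter> space M"
        using Bsp bij inj by (auto simp: the_inv_into_f_f bij_betw_apply subset_iff)
    next
      fix y assume y: "y \<in> the_inv_into (space M) f -` B \<inter> space M"
      then have "f (the_inv_into (space M) f y) = y" using bij by (intro f_the_inv_into_f_bij_betw) auto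
      then show "y \<in> f ` B" using y by (metis IntD1 image_eqI vimageD)
    qed
    then show ?thesis using measurable_sets[OF inv B(1)] by simp
  qed
qed (rule A)

context pmp_relation
begin

text \<open>On an invariant conull core the partial isomorphism is a bijection of the core, so it
  can be completed by the identity to an automorphism of the whole space.\<close>

lemma conull_partial_iso_full_group:
  assumes g: "partial_iso M R A g" and dom: "AE x in M. x \<in> A" and ran: "AE x in M. x \<in> g ` A"
  obtains c where "c \<in> full_group M R" "AE x in M. c x = g x"
proof -
  note gD = partial_isoD[OF g]
  have "AE x in M. x \<in> A \<and> x \<in> g ` A" using dom ran by eventually_elim blast
  then obtain Y where Y: "Y \<in> sets M" "AE x in M. x \<in> Y" "\<forall>x\<in>Y. x \<in> A \<and> x \<in> g ` A"
    "\<forall>x\<in>Y. \<forall>y. (x, y) \<in> R \<longrightarrow> y \<in> Y"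
    by (rule invariant_core)
  have YA: "Y \<subseteq> A" using Y(3) by blast
  have gY: "g x \<in> Y \<longleftrightarrow> x \<in> Y" if "x \<in> A" for x
    using Y(4) gD(3)[OF that] R_sym by blast
  have gYY: "g ` Y = Y"
  proof
    show "g ` Y \<subseteq> Y" using gY YA by auto
    show "Y \<subseteq> g ` Y"
    proof
      fix y assume y: "y \<in> Y"
      then obtain x where "x \<in> A" "y = g x" using Y(3) by blast
      then show "y \<in> g ` Y" using gY y by blast
    qed
  qed
  have Ysp: "Y \<subseteq> space M" using sets.sets_into_space[OF Y(1)] .
  define c where "c x = (if x \<in> Y then g x else x)" for x
  have inj: "inj_on c (space M)"
  proof (rule inj_onI)
    fix x y assume "c x = c y"
    then show "x = y" using gY YA inj_onD[OF gD(2), of x y]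
      by (auto simp: c_def split: if_splits)
  qed
  have img: "c ` B = g ` (B \<inter> Y) \<union> (B - Y)" for B by (auto simp: c_def)
  have c_img: "c ` space M = space M"
    using gYY Ysp by (simp add: img Int_absorb1 Un_absorb1 Un_Diff_cancel)
  have bij: "bij_betw c (space M) (space M)" using inj c_img by (simp add: bij_betw_def)
  have c_R: "(x, c x) \<in> R" if "x \<in> space M" for x
    using that gD(3) YA R_refl by (auto simp: c_def)
  have meas: "c \<in> M \<rightarrow>\<^sub>M M"
  proof (rule measurableI)
    fix B assume B: "B \<in> sets M"
    have "c -` B \<inter> space M = ({x \<in> A. g x \<in> B} \<inter> Y) \<union> (B - Y)"
      using YA Ysp sets.sets_into_space[OF B] by (auto simp: c_def split: if_splits)
    then show "c -` B \<inter> space M \<in> sets M" using gD(4)[OF B] Y(1) B by simp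
  qed (use R_space(2)[OF c_R] in blast)
  have "the_inv_into (space M) c \<in> M \<rightarrow>\<^sub>M M"
  proof (rule measurableI)
    fix x assume "x \<in> space M"
    then show "the_inv_into (space M) c x \<in> space M" using inj c_img by (intro the_inv_into_into) auto
  next
    fix B assume B: "B \<in> sets M"
    have Bsp: "B \<subseteq> space M" using sets.sets_into_space[OF B] .
    have "the_inv_into (space M) c -` B \<inter> space M = c ` B"
    proof (intro equalityI subsetI)
      fix y assume y: "y \<in> the_inv_into (space M) c -` B \<inter> space M"
      then have "c (the_inv_into (space M) c y) = y" using bij by (intro f_the_inv_into_f_bij_betw) auto
      then show "y \<in> c ` B" using y by (metis IntD1 image_eqI vimageD)
    next
      fix y assume "y \<in> c ` B"
      then obtain x where x: "x \<in> B" "y = c x" by blast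
      then have "x \<in> space M" using Bsp by blast
      then show "y \<in> the_inv_into (space M) c -` B \<inter> space M"
        using x inj c_img by (auto simp: the_inv_into_f_f)
    qed
    also have "\<dots> \<in> sets M"
      unfolding img using B Y(1) YA by (intro sets.Un sets.Diff gD(5) sets.Int) auto
    finally show "the_inv_into (space M) c -` B \<inter> space M \<in> sets M" .
  qed
  then have "c \<in> full_group M R" using bij meas c_R by (simp add: full_group_def borel_automorphism_def)
  moreover have "AE x in M. c x = g x" using Y(2) by eventually_elim (simp add: c_def)
  ultimately show ?thesis by (rule that)
qed

lemma id_full_group: "(\<lambda>x. x) \<in> full_group M R"
proof -
  have "the_inv_into (space M) (\<lambda>x. x) x = x" if "x \<in> space M" for x
    using that by (intro the_inv_into_f_eq) auto
  then have "the_inv_into (space M) (\<lambda>x. x) \<in> M \<rightarrow>\<^sub>M M"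
    using measurable_cong[of M "the_inv_into (space M) (\<lambda>x. x)" "\<lambda>x. x" M] by simp
  then show ?thesis using R_refl by (auto simp: full_group_def borel_automorphism_def bij_betw_def)
qed

text \<open>Choice functions have to be defined everywhere and have to contain the identity exactly;
  partial isomorphisms that have these properties up to null sets are corrected here.\<close>

lemma choice_family_from_partial_isos:
  assumes I: "i0 \<in> I" "countable I" and g0: "AE x in M. g i0 x = x"
    and g: "\<And>i. i \<in> I \<Longrightarrow> partial_iso M R (A i) (g i)"
    and dom: "\<And>i. i \<in> I \<Longrightarrow> AE x in M. x \<in> A i"
    and ran: "\<And>i. i \<in> I \<Longrightarrow> AE x in M. x \<in> g i ` A i"
  obtains c where "\<forall>i\<in>I. c i \<in> full_group M R" "\<exists>i\<in>I. \<forall>x\<in>space M. c i x = x"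
    "AE x in M. \<forall>i\<in>I. c i x = g i x"
proof -
  have "\<exists>c. c \<in> full_group M R \<and> (AE x in M. c x = g i x)" if "i \<in> I" for i
    using conull_partial_iso_full_group[OF g dom ran, OF that that that] by blast
  then have "\<forall>i\<in>I. \<exists>c. c \<in> full_group M R \<and> (AE x in M. c x = g i x)" by blast
  from bchoice[OF this] obtain b where b: "\<forall>i\<in>I. b i \<in> full_group M R \<and> (AE x in M. b i x = g i x)"
    by blast
  define c where "c i = (if i = i0 then (\<lambda>x. x) else b i)" for i
  have "AE x in M. c i x = g i x" if "i \<in> I" for i
  proof (cases "i = i0")
    case True
    then show ?thesis using g0 by (auto simp: c_def elim!: eventually_mono)
  next
    case False
    then show ?thesis using b that by (simp add: c_def)
  qed
  then have "AE x in M. \<forall>i\<in>I. c i x = g i x" using I(2) by (intro AE_ball_countable')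
  moreover have "\<forall>i\<in>I. c i \<in> full_group M R" using b id_full_group by (simp add: c_def)
  moreover have "\<exists>i\<in>I. \<forall>x\<in>space M. c i x = x" using I(1) by (auto simp: c_def)
  ultimately show ?thesis by (intro that[of c])
qed

lemma ergodic_saturation:
  assumes "ergodic_rel M R" and A: "A \<in> sets M" "emeasure M A > 0"
  shows "AE x in M. \<exists>z\<in>A. (x, z) \<in> R"
proof (rule ergodic_recurrence[OF R_sets order_refl _ _ _ A])
  show "AE x in M. (x, x) \<in> R" using R_refl by (intro AE_I2)
  show "AE x in M. \<forall>y. (x, y) \<in> R \<longrightarrow> (\<forall>z. ((x, z) \<in> R) = ((y, z) \<in> R))"
    using R_sym R_trans by (intro AE_I2) blast
  show "emeasure M B = 0 \<or> emeasure M B = 1" if "invariant_borel_set M R B" for B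
    using assms(1) that unfolding ergodic_rel_def by blast
qed

text \<open>The greedy step of the exhaustion below: a piece of at least half the possible
  measure.\<close>

lemma large_partial_iso:
  obtains C g where "partial_iso M R C g" "C \<subseteq> X" "g ` C \<subseteq> Y"
    "\<forall>C' g'. partial_iso M R C' g' \<longrightarrow> C' \<subseteq> X \<longrightarrow> g' ` C' \<subseteq> Y \<longrightarrow> measure M C' \<le> 2 * measure M C"
proof -
  define S where "S = {measure M C |C. \<exists>g. partial_iso M R C g \<and> C \<subseteq> X \<and> g ` C \<subseteq> Y}"
  have empty: "partial_iso M R {} (\<lambda>x. x)" by (rule partial_isoI) auto
  have ne: "S \<noteq> {}" using empty unfolding S_def by blast
  have bdd: "bdd_above S" unfolding S_def by (intro bdd_aboveI[of _ 1]) auto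
  have up: "measure M C' \<le> Sup S" if "partial_iso M R C' g'" "C' \<subseteq> X" "g' ` C' \<subseteq> Y" for C' g'
    using that by (intro cSup_upper bdd) (auto simp: S_def)
  have "\<exists>s\<in>S. Sup S \<le> 2 * s"
  proof (cases "Sup S \<le> 0")
    case True
    have "measure M {} \<in> S" using empty unfolding S_def by blast
    then have "0 \<in> S" by simp
    then show ?thesis using True by (intro bexI[of _ 0]) auto
  next
    case False
    then have "Sup S / 2 < Sup S" by simp
    then obtain s where "s \<in> S" "Sup S / 2 < s" using less_cSup_iff[OF ne bdd] by blast
    then show ?thesis by (intro bexI[of _ s]) auto
  qed
  then obtain C g where C: "partial_iso M R C g" "C \<subseteq> X" "g ` C \<subseteq> Y" "Sup S \<le> 2 * measure M C"
    unfolding S_def by blast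
  show ?thesis
  proof (rule that[OF C(1-3)], intro allI impI)
    fix C' g' assume "partial_iso M R C' g'" "C' \<subseteq> X" "g' ` C' \<subseteq> Y"
    then have "measure M C' \<le> Sup S" by (rule up)
    then show "measure M C' \<le> 2 * measure M C" using C(4) by simp
  qed
qed

text \<open>Pieces are removed greedily from both sets. If sets of positive measure were left over,
  then by ergodicity a partial isomorphism between them would have been a candidate at every step,
  so every piece would have at least half its measure; but the measures of the disjoint pieces tend
  to zero.\<close>

theorem ergodic_partial_iso:
  assumes erg: "ergodic_rel M R" and A: "A \<in> sets M" and B: "B \<in> sets M"
    and eq: "emeasure M A = emeasure M B"
  obtains C \<theta> where "partial_iso M R C \<theta>" "C \<subseteq> A" "\<theta> ` C \<subseteq> B"
    "A - C \<in> null_sets M" "B - \<theta> ` C \<in> null_sets M"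
proof -
  define piece where "piece s p \<longleftrightarrow> partial_iso M R (fst p) (snd p) \<and> fst p \<subseteq> fst s \<and> snd p ` fst p \<subseteq> snd s \<and>
    (\<forall>C' g'. partial_iso M R C' g' \<longrightarrow> C' \<subseteq> fst s \<longrightarrow> g' ` C' \<subseteq> snd s \<longrightarrow> measure M C' \<le> 2 * measure M (fst p))"
    for s :: "'a set \<times> 'a set" and p :: "'a set \<times> ('a \<Rightarrow> 'a)"
  have ex: "\<exists>p. piece s p" for s
  proof -
    obtain C g where "partial_iso M R C g" "C \<subseteq> fst s" "g ` C \<subseteq> snd s"
      "\<forall>C' g'. partial_iso M R C' g' \<longrightarrow> C' \<subseteq> fst s \<longrightarrow> g' ` C' \<subseteq> snd s \<longrightarrow> measure M C' \<le> 2 * measure M C"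
      by (rule large_partial_iso)
    then have "piece s (C, g)" by (simp add: piece_def)
    then show ?thesis ..
  qed
  define pick where "pick s = (SOME p. piece s p)" for s
  have pick: "piece s (pick s)" for s unfolding pick_def by (rule someI_ex[OF ex])
  define st where "st = rec_nat (A, B) (\<lambda>_ s. (fst s - fst (pick s), snd s - snd (pick s) ` fst (pick s)))"
  define C where "C n = fst (pick (st n))" for n
  define g where "g n = snd (pick (st n))" for n
  have st0: "st 0 = (A, B)" by (simp add: st_def)
  have stS: "st (Suc n) = (fst (st n) - C n, snd (st n) - g n ` C n)" for n by (simp add: st_def C_def g_def)
  have iso: "partial_iso M R (C n) (g n)" and Cst: "C n \<subseteq> fst (st n)" and gst: "g n ` C n \<subseteq> snd (st n)" for n
    using pick[of "st n"] by (auto simp: piece_def C_def g_def)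
  have large: "measure M C' \<le> 2 * measure M (C n)"
    if "partial_iso M R C' g'" "C' \<subseteq> fst (st n)" "g' ` C' \<subseteq> snd (st n)" for C' g' n
    using pick[of "st n"] that unfolding piece_def C_def by blast
  have stA: "fst (st n) = A - (\<Union>i<n. C i)" for n
    by (induction n) (auto simp: st0 stS lessThan_Suc)
  have stB: "snd (st n) = B - (\<Union>i<n. g i ` C i)" for n
    by (induction n) (auto simp: st0 stS lessThan_Suc)
  have disj: "disjoint_family C"
  proof -
    have *: "C m \<inter> C n = {}" if "m < n" for m n
      using Cst[of n] that unfolding stA by blast
    show ?thesis unfolding disjoint_family_on_def by (metis * Int_commute linorder_neqE_nat)
  qed
  have disj': "disjoint_family (\<lambda>n. g n ` C n)"
  proof -
    have *: "g m ` C m \<inter> g n ` C n = {}" if "m < n" for m n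
      using gst[of n] that unfolding stB by blast
    show ?thesis unfolding disjoint_family_on_def by (metis * Int_commute linorder_neqE_nat)
  qed
  obtain \<theta> where \<theta>: "partial_iso M R (\<Union>n. C n) \<theta>" "\<forall>n. \<forall>x\<in>C n. \<theta> x = g n x"
    by (rule partial_iso_UN[OF iso disj disj'])
  define D where "D = (\<Union>n. C n)"
  have \<theta>D: "\<theta> ` D = (\<Union>n. g n ` C n)" using \<theta>(2) unfolding D_def by (auto simp: image_UN)
  have DA: "D \<subseteq> A" using Cst unfolding stA D_def by blast
  have DB: "\<theta> ` D \<subseteq> B" using gst unfolding stB \<theta>D by blast
  have D: "D \<in> sets M" using partial_isoD(1)[OF \<theta>(1)] by (simp add: D_def)
  have gD: "\<theta> ` D \<in> sets M" using partial_isoD(5)[OF \<theta>(1) D] by (simp add: D_def)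
  have meas_eq: "emeasure M (\<theta> ` D) = emeasure M D" using partial_iso_emeasure[OF \<theta>(1)] by (simp add: D_def)
  have "emeasure M (A - D) = emeasure M (B - \<theta> ` D)"
    using A B D gD DA DB meas_eq eq by (simp add: emeasure_Diff emeasure_finite)
  moreover have "emeasure M (A - D) = 0"
  proof (rule ccontr)
    assume pos: "emeasure M (A - D) \<noteq> 0"
    then have "emeasure M (B - \<theta> ` D) > 0" using calculation by (simp add: zero_less_iff_neq_zero)
    then have sat: "AE x in M. \<exists>z\<in>B - \<theta> ` D. (x, z) \<in> R"
      using B gD by (intro ergodic_saturation[OF erg]) auto
    define V where "V = R \<inter> (A - D) \<times> (B - \<theta> ` D)"
    have V: "V \<in> sets (M \<Otimes>\<^sub>M M)" unfolding V_def using R_sets A B D gD by (intro sets.Int pair_measureI) auto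
    have ctbl: "countable {x. (x, y) \<in> V}" for y
      by (rule countable_subset[OF _ R_countable[of y]]) (auto simp: V_def)
    have not_null: "\<not> (AE x in M. \<forall>y. (x, y) \<notin> V)"
    proof
      assume "AE x in M. \<forall>y. (x, y) \<notin> V"
      with sat have "AE x in M. x \<notin> A - D" by eventually_elim (auto simp: V_def)
      then have "emeasure M (A - D) = 0" using A D by (subst (asm) AE_iff_null_sets[symmetric]) auto
      then show False using pos by simp
    qed
    obtain C' g' where g': "partial_iso M V C' g'" "0 < emeasure M C'"
      by (rule partial_iso_exists[OF std finite_measure_axioms V ctbl not_null])
    have g'R: "partial_iso M R C' g'" using g'(1) by (rule partial_iso_mono) (simp add: V_def)
    have sub: "C' \<subseteq> A - D" "g' ` C' \<subseteq> B - \<theta> ` D" using partial_isoD(3)[OF g'(1)] by (auto simp: V_def)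
    have "C' \<subseteq> fst (st n)" "g' ` C' \<subseteq> snd (st n)" for n
    proof -
      have "(\<Union>i<n. C i) \<subseteq> D" "(\<Union>i<n. g i ` C i) \<subseteq> \<theta> ` D" unfolding \<theta>D by (auto simp: D_def)
      then show "C' \<subseteq> fst (st n)" "g' ` C' \<subseteq> snd (st n)" using sub unfolding stA stB by blast+
    qed
    then have le: "measure M C' \<le> 2 * measure M (C n)" for n by (intro large[OF g'R])
    have "(\<lambda>n. measure M (C n)) sums measure M D"
      unfolding D_def using partial_isoD(1)[OF iso] disj by (intro finite_measure_UNION) auto
    then have "(\<lambda>n. measure M (C n)) \<longlonglongrightarrow> 0" by (intro summable_LIMSEQ_zero sums_summable)
    then have "(\<lambda>n. 2 * measure M (C n)) \<longlonglongrightarrow> 2 * 0" by (intro tendsto_mult tendsto_const)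
    then have "measure M C' \<le> 2 * 0" by (rule LIMSEQ_le_const) (use le in blast)
    then show False using g'(2) by (simp add: emeasure_eq_measure)
  qed
  ultimately have "A - D \<in> null_sets M" "B - \<theta> ` D \<in> null_sets M" using A B D gD by (auto intro!: null_setsI)
  then show ?thesis using \<theta>(1) DA DB by (intro that[of D \<theta>]) (auto simp: D_def)
qed

end

section \<open>Permutation groups with the topology of pointwise convergence\<close>

text \<open>For finite \<open>F\<close> these are the basic neighbourhoods of \<open>h\<close>; for
  the identity they are the pointwise stabilizers.\<close>

definition agreeing :: "'i set \<Rightarrow> ('i \<Rightarrow> 'i) \<Rightarrow> 'i set \<Rightarrow> ('i \<Rightarrow> 'i) set" where
  "agreeing I h F = {g \<in> Bij I. \<forall>i\<in>F. g i = h i}"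

lemma topspace_sym_topology[simp]: "topspace (sym_topology I) = Bij I"
proof -
  have "Bij I \<subseteq> PiE I (\<lambda>_. I)" using Bij_imp_funcset Bij_imp_extensional by (auto simp: PiE_def)
  then show ?thesis unfolding sym_topology_def by (simp add: Int_absorb1)
qed

lemma Bij_apply: "f \<in> Bij I \<Longrightarrow> i \<in> I \<Longrightarrow> f i \<in> I"
  using Bij_imp_funcset by blast

lemma Bij_inj: "f \<in> Bij I \<Longrightarrow> i \<in> I \<Longrightarrow> j \<in> I \<Longrightarrow> f i = f j \<Longrightarrow> i = j"
  by (auto simp: Bij_def bij_betw_def dest: inj_onD)

lemma Bij_eqI:
  assumes "f \<in> Bij I" "g \<in> Bij I" "\<And>i. i \<in> I \<Longrightarrow> f i = g i"
  shows "f = g"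
  using assms Bij_imp_extensional by (intro extensionalityI) blast+

lemma BijGroup_mult:
  "f \<in> Bij I \<Longrightarrow> g \<in> Bij I \<Longrightarrow> f \<otimes>\<^bsub>BijGroup I\<^esub> g = compose I f g"
  by (simp add: BijGroup_def)

lemma openin_agreeing:
  assumes h: "h \<in> Bij I" and F: "finite F" "F \<subseteq> I"
  shows "openin (sym_topology I) (agreeing I h F)"
proof -
  define W where "W i = (if i \<in> F then {h i} else I)" for i
  have W: "finite {i \<in> I. W i \<noteq> I}" by (rule finite_subset[OF _ F(1)]) (auto simp: W_def)
  have "W i \<subseteq> I" if "i \<in> I" for i using Bij_apply[OF h that] by (simp add: W_def)
  then have "openin (product_topology (\<lambda>_. discrete_topology I) I) (PiE I W)"
    using W by (subst openin_PiE_gen) auto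
  moreover have "agreeing I h F = PiE I W \<inter> Bij I"
  proof (intro equalityI subsetI)
    fix g assume "g \<in> agreeing I h F"
    then have g: "g \<in> Bij I" "\<forall>i\<in>F. g i = h i" by (auto simp: agreeing_def)
    then have "g \<in> PiE I W" using Bij_apply[OF g(1)] Bij_imp_extensional[OF g(1)] by (intro PiE_I) (auto simp: W_def extensional_def)
    then show "g \<in> PiE I W \<inter> Bij I" using g(1) by simp
  next
    fix g assume g: "g \<in> PiE I W \<inter> Bij I"
    have "g i = h i" if "i \<in> F" for i
    proof -
      have "g i \<in> W i" using g that F(2) by blast
      then show ?thesis using that by (simp add: W_def)
    qed
    then show "g \<in> agreeing I h F" using g by (simp add: agreeing_def)
  qed
  ultimately show ?thesis unfolding sym_topology_def openin_subtopology by blast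
qed

lemma openin_sym_topology_nbhd:
  assumes "openin (sym_topology I) U" "h \<in> U"
  obtains F where "finite F" "F \<subseteq> I" "agreeing I h F \<subseteq> U"
proof -
  obtain V where V: "openin (product_topology (\<lambda>_. discrete_topology I) I) V" "U = V \<inter> Bij I"
    using assms(1) unfolding sym_topology_def openin_subtopology by blast
  have "h \<in> V" using assms(2) V(2) by blast
  then obtain W where W: "finite {i \<in> I. W i \<noteq> I}" "h \<in> PiE I W" "PiE I W \<subseteq> V"
    using V(1) unfolding openin_product_topology_alt by force
  show ?thesis
  proof (rule that[OF W(1)])
    show "agreeing I h {i \<in> I. W i \<noteq> I} \<subseteq> U"
    proof
      fix g assume "g \<in> agreeing I h {i \<in> I. W i \<noteq> I}"
      then have g: "g \<in> Bij I" "\<And>i. i \<in> I \<Longrightarrow> W i \<noteq> I \<Longrightarrow> g i = h i" by (auto simp: agreeing_def)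
      have "g \<in> PiE I W"
      proof (rule PiE_I)
        fix i assume i: "i \<in> I"
        show "g i \<in> W i"
        proof (cases "W i = I")
          case True
          then show ?thesis using Bij_apply[OF g(1) i] by simp
        next
          case False
          then show ?thesis using g(2)[OF i False] W(2) i by auto
        qed
      next
        fix i assume "i \<notin> I"
        then show "g i = undefined" using Bij_imp_extensional[OF g(1)] by (simp add: extensional_def)
      qed
      then show "g \<in> U" using W(3) V(2) g(1) by blast
    qed
  qed simp
qed

lemma closedin_sym_topology_iff:
  "closedin (sym_topology I) C \<longleftrightarrow> C \<subseteq> Bij I \<and>
     (\<forall>h\<in>Bij I. (\<forall>F. finite F \<longrightarrow> F \<subseteq> I \<longrightarrow> C \<inter> agreeing I h F \<noteq> {}) \<longrightarrow> h \<in> C)"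
  (is "_ \<longleftrightarrow> _ \<and> ?lim")
proof
  assume cl: "closedin (sym_topology I) C"
  have "h \<in> C" if h: "h \<in> Bij I" and F: "\<forall>F. finite F \<longrightarrow> F \<subseteq> I \<longrightarrow> C \<inter> agreeing I h F \<noteq> {}" for h
  proof (rule ccontr)
    assume "h \<notin> C"
    then have "h \<in> Bij I - C" using h by blast
    moreover have "openin (sym_topology I) (Bij I - C)" using cl by (simp add: closedin_def)
    ultimately obtain F where "finite F" "F \<subseteq> I" "agreeing I h F \<subseteq> Bij I - C"
      using openin_sym_topology_nbhd by blast
    then show False using F by blast
  qed
  then show "C \<subseteq> Bij I \<and> ?lim" using closedin_subset[OF cl] by simp
next
  assume C: "C \<subseteq> Bij I \<and> ?lim"
  have "openin (sym_topology I) (Bij I - C)"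
  proof (subst openin_subopen, intro ballI)
    fix h assume h: "h \<in> Bij I - C"
    then obtain F where F: "finite F" "F \<subseteq> I" "C \<inter> agreeing I h F = {}" using C by blast
    have "openin (sym_topology I) (agreeing I h F)" using h F by (intro openin_agreeing) auto
    moreover have "h \<in> agreeing I h F" using h by (simp add: agreeing_def)
    moreover have "agreeing I h F \<subseteq> Bij I - C" using F(3) by (auto simp: agreeing_def)
    ultimately show "\<exists>T. openin (sym_topology I) T \<and> h \<in> T \<and> T \<subseteq> Bij I - C" by blast
  qed
  then show "closedin (sym_topology I) C" using C by (simp add: closedin_def)
qed

lemma subgroup_pointwise_stabilizer:
  assumes "F \<subseteq> I"
  shows "subgroup (agreeing I (\<lambda>i\<in>I. i) F) (BijGroup I)"
proof -
  interpret group "BijGroup I" by (rule group_BijGroup)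
  show ?thesis
  proof (rule subgroupI)
    show "agreeing I (\<lambda>i\<in>I. i) F \<subseteq> carrier (BijGroup I)" by (auto simp: agreeing_def BijGroup_def)
    have "(\<lambda>i\<in>I. i) \<in> agreeing I (\<lambda>i\<in>I. i) F" using id_Bij by (simp add: agreeing_def)
    then show "agreeing I (\<lambda>i\<in>I. i) F \<noteq> {}" by blast
  next
    fix a assume "a \<in> agreeing I (\<lambda>i\<in>I. i) F"
    then have a: "a \<in> Bij I" "\<And>i. i \<in> F \<Longrightarrow> a i = i" using assms by (auto simp: agreeing_def)
    have "inv_into I a i = i" if "i \<in> F" for i
    proof -
      have "i \<in> I" using that assms by blast
      then have "inv_into I a (a i) = i" using a(1) by (intro inv_into_f_f) (auto simp: Bij_def bij_betw_def)
      then show ?thesis using a(2)[OF that] by simp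
    qed
    then show "inv\<^bsub>BijGroup I\<^esub> a \<in> agreeing I (\<lambda>i\<in>I. i) F"
      using a(1) assms restrict_inv_into_Bij[OF a(1)] by (auto simp: inv_BijGroup agreeing_def)
  next
    fix a b assume "a \<in> agreeing I (\<lambda>i\<in>I. i) F" "b \<in> agreeing I (\<lambda>i\<in>I. i) F"
    then show "a \<otimes>\<^bsub>BijGroup I\<^esub> b \<in> agreeing I (\<lambda>i\<in>I. i) F"
      using assms by (auto simp: agreeing_def BijGroup_mult compose_Bij compose_eq)
  qed
qed

definition conj_bij :: "'k set \<Rightarrow> 'j set \<Rightarrow> ('k \<Rightarrow> 'j) \<Rightarrow> ('k \<Rightarrow> 'k) \<Rightarrow> 'j \<Rightarrow> 'j" where
  "conj_bij K J u h = (\<lambda>j\<in>J. u (h (inv_into K u j)))"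

lemma conj_bij_apply:
  assumes "bij_betw u K J" "k \<in> K"
  shows "conj_bij K J u h (u k) = u (h k)"
  using assms bij_betw_apply[OF assms] by (simp add: conj_bij_def bij_betw_inv_into_left)

lemma conj_bij_Bij:
  assumes u: "bij_betw u K J" and h: "h \<in> Bij K"
  shows "conj_bij K J u h \<in> Bij J"
proof -
  have "bij_betw (u \<circ> (h \<circ> inv_into K u)) J J"
    using bij_betw_inv_into[OF u] h u by (intro bij_betw_trans[of _ J K] bij_betw_trans[of _ K K]) (auto simp: Bij_def)
  then have "bij_betw (conj_bij K J u h) J J"
    by (rule bij_betw_cong[THEN iffD1, rotated]) (simp add: conj_bij_def)
  then show ?thesis by (simp add: Bij_def conj_bij_def)
qed

lemma conj_bij_inverse:
  assumes u: "bij_betw u K J" and h: "h \<in> Bij K"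
  shows "conj_bij J K (inv_into K u) (conj_bij K J u h) = h"
proof (rule Bij_eqI)
  have v: "bij_betw (inv_into K u) J K" using u by (rule bij_betw_inv_into)
  show "conj_bij J K (inv_into K u) (conj_bij K J u h) \<in> Bij K"
    by (intro conj_bij_Bij v u h)
  fix k assume k: "k \<in> K"
  have "u k \<in> J" using u k by (rule bij_betw_apply)
  then have "conj_bij J K (inv_into K u) (conj_bij K J u h) (inv_into K u (u k)) = inv_into K u (conj_bij K J u h (u k))"
    using v by (intro conj_bij_apply)
  then show "conj_bij J K (inv_into K u) (conj_bij K J u h) k = h k"
    using u k Bij_apply[OF h k] by (simp add: conj_bij_apply bij_betw_inv_into_left)
qed (rule h)

lemma conj_bij_mult:
  assumes u: "bij_betw u K J" and h: "h \<in> Bij K" "h' \<in> Bij K"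
  shows "conj_bij K J u (h \<otimes>\<^bsub>BijGroup K\<^esub> h') = conj_bij K J u h \<otimes>\<^bsub>BijGroup J\<^esub> conj_bij K J u h'"
proof (rule Bij_eqI)
  note cB = conj_bij_Bij[OF u]
  show "conj_bij K J u (h \<otimes>\<^bsub>BijGroup K\<^esub> h') \<in> Bij J"
    using h by (intro cB) (simp add: BijGroup_mult compose_Bij)
  show "conj_bij K J u h \<otimes>\<^bsub>BijGroup J\<^esub> conj_bij K J u h' \<in> Bij J"
    using cB[OF h(1)] cB[OF h(2)] by (simp add: BijGroup_mult compose_Bij)
  fix j assume "j \<in> J"
  then obtain k where k: "k \<in> K" "j = u k" using u by (auto simp: bij_betw_def)
  then show "conj_bij K J u (h \<otimes>\<^bsub>BijGroup K\<^esub> h') j = (conj_bij K J u h \<otimes>\<^bsub>BijGroup J\<^esub> conj_bij K J u h') j"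
    using h cB[OF h(1)] cB[OF h(2)] u Bij_apply[OF h(2) k(1)] \<open>j \<in> J\<close>
    by (simp add: BijGroup_mult compose_eq conj_bij_apply)
qed

lemma continuous_map_conj_bij:
  assumes u: "bij_betw u K J"
  shows "continuous_map (sym_topology K) (sym_topology J) (conj_bij K J u)"
proof -
  have "continuous_map (product_topology (\<lambda>_. discrete_topology K) K) (discrete_topology J) (\<lambda>h. conj_bij K J u h j)"
    if j: "j \<in> J" for j
  proof -
    define k where "k = inv_into K u j"
    have k: "k \<in> K" using bij_betw_apply[OF bij_betw_inv_into[OF u] j] by (simp add: k_def)
    have "continuous_map (discrete_topology K) (discrete_topology J) u"
      using bij_betw_apply[OF u] by simp
    moreover have "continuous_map (product_topology (\<lambda>_. discrete_topology K) K) (discrete_topology K) (\<lambda>h. h k)"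
      using continuous_map_product_projection[OF k, of "\<lambda>_. discrete_topology K"] .
    ultimately have "continuous_map (product_topology (\<lambda>_. discrete_topology K) K) (discrete_topology J) (u \<circ> (\<lambda>h. h k))"
      by (rule continuous_map_compose[rotated])
    moreover have "u \<circ> (\<lambda>h. h k) = (\<lambda>h. conj_bij K J u h j)" using j by (auto simp: conj_bij_def k_def)
    ultimately show ?thesis by simp
  qed
  moreover have "conj_bij K J u \<in> topspace (product_topology (\<lambda>_. discrete_topology K) K) \<rightarrow> extensional J"
    by (auto simp: conj_bij_def)
  ultimately have "continuous_map (product_topology (\<lambda>_. discrete_topology K) K) (product_topology (\<lambda>_. discrete_topology J) J) (conj_bij K J u)"
    unfolding continuous_map_componentwise by blast
  then have "continuous_map (sym_topology K) (product_topology (\<lambda>_. discrete_topology J) J) (conj_bij K J u)"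
    unfolding sym_topology_def by (rule continuous_map_from_subtopology)
  moreover have "conj_bij K J u \<in> topspace (sym_topology K) \<rightarrow> Bij J" using conj_bij_Bij[OF u] by simp
  ultimately show ?thesis unfolding sym_topology_def[of J] by (simp only: continuous_map_in_subtopology)
qed

text \<open>Conjugation by a bijection of the index sets is an isomorphism of topological groups
  between the full symmetric groups; here it is cut down to subsets that correspond to each
  other.\<close>

lemma perm_group_iso_conj:
  assumes u: "bij_betw u K J" and H: "H \<subseteq> Bij K" and H': "H' \<subseteq> Bij J"
    and 1: "\<forall>h\<in>H. conj_bij K J u h \<in> H'"
    and 2: "\<forall>h\<in>H'. conj_bij J K (inv_into K u) h \<in> H"
  shows "perm_group_iso K H J H'"
proof -
  let ?f = "conj_bij K J u" and ?v = "inv_into K u"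
  let ?g = "conj_bij J K ?v"
  have v: "bij_betw ?v J K" using u by (rule bij_betw_inv_into)
  have gf: "?g (?f h) = h" if "h \<in> H" for h using conj_bij_inverse[OF u] H that by blast
  have fg: "?f (?g h) = h" if h: "h \<in> H'" for h
  proof -
    have hB: "h \<in> Bij J" "?g h \<in> Bij K" using conj_bij_Bij[OF v] H' h by blast+
    show ?thesis
    proof (rule Bij_eqI)
      show "?f (?g h) \<in> Bij J" using u hB(2) by (rule conj_bij_Bij)
      fix j assume j: "j \<in> J"
      then have vj: "?v j \<in> K" "u (?v j) = j"
        using bij_betw_apply[OF v] bij_betw_inv_into_right[OF u] by auto
      have "?f (?g h) (u (?v j)) = u (?g h (?v j))" using u vj(1) by (rule conj_bij_apply)
      also have "?g h (?v j) = ?v (h j)" using v j by (rule conj_bij_apply)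
      also have "u (?v (h j)) = h j" using u Bij_apply[OF hB(1) j] by (rule bij_betw_inv_into_right)
      finally show "?f (?g h) j = h j" using vj(2) by simp
    qed (rule hB(1))
  qed
  have "bij_betw ?f H H'" using 1 2 gf fg by (intro bij_betw_byWitness[of _ ?g]) auto
  then have iso: "?f \<in> iso (BijGroup K\<lparr>carrier := H\<rparr>) (BijGroup J\<lparr>carrier := H'\<rparr>)"
    using 1 H conj_bij_mult[OF u] by (auto simp: iso_def hom_def subset_iff)
  have "homeomorphic_maps (subtopology (sym_topology K) H) (subtopology (sym_topology J) H') ?f ?g"
    unfolding homeomorphic_maps_def
    using 1 2 gf fg continuous_map_conj_bij[OF u] continuous_map_conj_bij[OF v]
    by (auto simp: continuous_map_in_subtopology continuous_map_from_subtopology)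
  then have "homeomorphic_map (subtopology (sym_topology K) H) (subtopology (sym_topology J) H') ?f"
    by (rule homeomorphic_maps_imp_map)
  with iso show ?thesis unfolding perm_group_iso_def by blast
qed

section \<open>Cocycles with values in a symmetric group\<close>

lemma AE_finite_subsets:
  assumes "countable I" "\<And>F. finite F \<Longrightarrow> F \<subseteq> I \<Longrightarrow> AE x in M. P F x"
  shows "AE x in M. \<forall>F. finite F \<longrightarrow> F \<subseteq> I \<longrightarrow> P F x"
proof -
  have "AE x in M. \<forall>F\<in>{F. finite F \<and> F \<subseteq> I}. P F x"
    using assms by (intro AE_ball_countable' countable_Collect_finite_subset) auto
  then show ?thesis by (rule eventually_mono) blast
qed

text \<open>The exact form of the almost everywhere conditions on a cocycle, on an invariant set
  \<open>Y\<close>.\<close>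

definition cocycle_on :: "('a \<times> 'a) set \<Rightarrow> 'i set \<Rightarrow> ('a \<times> 'a \<Rightarrow> 'i \<Rightarrow> 'i) \<Rightarrow> 'a set \<Rightarrow> bool" where
  "cocycle_on R I \<Omega> Y \<longleftrightarrow> (\<forall>x\<in>Y. \<forall>y. (x, y) \<in> R \<longrightarrow> y \<in> Y \<and> \<Omega> (x, y) \<in> Bij I \<and>
     (\<forall>z. (y, z) \<in> R \<longrightarrow> (\<forall>i\<in>I. \<Omega> (x, z) i = \<Omega> (x, y) (\<Omega> (y, z) i))))"

lemma cocycle_onD:
  assumes "cocycle_on R I \<Omega> Y" "x \<in> Y" "(x, y) \<in> R"
  shows "y \<in> Y" "\<Omega> (x, y) \<in> Bij I" "\<And>z i. (y, z) \<in> R \<Longrightarrow> i \<in> I \<Longrightarrow> \<Omega> (x, z) i = \<Omega> (x, y) (\<Omega> (y, z) i)"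
  using assms unfolding cocycle_on_def by blast+

context pmp_relation
begin

lemma cocycle_version:
  assumes "cocycle M R G T \<Omega>"
  obtains \<Omega>' where "\<forall>W\<in>sets (borel_of T). {p \<in> R. \<Omega>' p \<in> W} \<in> sets (M \<Otimes>\<^sub>M M)"
    "\<forall>p\<in>R. \<Omega>' p \<in> topspace T" "AE x in M. \<forall>y. (x, y) \<in> R \<longrightarrow> \<Omega> (x, y) = \<Omega>' (x, y)"
proof -
  obtain \<Omega>' where meas: "\<Omega>' \<in> restrict_space (M \<Otimes>\<^sub>M M) R \<rightarrow>\<^sub>M borel_of T"
    and ae: "AE x in M. \<forall>y. (x, y) \<in> R \<longrightarrow> \<Omega> (x, y) = \<Omega>' (x, y)"
    using assms unfolding cocycle_def by blast
  have sp: "space (restrict_space (M \<Otimes>\<^sub>M M) R) = R"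
    using sets.sets_into_space[OF R_sets] by (auto simp: space_restrict_space)
  show ?thesis
  proof (rule that[OF _ _ ae])
    show "\<forall>W\<in>sets (borel_of T). {p \<in> R. \<Omega>' p \<in> W} \<in> sets (M \<Otimes>\<^sub>M M)"
    proof
      fix W assume "W \<in> sets (borel_of T)"
      then have "\<Omega>' -` W \<inter> R \<in> sets (restrict_space (M \<Otimes>\<^sub>M M) R)"
        using measurable_sets[OF meas] sp by simp
      then have "\<Omega>' -` W \<inter> R \<in> sets (M \<Otimes>\<^sub>M M)"
        using R_sets sets.sets_into_space[OF R_sets] by (subst (asm) sets_restrict_space_iff) (auto simp: Int_absorb2)
      moreover have "\<Omega>' -` W \<inter> R = {p \<in> R. \<Omega>' p \<in> W}" by blast
      ultimately show "{p \<in> R. \<Omega>' p \<in> W} \<in> sets (M \<Otimes>\<^sub>M M)" by simp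
    qed
    show "\<forall>p\<in>R. \<Omega>' p \<in> topspace T" using measurable_space[OF meas] sp by simp
  qed
qed

lemma cocycle_core:
  assumes coc: "cocycle M R (BijGroup I) (sym_topology I) \<Omega>" and P: "AE x in M. P x"
  obtains Y where "Y \<in> sets M" "AE x in M. x \<in> Y" "\<forall>x\<in>Y. P x" "cocycle_on R I \<Omega> Y"
proof -
  obtain \<Omega>' where \<Omega>': "\<forall>p\<in>R. \<Omega>' p \<in> topspace (sym_topology I)" "AE x in M. \<forall>y. (x, y) \<in> R \<longrightarrow> \<Omega> (x, y) = \<Omega>' (x, y)"
    by (rule cocycle_version[OF coc])
  have mult: "AE x in M. \<forall>y z. (x, y) \<in> R \<longrightarrow> (y, z) \<in> R \<longrightarrow> \<Omega> (x, z) = \<Omega> (x, y) \<otimes>\<^bsub>BijGroup I\<^esub> \<Omega> (y, z)"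
    using coc unfolding cocycle_def by blast
  have "AE x in M. P x \<and> (\<forall>y. (x, y) \<in> R \<longrightarrow> \<Omega> (x, y) \<in> Bij I) \<and>
      (\<forall>y z. (x, y) \<in> R \<longrightarrow> (y, z) \<in> R \<longrightarrow> \<Omega> (x, z) = \<Omega> (x, y) \<otimes>\<^bsub>BijGroup I\<^esub> \<Omega> (y, z))"
    using P \<Omega>'(2) mult by eventually_elim (use \<Omega>'(1) in auto)
  then obtain Y where Y: "Y \<in> sets M" "AE x in M. x \<in> Y"
    "\<forall>x\<in>Y. P x \<and> (\<forall>y. (x, y) \<in> R \<longrightarrow> \<Omega> (x, y) \<in> Bij I) \<and>
      (\<forall>y z. (x, y) \<in> R \<longrightarrow> (y, z) \<in> R \<longrightarrow> \<Omega> (x, z) = \<Omega> (x, y) \<otimes>\<^bsub>BijGroup I\<^esub> \<Omega> (y, z))"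
    "\<forall>x\<in>Y. \<forall>y. (x, y) \<in> R \<longrightarrow> y \<in> Y"
    by (rule invariant_core)
  have "cocycle_on R I \<Omega> Y"
    unfolding cocycle_on_def
  proof (intro ballI allI impI conjI)
    fix x y z i assume *: "x \<in> Y" "(x, y) \<in> R" "(y, z) \<in> R" "i \<in> I"
    have "y \<in> Y" using Y(4) * by blast
    then have "\<Omega> (x, y) \<in> Bij I" "\<Omega> (y, z) \<in> Bij I" "\<Omega> (x, z) = \<Omega> (x, y) \<otimes>\<^bsub>BijGroup I\<^esub> \<Omega> (y, z)"
      using Y(3) * by blast+
    then show "\<Omega> (x, z) i = \<Omega> (x, y) (\<Omega> (y, z) i)" using *(4) by (simp add: BijGroup_mult compose_eq)
  qed (use Y in blast)+
  then show ?thesis using Y by (intro that[of Y]) auto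
qed

lemma cocycle_on_refl:
  assumes "cocycle_on R I \<Omega> Y" "x \<in> Y" "x \<in> space M" "i \<in> I"
  shows "\<Omega> (x, x) i = i"
proof -
  note D = cocycle_onD[OF assms(1,2) R_refl[OF assms(3)]]
  have "\<Omega> (x, x) i = \<Omega> (x, x) (\<Omega> (x, x) i)" using R_refl[OF assms(3)] assms(4) by (rule D(3))
  from Bij_inj[OF D(2) _ _ this] show ?thesis using Bij_apply[OF D(2)] assms(4) by simp
qed

text \<open>The subrelation on which \<open>\<Omega>\<close> lies in the stabilizer of
  \<open>F\<close> has only trivial invariant sets, because the stabilizer is an open subgroup; so
  recurrence applies to it.\<close>

lemma cocycle_recurrence:
  assumes erg: "ergodic_rel M R" and coc: "ergodic_cocycle M R (BijGroup I) (sym_topology I) \<Omega>"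
    and F: "finite F" "F \<subseteq> I" and A: "A \<in> sets M" "emeasure M A > 0"
  shows "AE x in M. \<exists>z\<in>A. (x, z) \<in> R \<and> (\<forall>i\<in>F. \<Omega> (x, z) i = i)"
proof -
  have c: "cocycle M R (BijGroup I) (sym_topology I) \<Omega>"
    and inv: "\<And>K B. subgroup K (BijGroup I) \<Longrightarrow> openin (sym_topology I) K \<Longrightarrow>
      invariant_borel_set M {p \<in> R. \<Omega> p \<in> K} B \<Longrightarrow> invariant_borel_set M R B"
    using coc unfolding ergodic_cocycle_def by blast+
  define K where "K = agreeing I (\<lambda>i\<in>I. i) F"
  have K_open: "openin (sym_topology I) K" unfolding K_def using F id_Bij by (intro openin_agreeing)
  have K_grp: "subgroup K (BijGroup I)" unfolding K_def using F(2) by (rule subgroup_pointwise_stabilizer)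
  have K_iff: "g \<in> K \<longleftrightarrow> (\<forall>i\<in>F. g i = i)" if "g \<in> Bij I" for g
    using that F(2) by (auto simp: K_def agreeing_def)
  obtain \<Omega>' where \<Omega>': "\<forall>W\<in>sets (borel_of (sym_topology I)). {p \<in> R. \<Omega>' p \<in> W} \<in> sets (M \<Otimes>\<^sub>M M)"
    "AE x in M. \<forall>y. (x, y) \<in> R \<longrightarrow> \<Omega> (x, y) = \<Omega>' (x, y)"
    by (rule cocycle_version[OF c])
  obtain Y where Y: "Y \<in> sets M" "AE x in M. x \<in> Y" "\<forall>x\<in>Y. \<forall>y. (x, y) \<in> R \<longrightarrow> \<Omega> (x, y) = \<Omega>' (x, y)" "cocycle_on R I \<Omega> Y"
    by (rule cocycle_core[OF c \<Omega>'(2)])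
  define E where "E = {p \<in> R. \<Omega>' p \<in> K}"
  have E_iff: "(x, y) \<in> E \<longleftrightarrow> (x, y) \<in> R \<and> (\<forall>i\<in>F. \<Omega> (x, y) i = i)" if "x \<in> Y" for x y
    using Y(3) cocycle_onD(2)[OF Y(4) that] K_iff that by (auto simp: E_def)
  have refl: "\<Omega> (x, x) i = i" if "x \<in> Y" "i \<in> F" for x i
    using cocycle_on_refl[OF Y(4) that(1)] sets.sets_into_space[OF Y(1)] that F(2) by blast
  have "AE x in M. \<exists>z\<in>A. (x, z) \<in> E"
  proof (rule ergodic_recurrence[OF _ _ _ _ _ A])
    show "E \<in> sets (M \<Otimes>\<^sub>M M)" unfolding E_def using \<Omega>'(1) K_open by (simp add: sets_borel_of)
    show "E \<subseteq> R" by (auto simp: E_def)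
    show "AE x in M. (x, x) \<in> E" using Y(2) AE_space by eventually_elim (simp add: E_iff refl R_refl)
    show "AE x in M. \<forall>y. (x, y) \<in> E \<longrightarrow> (\<forall>z. (x, z) \<in> E \<longleftrightarrow> (y, z) \<in> E)"
      using Y(2)
    proof eventually_elim
      case (elim x)
      show ?case
      proof (intro allI impI)
        fix y z assume "(x, y) \<in> E"
        then have xy: "(x, y) \<in> R" "\<forall>i\<in>F. \<Omega> (x, y) i = i" using E_iff[OF elim] by auto
        note D = cocycle_onD[OF Y(4) elim xy(1)]
        have yY: "y \<in> Y" by (rule D(1))
        have "(x, z) \<in> R \<longleftrightarrow> (y, z) \<in> R" using xy(1) R_sym R_trans by blast
        moreover have "\<Omega> (x, z) i = i \<longleftrightarrow> \<Omega> (y, z) i = i" if i: "i \<in> F" and yz: "(y, z) \<in> R" for i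
        proof -
          have iI: "i \<in> I" using i F(2) by blast
          have "\<Omega> (x, z) i = \<Omega> (x, y) (\<Omega> (y, z) i)" by (rule D(3)[OF yz iI])
          moreover have "\<Omega> (y, z) i \<in> I" using cocycle_onD(2)[OF Y(4) yY yz] iI by (rule Bij_apply)
          ultimately show ?thesis using xy(2) i Bij_inj[OF D(2) _ iI] by metis
        qed
        ultimately show "(x, z) \<in> E \<longleftrightarrow> (y, z) \<in> E" unfolding E_iff[OF elim] E_iff[OF yY] by blast
      qed
    qed
    show "emeasure M B = 0 \<or> emeasure M B = 1" if B: "invariant_borel_set M E B" for B
    proof -
      have "invariant_borel_set M {p \<in> R. \<Omega> p \<in> K} B"
        unfolding invariant_borel_set_def
      proof
        show "B \<in> sets M" using B by (simp add: invariant_borel_set_def)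
        have "AE x in M. \<forall>y. (x, y) \<in> E \<longrightarrow> (x \<in> B \<longleftrightarrow> y \<in> B)" using B by (simp add: invariant_borel_set_def)
        then show "AE x in M. \<forall>y. (x, y) \<in> {p \<in> R. \<Omega> p \<in> K} \<longrightarrow> (x \<in> B \<longleftrightarrow> y \<in> B)"
          using Y(2) by eventually_elim (use Y(3) in \<open>auto simp: E_def\<close>)
      qed
      then have "invariant_borel_set M R B" by (rule inv[OF K_grp K_open])
      then show ?thesis using erg unfolding ergodic_rel_def by blast
    qed
  qed
  then show ?thesis using Y(2)
  proof eventually_elim
    case (elim x)
    then show ?case using E_iff[of x] by blast
  qed
qed

text \<open>If the fibres were non-empty on a set that is not null, then the projection would
  contain a Borel set \<open>D\<close> of positive measure, and the counting function is at least 1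
  on \<open>D\<close>.\<close>

lemma rel_nu_null_iff:
  assumes coc: "cocycle M R G T \<Omega>" and W: "W \<in> sets (borel_of T)"
  shows "rel_nu M {p \<in> R. \<Omega> p \<in> W} = 0 \<longleftrightarrow> (AE x in M. \<forall>y. (x, y) \<in> R \<longrightarrow> \<Omega> (x, y) \<notin> W)"
proof
  assume "AE x in M. \<forall>y. (x, y) \<in> R \<longrightarrow> \<Omega> (x, y) \<notin> W"
  then have "AE x in M. emeasure (count_space UNIV) ({p \<in> R. \<Omega> p \<in> W} `` {x}) = 0"
  proof eventually_elim
    case (elim x)
    then have "{p \<in> R. \<Omega> p \<in> W} `` {x} = {}" by blast
    then show ?case by simp
  qed
  then have "rel_nu M {p \<in> R. \<Omega> p \<in> W} = (\<integral>\<^sup>+x. 0 \<partial>M)" unfolding rel_nu_def by (rule nn_integral_cong_AE)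
  then show "rel_nu M {p \<in> R. \<Omega> p \<in> W} = 0" by simp
next
  assume zero: "rel_nu M {p \<in> R. \<Omega> p \<in> W} = 0"
  obtain \<Omega>' where \<Omega>': "\<forall>W\<in>sets (borel_of T). {p \<in> R. \<Omega>' p \<in> W} \<in> sets (M \<Otimes>\<^sub>M M)"
    "AE x in M. \<forall>y. (x, y) \<in> R \<longrightarrow> \<Omega> (x, y) = \<Omega>' (x, y)"
    by (rule cocycle_version[OF coc])
  have V: "{p \<in> R. \<Omega>' p \<in> W} \<in> sets (M \<Otimes>\<^sub>M M)" using \<Omega>'(1) W by blast
  obtain D where D: "D \<in> sets M" "\<forall>x\<in>D. \<exists>y. (x, y) \<in> {p \<in> R. \<Omega>' p \<in> W}"
    "AE x in M. (\<exists>y. (x, y) \<in> {p \<in> R. \<Omega>' p \<in> W}) \<longrightarrow> x \<in> D"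
    by (rule projection_measurable[OF std finite_measure_axioms V])
  have "emeasure M D = (\<integral>\<^sup>+x. indicator D x \<partial>M)" using D(1) by simp
  also have "\<dots> \<le> rel_nu M {p \<in> R. \<Omega> p \<in> W}"
    unfolding rel_nu_def
  proof (rule nn_integral_mono_AE)
    show "AE x in M. indicator D x \<le> emeasure (count_space UNIV) ({p \<in> R. \<Omega> p \<in> W} `` {x})"
      using \<Omega>'(2)
    proof eventually_elim
      case (elim x)
      show ?case
      proof (cases "x \<in> D")
        case True
        then obtain y where "(x, y) \<in> R" "\<Omega>' (x, y) \<in> W" using D(2) by blast
        then have "{y} \<subseteq> {p \<in> R. \<Omega> p \<in> W} `` {x}" using elim by auto
        then have "emeasure (count_space UNIV) {y} \<le> emeasure (count_space UNIV) ({p \<in> R. \<Omega> p \<in> W} `` {x})"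
          by (rule emeasure_mono) simp
        then show ?thesis using True by simp
      qed simp
    qed
  qed
  finally have "D \<in> null_sets M" using zero D(1) by auto
  then have "AE x in M. x \<notin> D" by (rule AE_not_in)
  then show "AE x in M. \<forall>y. (x, y) \<in> R \<longrightarrow> \<Omega> (x, y) \<notin> W"
    using D(3) \<Omega>'(2) by eventually_elim auto
qed

text \<open>The complement of the essential image is the union of all basic open sets that
  \<open>\<Omega>\<close> avoids almost everywhere. Since the index set is countable there are
  countably many basic open sets, so \<open>\<Omega>\<close> avoids this union as well.\<close>

theorem essential_image_properties:
  assumes coc: "cocycle M R (BijGroup I) (sym_topology I) \<Omega>" and I: "countable I"
  defines "H \<equiv> essential_image M R (sym_topology I) \<Omega>"
  shows essential_image_closed: "closedin (sym_topology I) H"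
    and essential_image_AE: "AE x in M. \<forall>y. (x, y) \<in> R \<longrightarrow> \<Omega> (x, y) \<in> H"
    and essential_image_least: "\<And>C. closedin (sym_topology I) C \<Longrightarrow>
      (AE x in M. \<forall>y. (x, y) \<in> R \<longrightarrow> \<Omega> (x, y) \<in> C) \<Longrightarrow> H \<subseteq> C"
proof -
  have Bij: "AE x in M. \<forall>y. (x, y) \<in> R \<longrightarrow> \<Omega> (x, y) \<in> Bij I"
  proof -
    obtain \<Omega>' where \<Omega>': "\<forall>p\<in>R. \<Omega>' p \<in> topspace (sym_topology I)" "AE x in M. \<forall>y. (x, y) \<in> R \<longrightarrow> \<Omega> (x, y) = \<Omega>' (x, y)"
      by (rule cocycle_version[OF coc])
    show ?thesis using \<Omega>'(2) by eventually_elim (use \<Omega>'(1) in auto)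
  qed
  have iff: "rel_nu M {p \<in> R. \<Omega> p \<in> topspace (sym_topology I) - C} = 0 \<longleftrightarrow>
      (AE x in M. \<forall>y. (x, y) \<in> R \<longrightarrow> \<Omega> (x, y) \<in> C)" if "closedin (sym_topology I) C" for C
  proof -
    have "openin (sym_topology I) (topspace (sym_topology I) - C)" using that by (simp add: closedin_def)
    then have "topspace (sym_topology I) - C \<in> sets (borel_of (sym_topology I))" by (simp add: sets_borel_of)
    from rel_nu_null_iff[OF coc this]
    have "rel_nu M {p \<in> R. \<Omega> p \<in> topspace (sym_topology I) - C} = 0 \<longleftrightarrow>
      (AE x in M. \<forall>y. (x, y) \<in> R \<longrightarrow> \<Omega> (x, y) \<notin> topspace (sym_topology I) - C)" .
    also have "\<dots> \<longleftrightarrow> (AE x in M. \<forall>y. (x, y) \<in> R \<longrightarrow> \<Omega> (x, y) \<in> C)"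
      using Bij by (intro eventually_subst) (auto elim!: eventually_mono)
    finally show ?thesis .
  qed
  define null where "null W \<longleftrightarrow> (AE x in M. \<forall>y. (x, y) \<in> R \<longrightarrow> \<Omega> (x, y) \<notin> W)" for W
  define H0 where "H0 = {h \<in> Bij I. \<forall>F. finite F \<longrightarrow> F \<subseteq> I \<longrightarrow> \<not> null (agreeing I h F)}"
  have closed: "closedin (sym_topology I) H0"
    unfolding closedin_sym_topology_iff
  proof (intro conjI ballI impI)
    fix h assume h: "h \<in> Bij I" and lim: "\<forall>F. finite F \<longrightarrow> F \<subseteq> I \<longrightarrow> H0 \<inter> agreeing I h F \<noteq> {}"
    have "\<not> null (agreeing I h F)" if F: "finite F" "F \<subseteq> I" for F
    proof -
      obtain g where g: "g \<in> H0" "g \<in> agreeing I h F" using lim F by blast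
      then have "agreeing I g F = agreeing I h F" by (auto simp: agreeing_def)
      then show ?thesis using g(1) F by (auto simp: H0_def)
    qed
    then show "h \<in> H0" using h by (simp add: H0_def)
  qed (auto simp: H0_def)
  have ae: "AE x in M. \<forall>y. (x, y) \<in> R \<longrightarrow> \<Omega> (x, y) \<in> H0"
  proof -
    define basic where "basic l = {h \<in> Bij I. \<forall>(i, j)\<in>set l. h i = j}" for l
    have "AE x in M. \<forall>l\<in>lists (I \<times> I). null (basic l) \<longrightarrow> (\<forall>y. (x, y) \<in> R \<longrightarrow> \<Omega> (x, y) \<notin> basic l)"
    proof (rule AE_ball_countable')
      show "AE x in M. null (basic l) \<longrightarrow> (\<forall>y. (x, y) \<in> R \<longrightarrow> \<Omega> (x, y) \<notin> basic l)" for l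
        by (cases "null (basic l)") (auto simp: null_def)
    qed (use I in auto)
    then show ?thesis using Bij
    proof eventually_elim
      case (elim x)
      show ?case
      proof (intro allI impI)
        fix y assume xy: "(x, y) \<in> R"
        define h where "h = \<Omega> (x, y)"
        have h: "h \<in> Bij I" using elim(2) xy by (simp add: h_def)
        have "\<not> null (agreeing I h F)" if F: "finite F" "F \<subseteq> I" for F
        proof -
          obtain fs where fs: "set fs = F" using finite_list[OF F(1)] by blast
          define l where "l = map (\<lambda>i. (i, h i)) fs"
          have l: "l \<in> lists (I \<times> I)" using fs F(2) Bij_apply[OF h] by (auto simp: l_def subset_iff)
          have Ol: "basic l = agreeing I h F" using fs by (auto simp: basic_def l_def agreeing_def)
          have "h \<in> basic l" unfolding Ol using h by (simp add: agreeing_def)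
          then have "\<Omega> (x, y) \<in> basic l" by (simp add: h_def)
          then have "\<not> null (basic l)" using elim(1) l xy by blast
          then show ?thesis by (simp add: Ol)
        qed
        then show "\<Omega> (x, y) \<in> H0" using h by (simp add: H0_def h_def)
      qed
    qed
  qed
  have least: "H0 \<subseteq> C" if C: "closedin (sym_topology I) C" "AE x in M. \<forall>y. (x, y) \<in> R \<longrightarrow> \<Omega> (x, y) \<in> C" for C
  proof
    fix h assume h: "h \<in> H0"
    have "C \<inter> agreeing I h F \<noteq> {}" if F: "finite F" "F \<subseteq> I" for F
    proof
      assume empty: "C \<inter> agreeing I h F = {}"
      have "null (agreeing I h F)" unfolding null_def
        using C(2) by eventually_elim (use empty in blast)
      then show False using h F by (simp add: H0_def)
    qed
    then show "h \<in> C" using C(1) h unfolding closedin_sym_topology_iff H0_def by blast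
  qed
  have H: "H = H0"
    unfolding H_def essential_image_def
  proof (rule Least_equality)
    show "closedin (sym_topology I) H0 \<and> rel_nu M {p \<in> R. \<Omega> p \<in> topspace (sym_topology I) - H0} = 0"
      using closed ae iff by blast
    show "H0 \<subseteq> C" if "closedin (sym_topology I) C \<and> rel_nu M {p \<in> R. \<Omega> p \<in> topspace (sym_topology I) - C} = 0" for C
      using that iff least by blast
  qed
  show "closedin (sym_topology I) H" using closed H by simp
  show "AE x in M. \<forall>y. (x, y) \<in> R \<longrightarrow> \<Omega> (x, y) \<in> H" using ae H by simp
  show "H \<subseteq> C" if "closedin (sym_topology I) C" "AE x in M. \<forall>y. (x, y) \<in> R \<longrightarrow> \<Omega> (x, y) \<in> C" for C
    using least[OF that] H by simp
qed

end

section \<open>Cohomologous ergodic cocycles\<close>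

context pmp_relation
begin

text \<open>Fix a generic point \<open>x0\<close> and a finite set of indices. The set \<open>B
  F\<close> of the points where \<open>u\<close> agrees with \<open>u x0\<close> on \<open>F\<close>
  is not null. Given \<open>(x, y)\<close> in \<open>R\<close>, recurrence moves \<open>y\<close> to
  \<open>z\<close> and \<open>x\<close> to \<open>z'\<close> in sets of this form without changing
  the relevant values of \<open>\<Omega>\<^sub>2\<close>. At \<open>(z', z)\<close> the intertwining
  bijections may be replaced by \<open>u x0\<close>, so \<open>\<Omega>\<^sub>1 (z', z)\<close>
  agrees on the finite set with the conjugate of \<open>\<Omega>\<^sub>2 (x, y)\<close> by \<open>u
  x0\<close>. As the essential image of \<open>\<Omega>\<^sub>1\<close> is closed, it contains this
  conjugate.\<close>

lemma intertwined_essential_image: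
  fixes \<Omega>\<^sub>1 :: "'a \<times> 'a \<Rightarrow> 'j \<Rightarrow> 'j" and \<Omega>\<^sub>2 :: "'a \<times> 'a \<Rightarrow> 'k \<Rightarrow> 'k"
  assumes erg: "ergodic_rel M R" and J: "countable J" and K: "countable K"
    and c1: "cocycle M R (BijGroup J) (sym_topology J) \<Omega>\<^sub>1"
    and c2: "ergodic_cocycle M R (BijGroup K) (sym_topology K) \<Omega>\<^sub>2"
    and Y: "Y \<in> sets M" "AE x in M. x \<in> Y" and u: "\<forall>x\<in>Y. bij_betw (u x) K J"
    and meas: "\<forall>k\<in>K. \<forall>j\<in>J. {x \<in> Y. u x k = j} \<in> sets M"
    and inter: "\<forall>x\<in>Y. \<forall>y. (x, y) \<in> R \<longrightarrow> (\<forall>k\<in>K. u x (\<Omega>\<^sub>2 (x, y) k) = \<Omega>\<^sub>1 (x, y) (u y k))"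
  shows "AE x in M. \<forall>h\<in>essential_image M R (sym_topology K) \<Omega>\<^sub>2.
    conj_bij K J (u x) h \<in> essential_image M R (sym_topology J) \<Omega>\<^sub>1"
proof -
  let ?H1 = "essential_image M R (sym_topology J) \<Omega>\<^sub>1" and ?H2 = "essential_image M R (sym_topology K) \<Omega>\<^sub>2"
  have c2': "cocycle M R (BijGroup K) (sym_topology K) \<Omega>\<^sub>2" using c2 by (simp add: ergodic_cocycle_def)
  note H1 = essential_image_properties[OF c1 J] and H2 = essential_image_properties[OF c2' K]
  define A where "A l = {x \<in> Y. \<forall>(k, j)\<in>set l. u x k = j}" for l
  have A_sets: "A l \<in> sets M" if "l \<in> lists (K \<times> J)" for l
    using that
  proof (induction l)
    case Nil
    then show ?case using Y(1) by (simp add: A_def)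
  next
    case (Cons p l)
    have "A (p # l) = {x \<in> Y. u x (fst p) = snd p} \<inter> A l" by (auto simp: A_def)
    moreover have "{x \<in> Y. u x (fst p) = snd p} \<in> sets M" using meas Cons.hyps by auto
    ultimately show ?case using Cons.IH by simp
  qed
  have "AE x in M. \<forall>l\<in>lists (K \<times> J). x \<in> A l \<longrightarrow> emeasure M (A l) > 0"
  proof (rule AE_ball_countable')
    \<comment> \<open>There are countably many sets \<open>A l\<close>; a generic point lies in
      none that is null.\<close>
    fix l assume l: "l \<in> lists (K \<times> J)"
    show "AE x in M. x \<in> A l \<longrightarrow> emeasure M (A l) > 0"
    proof (cases "emeasure M (A l) = 0")
      case True
      then have "A l \<in> null_sets M" using A_sets[OF l] by auto
      from AE_not_in[OF this] show ?thesis by (rule eventually_mono) blast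
    next
      case False
      then show ?thesis by (simp add: zero_less_iff_neq_zero)
    qed
  qed (use J K in auto)
  then show ?thesis using Y(2)
  proof eventually_elim
    case (elim x0)
    let ?c = "conj_bij K J (u x0)"
    have u0: "bij_betw (u x0) K J" using u elim(2) by blast
    define B where "B F = {x \<in> Y. \<forall>k\<in>F. u x k = u x0 k}" for F
    have B: "B F \<in> sets M \<and> emeasure M (B F) > 0" if F: "finite F" "F \<subseteq> K" for F
    proof -
      obtain fs where fs: "set fs = F" using finite_list[OF F(1)] by blast
      define l where "l = map (\<lambda>k. (k, u x0 k)) fs"
      have l: "l \<in> lists (K \<times> J)" using fs F(2) bij_betw_apply[OF u0] by (auto simp: l_def subset_iff)
      have "A l = B F" using fs by (auto simp: A_def B_def l_def)
      moreover have "x0 \<in> A l" using elim(2) by (auto simp: A_def l_def)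
      ultimately show ?thesis using elim(1) l A_sets[OF l] by auto
    qed
    have rec: "AE x in M. \<forall>F. finite F \<longrightarrow> F \<subseteq> K \<longrightarrow> (\<exists>z\<in>B F. (x, z) \<in> R \<and> (\<forall>k\<in>F. \<Omega>\<^sub>2 (x, z) k = k))"
      using B by (intro AE_finite_subsets[OF K] cocycle_recurrence[OF erg c2]) auto
    have "AE x in M. (\<forall>F. finite F \<longrightarrow> F \<subseteq> K \<longrightarrow> (\<exists>z\<in>B F. (x, z) \<in> R \<and> (\<forall>k\<in>F. \<Omega>\<^sub>2 (x, z) k = k))) \<and>
        x \<in> Y \<and> (\<forall>y. (x, y) \<in> R \<longrightarrow> \<Omega>\<^sub>1 (x, y) \<in> ?H1)"
      using rec Y(2) H1(2) by eventually_elim blast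
    then obtain Z where Z: "Z \<in> sets M" "AE x in M. x \<in> Z"
      "\<forall>x\<in>Z. (\<forall>F. finite F \<longrightarrow> F \<subseteq> K \<longrightarrow> (\<exists>z\<in>B F. (x, z) \<in> R \<and> (\<forall>k\<in>F. \<Omega>\<^sub>2 (x, z) k = k))) \<and>
        x \<in> Y \<and> (\<forall>y. (x, y) \<in> R \<longrightarrow> \<Omega>\<^sub>1 (x, y) \<in> ?H1)" "cocycle_on R K \<Omega>\<^sub>2 Z"
      by (rule cocycle_core[OF c2'])
    define C where "C = {h \<in> Bij K. ?c h \<in> ?H1}"
    have "closedin (sym_topology K) {h \<in> topspace (sym_topology K). ?c h \<in> ?H1}"
      by (rule closedin_continuous_map_preimage[OF continuous_map_conj_bij[OF u0] H1(1)])
    then have C_closed: "closedin (sym_topology K) C" by (simp add: C_def)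
    have C_AE: "AE x in M. \<forall>y. (x, y) \<in> R \<longrightarrow> \<Omega>\<^sub>2 (x, y) \<in> C"
      using Z(2)
    proof eventually_elim
      case (elim x)
      show ?case
      proof (intro allI impI)
        fix y assume xy: "(x, y) \<in> R"
        note D = cocycle_onD[OF Z(4) elim xy]
        have Bx: "\<Omega>\<^sub>2 (x, y) \<in> Bij K" by (rule D(2))
        have "?H1 \<inter> agreeing J (?c (\<Omega>\<^sub>2 (x, y))) F \<noteq> {}" if F: "finite F" "F \<subseteq> J" for F
        proof -
          define F' where "F' = inv_into K (u x0) ` F"
          have F': "finite F'" "F' \<subseteq> K"
            using F bij_betw_apply[OF bij_betw_inv_into[OF u0]] by (auto simp: F'_def)
          define F'' where "F'' = \<Omega>\<^sub>2 (x, y) ` F'"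
          have F'': "finite F''" "F'' \<subseteq> K" using F' Bij_apply[OF Bx] by (auto simp: F''_def)
          obtain z where z: "z \<in> B F'" "(y, z) \<in> R" "\<forall>k\<in>F'. \<Omega>\<^sub>2 (y, z) k = k"
            using Z(3) D(1) F' by blast
          obtain z' where z': "z' \<in> B F''" "(x, z') \<in> R" "\<forall>k\<in>F''. \<Omega>\<^sub>2 (x, z') k = k"
            using Z(3) elim F'' by blast
          have z'Z: "z' \<in> Z" by (rule cocycle_onD(1)[OF Z(4) elim z'(2)])
          have xz: "(x, z) \<in> R" using xy z(2) by (rule R_trans)
          have z'z: "(z', z) \<in> R" using R_trans[OF R_sym[OF z'(2)] xz] .
          have key: "\<Omega>\<^sub>1 (z', z) j = ?c (\<Omega>\<^sub>2 (x, y)) j" if j: "j \<in> F" for j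
          proof -
            define k where "k = inv_into K (u x0) j"
            have k: "k \<in> F'" "k \<in> K" using j F' by (auto simp: k_def F'_def)
            have uk: "u x0 k = j" using bij_betw_inv_into_right[OF u0] j F(2) by (auto simp: k_def)
            define k' where "k' = \<Omega>\<^sub>2 (x, y) k"
            have k': "k' \<in> F''" "k' \<in> K" using k F'' by (auto simp: k'_def F''_def)
            have "\<Omega>\<^sub>2 (x, z) k = k'" using D(3)[OF z(2) k(2)] z(3) k(1) by (simp add: k'_def)
            moreover have "\<Omega>\<^sub>2 (x, z) k = \<Omega>\<^sub>2 (x, z') (\<Omega>\<^sub>2 (z', z) k)"
              using cocycle_onD(3)[OF Z(4) elim z'(2) z'z k(2)] .
            moreover have "\<Omega>\<^sub>2 (x, z') k' = k'" using z'(3) k'(1) by blast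
            moreover have "\<Omega>\<^sub>2 (z', z) k \<in> K" using cocycle_onD(2)[OF Z(4) z'Z z'z] k(2) by (rule Bij_apply)
            ultimately have "\<Omega>\<^sub>2 (z', z) k = k'"
              using Bij_inj[OF cocycle_onD(2)[OF Z(4) elim z'(2)] _ k'(2)] by simp
            moreover have "z' \<in> Y" using Z(3) z'Z by blast
            ultimately have "u z' k' = \<Omega>\<^sub>1 (z', z) (u z k)" using inter z'z k(2) by metis
            moreover have "u z k = j" using z(1) k(1) uk by (simp add: B_def)
            moreover have "u z' k' = u x0 k'" using z'(1) k'(1) by (simp add: B_def)
            moreover have "?c (\<Omega>\<^sub>2 (x, y)) j = u x0 k'" using conj_bij_apply[OF u0 k(2), of "\<Omega>\<^sub>2 (x, y)"] uk by (simp add: k'_def)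
            ultimately show ?thesis by simp
          qed
          have "\<Omega>\<^sub>1 (z', z) \<in> ?H1" using Z(3) z'Z z'z by blast
          moreover from this have "\<Omega>\<^sub>1 (z', z) \<in> Bij J" using closedin_subset[OF H1(1)] by auto
          ultimately show ?thesis using key by (auto simp: agreeing_def)
        qed
        moreover have "?c (\<Omega>\<^sub>2 (x, y)) \<in> Bij J" using u0 Bx by (rule conj_bij_Bij)
        ultimately have "?c (\<Omega>\<^sub>2 (x, y)) \<in> ?H1" using H1(1) unfolding closedin_sym_topology_iff by blast
        then show "\<Omega>\<^sub>2 (x, y) \<in> C" using Bx by (simp add: C_def)
      qed
    qed
    have "?H2 \<subseteq> C" by (rule H2(3)[OF C_closed C_AE])
    then show ?case by (auto simp: C_def)
  qed
qed

text \<open>The inverse bijections intertwine the cocycles in the opposite order. The two inclusions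
  at a common generic point show that conjugation maps one essential image onto the other.\<close>

theorem intertwined_essential_image_iso:
  fixes \<Omega>\<^sub>1 :: "'a \<times> 'a \<Rightarrow> 'j \<Rightarrow> 'j" and \<Omega>\<^sub>2 :: "'a \<times> 'a \<Rightarrow> 'k \<Rightarrow> 'k"
  assumes erg: "ergodic_rel M R" and J: "countable J" and K: "countable K"
    and c1: "ergodic_cocycle M R (BijGroup J) (sym_topology J) \<Omega>\<^sub>1"
    and c2: "ergodic_cocycle M R (BijGroup K) (sym_topology K) \<Omega>\<^sub>2"
    and Y: "Y \<in> sets M" "AE x in M. x \<in> Y" "\<forall>x\<in>Y. \<forall>y. (x, y) \<in> R \<longrightarrow> y \<in> Y"
    and u: "\<forall>x\<in>Y. bij_betw (u x) K J"
    and meas: "\<forall>k\<in>K. \<forall>j\<in>J. {x \<in> Y. u x k = j} \<in> sets M"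
    and inter: "\<forall>x\<in>Y. \<forall>y. (x, y) \<in> R \<longrightarrow> (\<forall>k\<in>K. u x (\<Omega>\<^sub>2 (x, y) k) = \<Omega>\<^sub>1 (x, y) (u y k))"
  shows "perm_group_iso K (essential_image M R (sym_topology K) \<Omega>\<^sub>2) J (essential_image M R (sym_topology J) \<Omega>\<^sub>1)"
proof -
  let ?H1 = "essential_image M R (sym_topology J) \<Omega>\<^sub>1" and ?H2 = "essential_image M R (sym_topology K) \<Omega>\<^sub>2"
  have c1': "cocycle M R (BijGroup J) (sym_topology J) \<Omega>\<^sub>1" and c2': "cocycle M R (BijGroup K) (sym_topology K) \<Omega>\<^sub>2"
    using c1 c2 by (simp_all add: ergodic_cocycle_def)
  obtain Z where Z: "Z \<in> sets M" "AE x in M. x \<in> Z" "\<forall>x\<in>Z. x \<in> Y" "cocycle_on R K \<Omega>\<^sub>2 Z"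
    by (rule cocycle_core[OF c2' Y(2)])
  define v where "v x = inv_into K (u x)" for x
  have v: "\<forall>x\<in>Z. bij_betw (v x) J K" using u Z(3) unfolding v_def by (auto intro: bij_betw_inv_into)
  have uv: "v x j = k \<longleftrightarrow> u x k = j" if "x \<in> Z" "k \<in> K" "j \<in> J" for x k j
    using u Z(3) that unfolding v_def by (metis bij_betw_inv_into_left bij_betw_inv_into_right)
  have meas': "\<forall>j\<in>J. \<forall>k\<in>K. {x \<in> Z. v x j = k} \<in> sets M"
  proof (intro ballI)
    fix j k assume jk: "j \<in> J" "k \<in> K"
    have "{x \<in> Z. v x j = k} = Z \<inter> {x \<in> Y. u x k = j}" using uv[OF _ jk(2,1)] Z(3) by auto
    moreover have "{x \<in> Y. u x k = j} \<in> sets M" using meas jk by blast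
    ultimately show "{x \<in> Z. v x j = k} \<in> sets M" using sets.Int[OF Z(1)] by simp
  qed
  have inter': "\<forall>x\<in>Z. \<forall>y. (x, y) \<in> R \<longrightarrow> (\<forall>j\<in>J. v x (\<Omega>\<^sub>1 (x, y) j) = \<Omega>\<^sub>2 (x, y) (v y j))"
  proof (intro ballI allI impI)
    fix x y j assume x: "x \<in> Z" and xy: "(x, y) \<in> R" and j: "j \<in> J"
    have yZ: "y \<in> Z" by (rule cocycle_onD(1)[OF Z(4) x xy])
    have vj: "v y j \<in> K" using bij_betw_apply[OF bspec[OF v yZ] j] .
    have "u y (v y j) = j" using uv[OF yZ vj j] by simp
    then have "u x (\<Omega>\<^sub>2 (x, y) (v y j)) = \<Omega>\<^sub>1 (x, y) j" using inter Z(3) x xy vj by metis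
    moreover have k: "\<Omega>\<^sub>2 (x, y) (v y j) \<in> K" using cocycle_onD(2)[OF Z(4) x xy] vj by (rule Bij_apply)
    moreover have "u x (\<Omega>\<^sub>2 (x, y) (v y j)) \<in> J" using u Z(3) x k bij_betw_apply by metis
    ultimately show "v x (\<Omega>\<^sub>1 (x, y) j) = \<Omega>\<^sub>2 (x, y) (v y j)" using uv[OF x k] by simp
  qed
  have "AE x in M. \<forall>h\<in>?H2. conj_bij K J (u x) h \<in> ?H1"
    by (rule intertwined_essential_image[OF erg J K c1' c2 Y(1,2) u meas inter])
  moreover have "AE x in M. \<forall>h\<in>?H1. conj_bij J K (v x) h \<in> ?H2"
    by (rule intertwined_essential_image[OF erg K J c2' c1 Z(1,2) v meas' inter'])
  ultimately have "AE x in M. x \<in> Y \<and> (\<forall>h\<in>?H2. conj_bij K J (u x) h \<in> ?H1) \<and> (\<forall>h\<in>?H1. conj_bij J K (v x) h \<in> ?H2)"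
    using Y(2) by eventually_elim blast
  from eventually_happens'[OF ae_filter_bot this]
  obtain x where x: "x \<in> Y" "\<forall>h\<in>?H2. conj_bij K J (u x) h \<in> ?H1" "\<forall>h\<in>?H1. conj_bij J K (v x) h \<in> ?H2"
    by blast
  show ?thesis
  proof (rule perm_group_iso_conj)
    show "bij_betw (u x) K J" using u x(1) by blast
    show "?H2 \<subseteq> Bij K" using closedin_subset[OF essential_image_closed[OF c2' K]] by simp
    show "?H1 \<subseteq> Bij J" using closedin_subset[OF essential_image_closed[OF c1' J]] by simp
    show "\<forall>h\<in>?H2. conj_bij K J (u x) h \<in> ?H1" by (rule x(2))
    show "\<forall>h\<in>?H1. conj_bij J K (inv_into K (u x)) h \<in> ?H2" using x(3) by (simp add: v_def)
  qed
qed

end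

section \<open>Uniqueness of the group of an inclusion\<close>

lemma ergodic_pmp_inclusionD:
  assumes "ergodic_pmp_inclusion M S R"
  shows "pmp_relation M S" "pmp_relation M R" "ergodic_rel M S" "ergodic_rel M R" "AE x in M. S `` {x} \<subseteq> R `` {x}"
  using assms by (auto simp: ergodic_pmp_inclusion_def standard_prob_space_def rel_subset_ae_def
      pmp_relation_def pmp_relation_axioms_def)

lemma choice_functionsD:
  assumes "choice_functions M S R I c"
  shows "countable I" "\<And>i. i \<in> I \<Longrightarrow> c i \<in> full_group M R" "\<exists>i\<in>I. \<forall>x\<in>space M. c i x = x"
    "AE x in M. R `` {x} = (\<Union>i\<in>I. S `` {c i x}) \<and> disjoint_family_on (\<lambda>i. S `` {c i x}) I"
  using assms unfolding choice_functions_def by auto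

lemma full_groupD:
  assumes "f \<in> full_group M R"
  shows "f \<in> M \<rightarrow>\<^sub>M M" "\<And>x. x \<in> space M \<Longrightarrow> (x, f x) \<in> R" "bij_betw f (space M) (space M)"
  using assms by (auto simp: full_group_def borel_automorphism_def)

text \<open>Both families of choice functions enumerate the \<open>S\<close>-classes inside the
  \<open>R\<close>-class of \<open>x\<close>. Hence they differ by a bijection \<open>u x\<close> of
  the index sets, and these bijections intertwine the index cocycles.\<close>

theorem ergodic_index_cocycle_image_unique:
  fixes \<Omega>\<^sub>1 :: "'a \<times> 'a \<Rightarrow> 'j \<Rightarrow> 'j" and \<Omega>\<^sub>2 :: "'a \<times> 'a \<Rightarrow> 'k \<Rightarrow> 'k"
  assumes inc: "ergodic_pmp_inclusion M S R"
    and o1: "ergodic_index_cocycle M S R J \<Omega>\<^sub>1" and o2: "ergodic_index_cocycle M S R K \<Omega>\<^sub>2"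
  shows "perm_group_iso K (essential_image M R (sym_topology K) \<Omega>\<^sub>2) J (essential_image M R (sym_topology J) \<Omega>\<^sub>1)"
proof -
  interpret R: pmp_relation M R by (rule ergodic_pmp_inclusionD(2)[OF inc])
  interpret S: pmp_relation M S by (rule ergodic_pmp_inclusionD(1)[OF inc])
  have e1: "ergodic_cocycle M R (BijGroup J) (sym_topology J) \<Omega>\<^sub>1"
    and e2: "ergodic_cocycle M R (BijGroup K) (sym_topology K) \<Omega>\<^sub>2"
    using o1 o2 by (simp_all add: ergodic_index_cocycle_def)
  have coc2: "cocycle M R (BijGroup K) (sym_topology K) \<Omega>\<^sub>2" using e2 by (simp add: ergodic_cocycle_def)
  obtain c where c: "choice_functions M S R J c"
    "AE x in M. \<forall>y. (x, y) \<in> R \<longrightarrow> (\<forall>i\<in>J. \<forall>j\<in>J. \<Omega>\<^sub>1 (x, y) i = j \<longleftrightarrow> S `` {c j x} = S `` {c i y})"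
    using o1 unfolding ergodic_index_cocycle_def index_cocycle_def by blast
  obtain d where d: "choice_functions M S R K d"
    "AE x in M. \<forall>y. (x, y) \<in> R \<longrightarrow> (\<forall>i\<in>K. \<forall>j\<in>K. \<Omega>\<^sub>2 (x, y) i = j \<longleftrightarrow> S `` {d j x} = S `` {d i y})"
    using o2 unfolding ergodic_index_cocycle_def index_cocycle_def by blast
  note cD = choice_functionsD[OF c(1)] and dD = choice_functionsD[OF d(1)]
  define good where "good x \<longleftrightarrow>
      R `` {x} = (\<Union>i\<in>J. S `` {c i x}) \<and> disjoint_family_on (\<lambda>i. S `` {c i x}) J \<and>
      R `` {x} = (\<Union>i\<in>K. S `` {d i x}) \<and> disjoint_family_on (\<lambda>i. S `` {d i x}) K \<and>
      (\<forall>y. (x, y) \<in> R \<longrightarrow> (\<forall>i\<in>J. \<forall>j\<in>J. \<Omega>\<^sub>1 (x, y) i = j \<longleftrightarrow> S `` {c j x} = S `` {c i y})) \<and>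
      (\<forall>y. (x, y) \<in> R \<longrightarrow> (\<forall>i\<in>K. \<forall>j\<in>K. \<Omega>\<^sub>2 (x, y) i = j \<longleftrightarrow> S `` {d j x} = S `` {d i y}))" for x
  have "AE x in M. good x" using cD(4) dD(4) c(2) d(2) by eventually_elim (simp add: good_def)
  then obtain Y where Y: "Y \<in> sets M" "AE x in M. x \<in> Y" "\<forall>x\<in>Y. good x" "cocycle_on R K \<Omega>\<^sub>2 Y"
    by (rule R.cocycle_core[OF coc2])
  have Ysp: "x \<in> space M" if "x \<in> Y" for x using sets.sets_into_space[OF Y(1)] that by blast
  have class_eq: "S `` {p} = S `` {q}" if "(p, q) \<in> S" for p q
    using S.R_equiv that by (rule equiv_class_eq)
  define u where "u x k = (THE j. j \<in> J \<and> (c j x, d k x) \<in> S)" for x k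
  have u: "u x k \<in> J \<and> (c (u x k) x, d k x) \<in> S" and u_eq: "j \<in> J \<Longrightarrow> (c j x, d k x) \<in> S \<Longrightarrow> u x k = j"
    if x: "x \<in> Y" and k: "k \<in> K" for x k j
  proof -
    have g1: "R `` {x} = (\<Union>i\<in>J. S `` {c i x})"
      using bspec[OF Y(3) x] unfolding good_def by (elim conjE)
    have g2: "disjoint_family_on (\<lambda>i. S `` {c i x}) J"
      using bspec[OF Y(3) x] unfolding good_def by (elim conjE)
    note g = g1 g2
    have "d k x \<in> R `` {x}" using full_groupD(2)[OF dD(2)[OF k] Ysp[OF x]] by simp
    then obtain j0 where j0: "j0 \<in> J" "(c j0 x, d k x) \<in> S" unfolding g(1) by blast
    have un: "j = j0" if "j \<in> J" "(c j x, d k x) \<in> S" for j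
      using g(2) that j0 unfolding disjoint_family_on_def by blast
    have ux: "u x k = j0" unfolding u_def by (rule the_equality) (use j0 un in blast)+
    show "u x k \<in> J \<and> (c (u x k) x, d k x) \<in> S" using ux j0 by simp
    show "u x k = j" if "j \<in> J" "(c j x, d k x) \<in> S" using un[OF that] ux by simp
  qed
  have bij: "\<forall>x\<in>Y. bij_betw (u x) K J"
  proof
    fix x assume x: "x \<in> Y"
    have g1: "R `` {x} = (\<Union>i\<in>K. S `` {d i x})"
      using bspec[OF Y(3) x] unfolding good_def by (elim conjE)
    have g2: "disjoint_family_on (\<lambda>i. S `` {d i x}) K"
      using bspec[OF Y(3) x] unfolding good_def by (elim conjE)
    note g = g1 g2
    show "bij_betw (u x) K J"
      unfolding bij_betw_def
    proof
      show "inj_on (u x) K"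
      proof (rule inj_onI)
        fix k k' assume k: "k \<in> K" "k' \<in> K" "u x k = u x k'"
        have "c (u x k) x \<in> S `` {d k x} \<inter> S `` {d k' x}"
          using u[OF x k(1)] u[OF x k(2)] k(3) S.R_sym by auto
        then show "k = k'" using g(2) k(1,2) unfolding disjoint_family_on_def by blast
      qed
      show "u x ` K = J"
      proof
        show "u x ` K \<subseteq> J" using u[OF x] by blast
        show "J \<subseteq> u x ` K"
        proof
          fix j assume j: "j \<in> J"
          have "c j x \<in> R `` {x}" using full_groupD(2)[OF cD(2)[OF j] Ysp[OF x]] by simp
          then obtain k where k: "k \<in> K" "(d k x, c j x) \<in> S" unfolding g(1) by blast
          then have "u x k = j" using u_eq[OF x k(1) j] S.R_sym by blast
          then show "j \<in> u x ` K" using k(1) by blast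
        qed
      qed
    qed
  qed
  have meas: "\<forall>k\<in>K. \<forall>j\<in>J. {x \<in> Y. u x k = j} \<in> sets M"
  proof (intro ballI)
    fix k j assume k: "k \<in> K" and j: "j \<in> J"
    have "(\<lambda>x. (c j x, d k x)) \<in> M \<rightarrow>\<^sub>M M \<Otimes>\<^sub>M M"
      by (intro measurable_Pair full_groupD(1)[OF cD(2)[OF j]] full_groupD(1)[OF dD(2)[OF k]])
    from measurable_sets[OF this S.R_sets]
    have "Y \<inter> ((\<lambda>x. (c j x, d k x)) -` S \<inter> space M) \<in> sets M" by (rule sets.Int[OF Y(1)])
    moreover have "Y \<inter> ((\<lambda>x. (c j x, d k x)) -` S \<inter> space M) = {x \<in> Y. u x k = j}"
      using u u_eq k j Ysp by auto
    ultimately show "{x \<in> Y. u x k = j} \<in> sets M" by simp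
  qed
  have inter: "\<forall>x\<in>Y. \<forall>y. (x, y) \<in> R \<longrightarrow> (\<forall>k\<in>K. u x (\<Omega>\<^sub>2 (x, y) k) = \<Omega>\<^sub>1 (x, y) (u y k))"
  proof (intro ballI allI impI)
    fix x y k assume x: "x \<in> Y" and xy: "(x, y) \<in> R" and k: "k \<in> K"
    have y: "y \<in> Y" by (rule cocycle_onD(1)[OF Y(4) x xy])
    define k' where "k' = \<Omega>\<^sub>2 (x, y) k"
    have k': "k' \<in> K" unfolding k'_def using cocycle_onD(2)[OF Y(4) x xy] k by (rule Bij_apply)
    have gx: "good x" using Y(3) x by blast
    have "S `` {c (u x k') x} = S `` {d k' x}" using u[OF x k'] class_eq by blast
    also have "\<dots> = S `` {d k y}" using gx xy k k' unfolding good_def k'_def by blast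
    also have "\<dots> = S `` {c (u y k) y}" using u[OF y k] class_eq by blast
    finally show "u x (\<Omega>\<^sub>2 (x, y) k) = \<Omega>\<^sub>1 (x, y) (u y k)"
      using gx xy u[OF x k'] u[OF y k] unfolding good_def k'_def by metis
  qed
  show ?thesis
  proof (rule R.intertwined_essential_image_iso[OF ergodic_pmp_inclusionD(4)[OF inc] cD(1) dD(1) e1 e2 Y(1,2) _ bij meas inter])
    show "\<forall>x\<in>Y. \<forall>y. (x, y) \<in> R \<longrightarrow> y \<in> Y" using cocycle_onD(1)[OF Y(4)] by blast
  qed
qed

lemma (in pmp_relation) cocycleI:
  assumes preim: "\<And>W. W \<in> sets (borel_of T) \<Longrightarrow> {p \<in> R. \<Omega>' p \<in> W} \<in> sets (M \<Otimes>\<^sub>M M)"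
    and top: "\<And>p. p \<in> R \<Longrightarrow> \<Omega>' p \<in> topspace T"
    and ae: "AE x in M. \<forall>y. (x, y) \<in> R \<longrightarrow> \<Omega> (x, y) = \<Omega>' (x, y)"
    and mult: "AE x in M. \<forall>y z. (x, y) \<in> R \<longrightarrow> (y, z) \<in> R \<longrightarrow> \<Omega> (x, z) = \<Omega> (x, y) \<otimes>\<^bsub>G\<^esub> \<Omega> (y, z)"
  shows "cocycle M R G T \<Omega>"
proof -
  have sp: "space (restrict_space (M \<Otimes>\<^sub>M M) R) = R"
    using sets.sets_into_space[OF R_sets] by (auto simp: space_restrict_space)
  have "\<Omega>' \<in> restrict_space (M \<Otimes>\<^sub>M M) R \<rightarrow>\<^sub>M borel_of T"
  proof (rule measurableI)
    fix p assume "p \<in> space (restrict_space (M \<Otimes>\<^sub>M M) R)"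
    then show "\<Omega>' p \<in> space (borel_of T)" using top sp by simp
  next
    fix W assume W: "W \<in> sets (borel_of T)"
    have "\<Omega>' -` W \<inter> R = {p \<in> R. \<Omega>' p \<in> W}" by blast
    then have "\<Omega>' -` W \<inter> R \<in> sets (restrict_space (M \<Otimes>\<^sub>M M) R)"
      using preim[OF W] R_sets sets.sets_into_space[OF R_sets]
      by (subst sets_restrict_space_iff) (auto simp: Int_absorb2)
    then show "\<Omega>' -` W \<inter> space (restrict_space (M \<Otimes>\<^sub>M M) R) \<in> sets (restrict_space (M \<Otimes>\<^sub>M M) R)"
      using sp by simp
  qed
  then show ?thesis using ae mult unfolding cocycle_def by blast
qed

section \<open>Restriction to a subset\<close>

locale pmp_restriction = pmp_relation +
  fixes U :: "'a set"
  assumes U: "U \<in> sets M" and U_pos: "emeasure M U > 0"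
begin

abbreviation "MU \<equiv> cond_space M U"
abbreviation "RU \<equiv> restrict_rel R U"

lemma U_space: "U \<subseteq> space M" using sets.sets_into_space[OF U] .

lemma space_MU: "space MU = U"
  using U_space by (auto simp: cond_space_def space_restrict_space)

lemma sets_MU: "A \<in> sets MU \<longleftrightarrow> A \<in> sets M \<and> A \<subseteq> U"
  unfolding cond_space_def using U by (subst sets_restrict_space_iff) auto

lemma AE_MU: "(AE x in MU. P x) \<longleftrightarrow> (AE x in M. x \<in> U \<longrightarrow> P x)"
proof -
  have "(AE x in MU. P x) \<longleftrightarrow> (AE x in uniform_measure M U. x \<in> U \<longrightarrow> P x)"
    unfolding cond_space_def using U by (subst AE_restrict_space_iff) auto
  also have "\<dots> \<longleftrightarrow> (AE x in M. x \<in> U \<longrightarrow> x \<in> U \<longrightarrow> P x)"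
    using U U_pos by (subst AE_uniform_measure) (auto simp: less_top[symmetric])
  finally show ?thesis by simp
qed

lemma emeasure_MU:
  assumes "A \<in> sets M" "A \<subseteq> U"
  shows "emeasure MU A = emeasure M A / emeasure M U"
  unfolding cond_space_def using assms U
  by (subst emeasure_restrict_space) (auto simp: Int_absorb1)

lemma prob_space_MU: "prob_space MU"
proof (rule prob_spaceI)
  show "emeasure MU (space MU) = 1"
    unfolding space_MU emeasure_MU[OF U order_refl] using U_pos emeasure_finite[of U]
    by (intro ennreal_divide_self less_top[THEN iffD1]) simp_all
qed

lemma standard_borel_MU: "standard_borel MU"
proof -
  obtain T where T: "completely_metrizable_space T" "second_countable T"
    and spT: "space M \<in> sets (borel_of T)" and setsT: "sets M = sets (restrict_space (borel_of T) (space M))"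
    using std unfolding standard_borel_def by blast
  have sp: "space M \<subseteq> topspace T" using sets.sets_into_space[OF spT] by simp
  have iff: "A \<in> sets M \<longleftrightarrow> A \<in> sets (borel_of T) \<and> A \<subseteq> space M" for A
    unfolding setsT using spT sp by (subst sets_restrict_space_iff) (auto simp: Int_absorb2)
  have UT: "U \<in> sets (borel_of T)" using U iff by blast
  then have "A \<in> sets MU \<longleftrightarrow> A \<in> sets (restrict_space (borel_of T) U)" for A
    using sets_MU[of A] iff[of A] U_space sp by (subst sets_restrict_space_iff) (auto simp: Int_absorb2)
  then have "sets MU = sets (restrict_space (borel_of T) U)" by blast
  then show ?thesis using T UT unfolding standard_borel_def space_MU by blast
qed

lemma pair_sets_MU:
  assumes "V \<in> sets (M \<Otimes>\<^sub>M M)" "V \<subseteq> U \<times> U"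
  shows "V \<in> sets (MU \<Otimes>\<^sub>M MU)"
proof -
  have "(\<lambda>x. x) \<in> MU \<rightarrow>\<^sub>M M"
  proof (rule measurableI)
    show "x \<in> space M" if "x \<in> space MU" for x using that U_space space_MU by auto
    show "(\<lambda>x. x) -` A \<inter> space MU \<in> sets MU" if "A \<in> sets M" for A
      using that U by (simp add: space_MU sets_MU)
  qed
  from measurable_sets[OF measurable_pair_map[OF this this] assms(1)]
  have "map_prod (\<lambda>x. x) (\<lambda>x. x) -` V \<inter> space (MU \<Otimes>\<^sub>M MU) \<in> sets (MU \<Otimes>\<^sub>M MU)" .
  moreover have "map_prod (\<lambda>x. x) (\<lambda>x. x) -` V \<inter> space (MU \<Otimes>\<^sub>M MU) = V"
    using assms(2) by (auto simp: space_pair_measure space_MU)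
  ultimately show ?thesis by simp
qed

lemma RU_iff: "(x, y) \<in> RU \<longleftrightarrow> (x, y) \<in> R \<and> x \<in> U \<and> y \<in> U"
  by (auto simp: restrict_rel_def)

text \<open>This reduces questions about the restricted relation to the whole space, where the
  measure is already known to be preserved.\<close>

lemma partial_iso_MU:
  "partial_iso MU RU A g \<longleftrightarrow> partial_iso M R A g \<and> A \<subseteq> U \<and> g ` A \<subseteq> U"
proof
  assume g: "partial_iso MU RU A g"
  note gD = partial_isoD[OF g]
  have A: "A \<in> sets M" "A \<subseteq> U" using gD(1) by (simp_all add: sets_MU)
  have gU: "g x \<in> U" "(x, g x) \<in> R" if "x \<in> A" for x using gD(3)[OF that] by (simp_all add: RU_iff)
  have "partial_iso M R A g"
  proof (rule partial_isoI[OF A(1) gD(2) gU(2)])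
    fix B assume "B \<in> sets M"
    then have "B \<inter> U \<in> sets MU" using U by (simp add: sets_MU)
    from gD(4)[OF this] have "{x \<in> A. g x \<in> B \<inter> U} \<in> sets M" by (simp add: sets_MU)
    moreover have "{x \<in> A. g x \<in> B \<inter> U} = {x \<in> A. g x \<in> B}" using gU by auto
    ultimately show "{x \<in> A. g x \<in> B} \<in> sets M" by simp
  next
    fix B assume "B \<in> sets M" "B \<subseteq> A"
    then have "g ` B \<in> sets MU" using A by (intro gD(5)) (auto simp: sets_MU)
    then show "g ` B \<in> sets M" by (simp add: sets_MU)
  qed
  then show "partial_iso M R A g \<and> A \<subseteq> U \<and> g ` A \<subseteq> U" using A gU by auto
next
  assume g: "partial_iso M R A g \<and> A \<subseteq> U \<and> g ` A \<subseteq> U"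
  then have gD: "partial_iso M R A g" and AU: "A \<subseteq> U" "g ` A \<subseteq> U" by auto
  note gD = partial_isoD[OF gD]
  show "partial_iso MU RU A g"
  proof (rule partial_isoI)
    show "A \<in> sets MU" using gD(1) AU by (simp add: sets_MU)
    show "inj_on g A" by (rule gD(2))
    show "(x, g x) \<in> RU" if "x \<in> A" for x using gD(3)[OF that] AU that by (auto simp: RU_iff)
    show "{x \<in> A. g x \<in> B} \<in> sets MU" if "B \<in> sets MU" for B
      using gD(4)[of B] that AU by (auto simp: sets_MU)
    show "g ` B \<in> sets MU" if "B \<in> sets MU" "B \<subseteq> A" for B
      using gD(5)[of B] that AU by (auto simp: sets_MU)
  qed
qed

lemma pmp_equiv_MU: "pmp_equiv MU RU"
  unfolding pmp_equiv_def
proof (intro conjI ballI)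
  show "countable_borel_equiv MU RU"
    unfolding countable_borel_equiv_def space_MU
  proof (intro conjI ballI)
    have "RU \<in> sets (M \<Otimes>\<^sub>M M)" unfolding restrict_rel_def using R_sets U by (intro sets.Int pair_measureI)
    then show "RU \<in> sets (MU \<Otimes>\<^sub>M MU)" by (rule pair_sets_MU) (auto simp: restrict_rel_def)
    show "equiv U RU"
    proof (rule equivI)
      show "RU \<subseteq> U \<times> U" by (auto simp: restrict_rel_def)
      show "refl_on U RU" using R_refl U_space by (auto simp: refl_on_def RU_iff)
      show "sym RU" using R_sym by (auto simp: sym_def RU_iff)
      show "trans RU" using R_trans by (auto simp: trans_def RU_iff)
    qed
    show "countable (RU `` {x})" for x
    proof (rule countable_subset)
      show "RU `` {x} \<subseteq> {y. (y, x) \<in> R}" using R_sym by (auto simp: RU_iff)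
    qed (rule R_countable)
  qed
next
  fix f assume f: "f \<in> full_group MU RU"
  note fD = full_groupD[OF f]
  show "distr MU MU f = MU"
  proof (rule measure_eqI)
    fix B assume "B \<in> sets (distr MU MU f)"
    then have B: "B \<in> sets MU" by simp
    define A where "A = f -` B \<inter> space MU"
    have A: "A \<in> sets MU" unfolding A_def by (rule measurable_sets[OF fD(1) B])
    have "f ` A = B"
    proof
      show "f ` A \<subseteq> B" by (auto simp: A_def)
      show "B \<subseteq> f ` A"
      proof
        fix y assume y: "y \<in> B"
        then have "y \<in> f ` space MU" using fD(3) sets.sets_into_space[OF B] by (auto simp: bij_betw_def)
        then show "y \<in> f ` A" using y by (auto simp: A_def)
      qed
    qed
    moreover have "partial_iso M R A f"
      using full_group_partial_iso[OF f A] by (simp add: partial_iso_MU)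
    then have "emeasure M (f ` A) = emeasure M A" by (rule partial_iso_emeasure)
    ultimately have "emeasure M B = emeasure M A" by simp
    then show "emeasure (distr MU MU f) B = emeasure MU B"
      using A B by (simp add: emeasure_distr[OF fD(1) B] A_def[symmetric] emeasure_MU sets_MU)
  qed simp
qed

sublocale RU: pmp_relation MU RU
  using prob_space_MU standard_borel_MU pmp_equiv_MU
  by (simp add: pmp_relation_def pmp_relation_axioms_def)

lemma conull_MU:
  assumes "A \<in> sets M" "A \<subseteq> U" "emeasure M A = emeasure M U"
  shows "AE x in MU. x \<in> A"
proof -
  have "emeasure M (U - A) = 0"
    using assms U emeasure_finite[of A] by (simp add: emeasure_Diff)
  then have "U - A \<in> null_sets M" using assms U by auto
  from AE_not_in[OF this] show ?thesis unfolding AE_MU by (rule eventually_mono) blast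
qed

lemma ergodic_MU:
  assumes "ergodic_rel M R"
  shows "ergodic_rel MU RU"
  unfolding ergodic_rel_def
proof (intro allI impI)
  fix A assume A: "invariant_borel_set MU RU A"
  then have AM: "A \<in> sets M" "A \<subseteq> U" by (auto simp: invariant_borel_set_def sets_MU)
  show "emeasure MU A = 0 \<or> emeasure MU A = 1"
  proof (cases "emeasure M A = 0")
    case True
    then show ?thesis by (simp add: emeasure_MU[OF AM])
  next
    case False
    then have sat: "AE x in M. \<exists>z\<in>A. (x, z) \<in> R"
      using AM by (intro ergodic_saturation[OF assms]) (auto simp: zero_less_iff_neq_zero)
    have inv: "AE x in M. x \<in> U \<longrightarrow> (\<forall>y. (x, y) \<in> RU \<longrightarrow> (x \<in> A \<longleftrightarrow> y \<in> A))"
      using A unfolding invariant_borel_set_def AE_MU by blast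
    have "AE x in MU. x \<in> A"
      unfolding AE_MU using sat inv
    proof eventually_elim
      case (elim x)
      then show ?case using AM(2) RU_iff by blast
    qed
    then have "emeasure MU A = 1" using AM by (simp add: RU.AE_in_set_eq_1 RU.emeasure_eq_measure sets_MU)
    then show ?thesis ..
  qed
qed

lemma cocycle_MU:
  assumes coc: "cocycle M R G T \<Omega>"
  shows "cocycle MU RU G T (restrict \<Omega> RU)"
proof -
  obtain \<Omega>' where \<Omega>': "\<forall>W\<in>sets (borel_of T). {p \<in> R. \<Omega>' p \<in> W} \<in> sets (M \<Otimes>\<^sub>M M)"
    "\<forall>p\<in>R. \<Omega>' p \<in> topspace T" "AE x in M. \<forall>y. (x, y) \<in> R \<longrightarrow> \<Omega> (x, y) = \<Omega>' (x, y)"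
    by (rule cocycle_version[OF coc])
  have mult: "AE x in M. \<forall>y z. (x, y) \<in> R \<longrightarrow> (y, z) \<in> R \<longrightarrow> \<Omega> (x, z) = \<Omega> (x, y) \<otimes>\<^bsub>G\<^esub> \<Omega> (y, z)"
    using coc unfolding cocycle_def by blast
  show ?thesis
  proof (rule RU.cocycleI[of _ \<Omega>'])
    fix W assume "W \<in> sets (borel_of T)"
    then have "{p \<in> R. \<Omega>' p \<in> W} \<inter> U \<times> U \<in> sets (M \<Otimes>\<^sub>M M)"
      using \<Omega>'(1) U by (intro sets.Int pair_measureI) auto
    then have "{p \<in> R. \<Omega>' p \<in> W} \<inter> U \<times> U \<in> sets (MU \<Otimes>\<^sub>M MU)" by (rule pair_sets_MU) auto
    moreover have "{p \<in> R. \<Omega>' p \<in> W} \<inter> U \<times> U = {p \<in> RU. \<Omega>' p \<in> W}" by (auto simp: restrict_rel_def)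
    ultimately show "{p \<in> RU. \<Omega>' p \<in> W} \<in> sets (MU \<Otimes>\<^sub>M MU)" by simp
  next
    show "\<Omega>' p \<in> topspace T" if "p \<in> RU" for p using \<Omega>'(2) that by (auto simp: restrict_rel_def)
    show "AE x in MU. \<forall>y. (x, y) \<in> RU \<longrightarrow> restrict \<Omega> RU (x, y) = \<Omega>' (x, y)"
      unfolding AE_MU using \<Omega>'(3) by eventually_elim (simp add: RU_iff)
    show "AE x in MU. \<forall>y z. (x, y) \<in> RU \<longrightarrow> (y, z) \<in> RU \<longrightarrow>
        restrict \<Omega> RU (x, z) = restrict \<Omega> RU (x, y) \<otimes>\<^bsub>G\<^esub> restrict \<Omega> RU (y, z)"
      unfolding AE_MU using mult
    proof eventually_elim
      case (elim x)
      show ?case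
      proof (intro impI allI)
        fix y z assume xy: "(x, y) \<in> RU" "(y, z) \<in> RU"
        then have "(x, z) \<in> RU" by (rule RU.R_trans)
        then show "restrict \<Omega> RU (x, z) = restrict \<Omega> RU (x, y) \<otimes>\<^bsub>G\<^esub> restrict \<Omega> RU (y, z)"
          using elim xy by (simp add: RU_iff)
      qed
    qed
  qed
qed

text \<open>An invariant set of the restricted subrelation that is not null is met by recurrence
  from almost every point of \<open>U\<close>; by invariance it then contains almost every point of
  \<open>U\<close>.\<close>

lemma ergodic_cocycle_MU:
  assumes erg: "ergodic_rel M R" and coc: "ergodic_cocycle M R (BijGroup I) (sym_topology I) \<Omega>"
  shows "ergodic_cocycle MU RU (BijGroup I) (sym_topology I) (restrict \<Omega> RU)"
  unfolding ergodic_cocycle_def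
proof (intro conjI allI impI)
  have c: "cocycle M R (BijGroup I) (sym_topology I) \<Omega>" using coc by (simp add: ergodic_cocycle_def)
  then show "cocycle MU RU (BijGroup I) (sym_topology I) (restrict \<Omega> RU)" by (rule cocycle_MU)
  fix K A assume K: "subgroup K (BijGroup I) \<and> openin (sym_topology I) K"
  show "invariant_borel_set MU {p \<in> RU. restrict \<Omega> RU p \<in> K} A \<longleftrightarrow> invariant_borel_set MU RU A"
  proof
    assume "invariant_borel_set MU RU A"
    then show "invariant_borel_set MU {p \<in> RU. restrict \<Omega> RU p \<in> K} A"
      unfolding invariant_borel_set_def by (auto elim!: eventually_mono)
  next
    assume A: "invariant_borel_set MU {p \<in> RU. restrict \<Omega> RU p \<in> K} A"
    then have AM: "A \<in> sets M" "A \<subseteq> U" "A \<in> sets MU"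
      and inv: "AE x in MU. \<forall>y. (x, y) \<in> RU \<and> \<Omega> (x, y) \<in> K \<longrightarrow> (x \<in> A \<longleftrightarrow> y \<in> A)"
      by (auto simp: invariant_borel_set_def sets_MU elim!: eventually_mono)
    have triv: "(AE x in MU. x \<in> A) \<or> (AE x in MU. x \<notin> A)"
    proof (cases "emeasure M A = 0")
      case True
      then have "A \<in> null_sets M" using AM(1) by auto
      from AE_not_in[OF this] have "AE x in MU. x \<notin> A" unfolding AE_MU by (rule eventually_mono) simp
      then show ?thesis ..
    next
      case False
      have one: "(\<lambda>i\<in>I. i) \<in> K" using subgroup.one_closed[of K "BijGroup I"] K by (simp add: BijGroup_def)
      obtain F where F: "finite F" "F \<subseteq> I" "agreeing I (\<lambda>i\<in>I. i) F \<subseteq> K"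
        using openin_sym_topology_nbhd[OF _ one] K by blast
      have rec: "AE x in M. \<exists>z\<in>A. (x, z) \<in> R \<and> (\<forall>i\<in>F. \<Omega> (x, z) i = i)"
        using False AM(1) by (intro cocycle_recurrence[OF erg coc F(1,2)]) (auto simp: zero_less_iff_neq_zero)
      obtain Y where Y: "Y \<in> sets M" "AE x in M. x \<in> Y" "\<forall>x\<in>Y. True" "cocycle_on R I \<Omega> Y"
        by (rule cocycle_core[OF c, of "\<lambda>_. True"]) auto
      have "AE x in MU. x \<in> A"
        unfolding AE_MU using rec Y(2) inv[unfolded AE_MU]
      proof eventually_elim
        case (elim x)
        show ?case
        proof
          assume x: "x \<in> U"
          obtain z where z: "z \<in> A" "(x, z) \<in> R" "\<forall>i\<in>F. \<Omega> (x, z) i = i" using elim(1) by blast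
          have "\<Omega> (x, z) \<in> agreeing I (\<lambda>i\<in>I. i) F"
            using cocycle_onD(2)[OF Y(4) elim(2) z(2)] z(3) F(2) by (auto simp: agreeing_def)
          then have "\<Omega> (x, z) \<in> K" using F(3) by blast
          moreover have "(x, z) \<in> RU" using z x AM(2) by (auto simp: RU_iff)
          ultimately show "x \<in> A" using elim(3) x z(1) by blast
        qed
      qed
      then show ?thesis ..
    qed
    then have "AE x in MU. \<forall>y. (x, y) \<in> RU \<longrightarrow> (x \<in> A \<longleftrightarrow> y \<in> A)"
    proof
      assume ae: "AE x in MU. x \<in> A"
      show ?thesis using ae RU.AE_class[OF ae] by eventually_elim blast
    next
      assume ae: "AE x in MU. x \<notin> A"
      show ?thesis using ae RU.AE_class[OF ae] by eventually_elim blast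
    qed
    then show "invariant_borel_set MU RU A" using AM(3) by (simp add: invariant_borel_set_def)
  qed
qed

text \<open>Both ends of a pair are moved into \<open>U\<close> by recurrence, which changes the
  value of the cocycle only outside the given finite set.\<close>

lemma essential_image_MU:
  assumes erg: "ergodic_rel M R" and coc: "ergodic_cocycle M R (BijGroup I) (sym_topology I) \<Omega>" and I: "countable I"
  shows "essential_image MU RU (sym_topology I) (restrict \<Omega> RU) = essential_image M R (sym_topology I) \<Omega>"
    (is "?HU = ?H")
proof
  have c: "cocycle M R (BijGroup I) (sym_topology I) \<Omega>" using coc by (simp add: ergodic_cocycle_def)
  note H = essential_image_properties[OF c I]
    and HU = RU.essential_image_properties[OF cocycle_MU[OF c] I]
  show "?HU \<subseteq> ?H"
  proof (rule HU(3)[OF H(1)])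
    show "AE x in MU. \<forall>y. (x, y) \<in> RU \<longrightarrow> restrict \<Omega> RU (x, y) \<in> ?H"
      unfolding AE_MU using H(2) by eventually_elim (simp add: RU_iff)
  qed
  have HU_AE: "AE x in M. x \<in> U \<longrightarrow> (\<forall>y. (x, y) \<in> RU \<longrightarrow> \<Omega> (x, y) \<in> ?HU)"
    using HU(2)[unfolded AE_MU] by eventually_elim simp
  have rec: "AE x in M. \<forall>F. finite F \<longrightarrow> F \<subseteq> I \<longrightarrow> (\<exists>z\<in>U. (x, z) \<in> R \<and> (\<forall>k\<in>F. \<Omega> (x, z) k = k))"
    by (intro AE_finite_subsets[OF I] cocycle_recurrence[OF erg coc _ _ U U_pos])
  have "AE x in M. (x \<in> U \<longrightarrow> (\<forall>y. (x, y) \<in> RU \<longrightarrow> \<Omega> (x, y) \<in> ?HU)) \<and>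
      (\<forall>F. finite F \<longrightarrow> F \<subseteq> I \<longrightarrow> (\<exists>z\<in>U. (x, z) \<in> R \<and> (\<forall>k\<in>F. \<Omega> (x, z) k = k)))"
    using HU_AE rec by eventually_elim blast
  then obtain Z where Z: "Z \<in> sets M" "AE x in M. x \<in> Z"
    "\<forall>x\<in>Z. (x \<in> U \<longrightarrow> (\<forall>y. (x, y) \<in> RU \<longrightarrow> \<Omega> (x, y) \<in> ?HU)) \<and>
      (\<forall>F. finite F \<longrightarrow> F \<subseteq> I \<longrightarrow> (\<exists>z\<in>U. (x, z) \<in> R \<and> (\<forall>k\<in>F. \<Omega> (x, z) k = k)))"
    "cocycle_on R I \<Omega> Z"
    by (rule cocycle_core[OF c])
  show "?H \<subseteq> ?HU"
  proof (rule H(3)[OF HU(1)])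
    show "AE x in M. \<forall>y. (x, y) \<in> R \<longrightarrow> \<Omega> (x, y) \<in> ?HU"
      using Z(2)
    proof eventually_elim
      case (elim x)
      show ?case
      proof (intro allI impI)
        fix y assume xy: "(x, y) \<in> R"
        note D = cocycle_onD[OF Z(4) elim xy]
        have B: "\<Omega> (x, y) \<in> Bij I" by (rule D(2))
        have "?HU \<inter> agreeing I (\<Omega> (x, y)) F \<noteq> {}" if F: "finite F" "F \<subseteq> I" for F
        proof -
          define F' where "F' = \<Omega> (x, y) ` F"
          have F': "finite F'" "F' \<subseteq> I" using F Bij_apply[OF B] by (auto simp: F'_def)
          obtain z where z: "z \<in> U" "(y, z) \<in> R" "\<forall>k\<in>F. \<Omega> (y, z) k = k" using Z(3) D(1) F by blast
          obtain z' where z': "z' \<in> U" "(x, z') \<in> R" "\<forall>k\<in>F'. \<Omega> (x, z') k = k" using Z(3) elim F' by blast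
          have z'Z: "z' \<in> Z" by (rule cocycle_onD(1)[OF Z(4) elim z'(2)])
          have xz: "(x, z) \<in> R" using xy z(2) by (rule R_trans)
          have z'z: "(z', z) \<in> R" using R_trans[OF R_sym[OF z'(2)] xz] .
          have gB: "\<Omega> (z', z) \<in> Bij I" by (rule cocycle_onD(2)[OF Z(4) z'Z z'z])
          have "\<Omega> (z', z) k = \<Omega> (x, y) k" if k: "k \<in> F" for k
          proof -
            have kI: "k \<in> I" using k F(2) by blast
            define k' where "k' = \<Omega> (x, y) k"
            have k': "k' \<in> F'" "k' \<in> I" using k F' by (auto simp: k'_def F'_def)
            have "\<Omega> (x, z) k = k'" using D(3)[OF z(2) kI] z(3) k by (simp add: k'_def)
            moreover have "\<Omega> (x, z) k = \<Omega> (x, z') (\<Omega> (z', z) k)"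
              using cocycle_onD(3)[OF Z(4) elim z'(2) z'z kI] .
            moreover have "\<Omega> (x, z') k' = k'" using z'(3) k'(1) by blast
            ultimately have "\<Omega> (z', z) k = k'"
              using Bij_inj[OF cocycle_onD(2)[OF Z(4) elim z'(2)] Bij_apply[OF gB kI] k'(2)] by simp
            then show ?thesis by (simp add: k'_def)
          qed
          moreover have "\<Omega> (z', z) \<in> ?HU"
            using Z(3) z'Z z'z z(1) z'(1) by (simp add: RU_iff)
          ultimately show ?thesis using gB by (auto simp: agreeing_def)
        qed
        then show "\<Omega> (x, y) \<in> ?HU" using HU(1) B unfolding closedin_sym_topology_iff by blast
      qed
    qed
  qed
qed

end

lemma ergodic_pmp_inclusion_restrict:
  assumes inc: "ergodic_pmp_inclusion M S R" and U: "U \<in> sets M" "emeasure M U > 0"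
  shows "ergodic_pmp_inclusion (cond_space M U) (restrict_rel S U) (restrict_rel R U)"
proof -
  interpret R: pmp_restriction M R U
    using ergodic_pmp_inclusionD(2)[OF inc] U by (simp add: pmp_restriction_def pmp_restriction_axioms_def)
  interpret S: pmp_restriction M S U
    using ergodic_pmp_inclusionD(1)[OF inc] U by (simp add: pmp_restriction_def pmp_restriction_axioms_def)
  have "AE x in cond_space M U. restrict_rel S U `` {x} \<subseteq> restrict_rel R U `` {x}"
    unfolding R.AE_MU using ergodic_pmp_inclusionD(5)[OF inc] by eventually_elim (auto simp: restrict_rel_def)
  then show ?thesis
    using R.prob_space_MU R.standard_borel_MU R.pmp_equiv_MU S.pmp_equiv_MU
      R.ergodic_MU[OF ergodic_pmp_inclusionD(4)[OF inc]] S.ergodic_MU[OF ergodic_pmp_inclusionD(3)[OF inc]]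
    by (simp add: ergodic_pmp_inclusion_def standard_prob_space_def rel_subset_ae_def)
qed

text \<open>The map \<open>c i\<close> sends \<open>U\<close> to a set of the same measure, and a
  partial isomorphism \<open>\<theta>\<close> of the ergodic relation \<open>S\<close> brings this
  set back to \<open>U\<close>. The composition \<open>\<theta> \<circ> c i\<close> takes values in
  \<open>U\<close> and represents the same \<open>S\<close>-class as \<open>c i\<close>.\<close>

lemma choice_functions_restrict:
  assumes inc: "ergodic_pmp_inclusion M S R" and U: "U \<in> sets M" "emeasure M U > 0"
    and c: "choice_functions M S R I c"
  obtains c' where "choice_functions (cond_space M U) (restrict_rel S U) (restrict_rel R U) I c'"
    "AE x in cond_space M U. \<forall>i\<in>I. S `` {c i x} = S `` {c' i x} \<and> c' i x \<in> U"
proof -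
  interpret R: pmp_restriction M R U
    using ergodic_pmp_inclusionD(2)[OF inc] U by (simp add: pmp_restriction_def pmp_restriction_axioms_def)
  interpret S: pmp_relation M S by (rule ergodic_pmp_inclusionD(1)[OF inc])
  note cD = choice_functionsD[OF c]
  obtain i0 where i0: "i0 \<in> I" "\<forall>x\<in>space M. c i0 x = x" using cD(3) by blast
  obtain Y where Y: "Y \<in> sets M" "AE x in M. x \<in> Y" "\<forall>x\<in>Y. S `` {x} \<subseteq> R `` {x}"
    "\<forall>x\<in>Y. \<forall>y. (x, y) \<in> R \<longrightarrow> y \<in> Y"
    by (rule R.invariant_core[OF ergodic_pmp_inclusionD(5)[OF inc]])
  define good where "good i p \<longleftrightarrow> partial_iso (cond_space M U) (restrict_rel R U) (fst p) (snd p) \<and>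
      (AE x in cond_space M U. x \<in> fst p) \<and> (AE x in cond_space M U. x \<in> snd p ` fst p) \<and>
      (\<forall>x\<in>fst p. (c i x, snd p x) \<in> S) \<and> (i = i0 \<longrightarrow> (\<forall>x\<in>fst p. snd p x = x))" for i and p :: "'a set \<times> ('a \<Rightarrow> 'a)"
  have "\<exists>p. good i p" if i: "i \<in> I" for i
  proof (cases "i = i0")
    case True
    have "partial_iso (cond_space M U) (restrict_rel R U) U (\<lambda>x. x)"
      using full_group_partial_iso[OF R.RU.id_full_group] U(1) by (simp add: R.sets_MU)
    moreover have "AE x in cond_space M U. x \<in> U" by (rule R.conull_MU) (use U in auto)
    moreover have "(c i x, x) \<in> S" if "x \<in> U" for x
      using i0(2) True R.U_space that S.R_refl by auto
    ultimately have "good i (U, \<lambda>x. x)" by (simp add: good_def)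
    then show ?thesis ..
  next
    case False
    have ci: "partial_iso M R B (c i)" if "B \<in> sets M" for B
      using full_group_partial_iso[OF cD(2)[OF i] that] .
    define V where "V = c i ` U"
    have V: "V \<in> sets M" unfolding V_def using partial_isoD(5)[OF ci[OF U(1)] U(1)] by simp
    have "emeasure M V = emeasure M U" unfolding V_def by (rule R.partial_iso_emeasure[OF ci[OF U(1)]])
    then obtain C \<theta> where C: "partial_iso M S C \<theta>" "C \<subseteq> V" "\<theta> ` C \<subseteq> U" "V - C \<in> null_sets M" "U - \<theta> ` C \<in> null_sets M"
      by (rule S.ergodic_partial_iso[OF ergodic_pmp_inclusionD(3)[OF inc] V U(1)])
    \<comment> \<open>The inclusion of \<open>S\<close> in \<open>R\<close> is only known on
      \<open>Y\<close>, and the graph has to lie in \<open>R\<close> everywhere.\<close>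
    define A where "A = {x \<in> U \<inter> Y. c i x \<in> C}"
    have UY: "U \<inter> Y \<in> sets M" using U(1) Y(1) by simp
    have A: "A \<in> sets M" unfolding A_def by (rule partial_isoD(4)[OF ci[OF UY] partial_isoD(1)[OF C(1)]])
    have AU: "A \<subseteq> U" by (auto simp: A_def)
    have cY: "c i x \<in> Y" if "x \<in> A" for x
      using Y(4) partial_isoD(3)[OF ci[OF A] that] that by (auto simp: A_def)
    have g: "partial_iso M R A (\<theta> \<circ> c i)"
    proof -
      have C': "partial_iso M (S \<inter> Y \<times> UNIV) (C \<inter> Y) \<theta>"
      proof -
        have "partial_iso M S (C \<inter> Y) \<theta>"
          using partial_isoD(1)[OF C(1)] Y(1) by (intro partial_iso_subset[OF C(1)]) auto
        then show ?thesis unfolding partial_iso_def by auto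
      qed
      show ?thesis
      proof (rule partial_iso_comp[OF ci[OF A] C'])
        show "c i ` A \<subseteq> C \<inter> Y" using cY by (auto simp: A_def)
        show "(x, z) \<in> R" if "(x, y) \<in> R" "(y, z) \<in> S \<inter> Y \<times> UNIV" for x y z
        proof -
          have "(y, z) \<in> R" using that(2) Y(3) by blast
          with that(1) show ?thesis by (rule R.R_trans)
        qed
      qed
    qed
    have gU: "(\<theta> \<circ> c i) ` A \<subseteq> U" using C(3) by (auto simp: A_def)
    have "emeasure M A = emeasure M U"
    proof -
      have "U - A \<subseteq> (space M - Y) \<union> {x \<in> U. c i x \<in> V - C}"
        using R.U_space by (auto simp: A_def V_def)
      moreover have "space M - Y \<in> null_sets M"
        using Y(1,2) by (subst AE_iff_null_sets) (auto elim!: eventually_mono)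
      moreover have "{x \<in> U. c i x \<in> V - C} \<in> null_sets M"
      proof (rule null_setsI)
        let ?B = "{x \<in> U. c i x \<in> V - C}"
        show B: "?B \<in> sets M" using V partial_isoD(1)[OF C(1)] by (intro partial_isoD(4)[OF ci[OF U(1)]]) auto
        have "emeasure M ?B = emeasure M (c i ` ?B)" by (rule R.partial_iso_emeasure[OF ci[OF B], symmetric])
        also have "\<dots> \<le> emeasure M (V - C)" using C(4) by (intro emeasure_mono) auto
        also have "\<dots> = 0" using C(4) by auto
        finally show "emeasure M ?B = 0" by simp
      qed
      ultimately have "U - A \<in> null_sets M"
        using U(1) A by (intro null_sets_subset[of "(space M - Y) \<union> {x \<in> U. c i x \<in> V - C}" M "U - A"] null_sets.Un) auto
      then have "emeasure M (U - (U - A)) = emeasure M U" using U(1) by (rule emeasure_Diff_null_set)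
      then show ?thesis using AU by (simp add: double_diff)
    qed
    moreover have "emeasure M ((\<theta> \<circ> c i) ` A) = emeasure M A" by (rule R.partial_iso_emeasure[OF g])
    ultimately have "AE x in cond_space M U. x \<in> A" "AE x in cond_space M U. x \<in> (\<theta> \<circ> c i) ` A"
      using A AU gU partial_isoD(5)[OF g A order_refl] by (auto intro!: R.conull_MU)
    moreover have "partial_iso (cond_space M U) (restrict_rel R U) A (\<theta> \<circ> c i)"
      using g AU gU by (simp add: R.partial_iso_MU)
    moreover have "(c i x, (\<theta> \<circ> c i) x) \<in> S" if "x \<in> A" for x
      using partial_isoD(3)[OF C(1)] that by (auto simp: A_def)
    ultimately have "good i (A, \<theta> \<circ> c i)" using False by (simp add: good_def)
    then show ?thesis ..
  qed
  then have "\<forall>i\<in>I. \<exists>p. good i p" by blast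
  from bchoice[OF this] obtain p where p: "\<forall>i\<in>I. good i (p i)" by blast
  have g0: "AE x in cond_space M U. snd (p i0) x = x"
    using bspec[OF p i0(1)] by (auto simp: good_def elim!: eventually_mono)
  have pi: "i \<in> I \<Longrightarrow> partial_iso (cond_space M U) (restrict_rel R U) (fst (p i)) (snd (p i))"
    and pd: "i \<in> I \<Longrightarrow> AE x in cond_space M U. x \<in> fst (p i)"
    and pr: "i \<in> I \<Longrightarrow> AE x in cond_space M U. x \<in> snd (p i) ` fst (p i)"
    and pS: "i \<in> I \<Longrightarrow> \<forall>x\<in>fst (p i). (c i x, snd (p i) x) \<in> S" for i
    using p by (auto simp: good_def)
  obtain c' where c': "\<forall>i\<in>I. c' i \<in> full_group (cond_space M U) (restrict_rel R U)"
    "\<exists>i\<in>I. \<forall>x\<in>space (cond_space M U). c' i x = x"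
    "AE x in cond_space M U. \<forall>i\<in>I. c' i x = snd (p i) x"
    by (rule R.RU.choice_family_from_partial_isos[where g = "\<lambda>i. snd (p i)", OF i0(1) cD(1) g0 pi pd pr])
  have "AE x in cond_space M U. \<forall>i\<in>I. x \<in> fst (p i)"
    using pd cD(1) by (intro AE_ball_countable')
  then have rel: "AE x in cond_space M U. \<forall>i\<in>I. S `` {c i x} = S `` {c' i x} \<and> c' i x \<in> U"
    using c'(3)
  proof eventually_elim
    case (elim x)
    show ?case
    proof
      fix i assume i: "i \<in> I"
      have x: "x \<in> fst (p i)" "c' i x = snd (p i) x" using elim i by auto
      have "(c i x, c' i x) \<in> S" using pS[OF i] x by auto
      then have "S `` {c i x} = S `` {c' i x}" by (rule equiv_class_eq[OF S.R_equiv])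
      moreover have "c' i x \<in> U" using partial_isoD(3)[OF pi[OF i] x(1)] x(2) by (simp add: R.RU_iff)
      ultimately show "S `` {c i x} = S `` {c' i x} \<and> c' i x \<in> U" ..
    qed
  qed
  have "AE x in cond_space M U. R `` {x} = (\<Union>i\<in>I. S `` {c i x}) \<and> disjoint_family_on (\<lambda>i. S `` {c i x}) I"
    unfolding R.AE_MU using cD(4) by eventually_elim blast
  then have "AE x in cond_space M U. restrict_rel R U `` {x} = (\<Union>i\<in>I. restrict_rel S U `` {c' i x}) \<and>
      disjoint_family_on (\<lambda>i. restrict_rel S U `` {c' i x}) I"
    using rel AE_space
  proof eventually_elim
    case (elim x)
    have x: "x \<in> U" using elim(3) by (simp add: R.space_MU)
    have cl: "restrict_rel S U `` {c' i x} = S `` {c i x} \<inter> U" if "i \<in> I" for i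
      using elim(2) that by (auto simp: restrict_rel_def)
    have "restrict_rel R U `` {x} = R `` {x} \<inter> U" using x by (auto simp: restrict_rel_def)
    also have "\<dots> = (\<Union>i\<in>I. S `` {c i x} \<inter> U)" using elim(1) by auto
    finally have "restrict_rel R U `` {x} = (\<Union>i\<in>I. restrict_rel S U `` {c' i x})" using cl by simp
    moreover have "disjoint_family_on (\<lambda>i. restrict_rel S U `` {c' i x}) I"
      using elim(1) cl unfolding disjoint_family_on_def by blast
    ultimately show ?case ..
  qed
  then have "choice_functions (cond_space M U) (restrict_rel S U) (restrict_rel R U) I c'"
    using c'(1,2) cD(1) unfolding choice_functions_def by blast
  then show ?thesis using rel by (rule that)
qed

theorem ergodic_index_cocycle_restrict:
  assumes inc: "ergodic_pmp_inclusion M S R" and U: "U \<in> sets M" "emeasure M U > 0"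
    and o: "ergodic_index_cocycle M S R I \<Omega>"
  shows "ergodic_index_cocycle (cond_space M U) (restrict_rel S U) (restrict_rel R U) I (restrict \<Omega> (restrict_rel R U))"
    and "essential_image (cond_space M U) (restrict_rel R U) (sym_topology I) (restrict \<Omega> (restrict_rel R U))
      = essential_image M R (sym_topology I) \<Omega>"
proof -
  interpret R: pmp_restriction M R U
    using ergodic_pmp_inclusionD(2)[OF inc] U by (simp add: pmp_restriction_def pmp_restriction_axioms_def)
  interpret S: pmp_relation M S by (rule ergodic_pmp_inclusionD(1)[OF inc])
  have e: "ergodic_cocycle M R (BijGroup I) (sym_topology I) \<Omega>" using o by (simp add: ergodic_index_cocycle_def)
  have eU: "ergodic_cocycle (cond_space M U) (restrict_rel R U) (BijGroup I) (sym_topology I) (restrict \<Omega> (restrict_rel R U))"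
    by (rule R.ergodic_cocycle_MU[OF ergodic_pmp_inclusionD(4)[OF inc] e])
  obtain c where c: "choice_functions M S R I c"
    "AE x in M. \<forall>y. (x, y) \<in> R \<longrightarrow> (\<forall>i\<in>I. \<forall>j\<in>I. \<Omega> (x, y) i = j \<longleftrightarrow> S `` {c j x} = S `` {c i y})"
    using o unfolding ergodic_index_cocycle_def index_cocycle_def by blast
  have I: "countable I" by (rule choice_functionsD(1)[OF c(1)])
  show "essential_image (cond_space M U) (restrict_rel R U) (sym_topology I) (restrict \<Omega> (restrict_rel R U))
      = essential_image M R (sym_topology I) \<Omega>"
    by (rule R.essential_image_MU[OF ergodic_pmp_inclusionD(4)[OF inc] e I])
  obtain c' where c': "choice_functions (cond_space M U) (restrict_rel S U) (restrict_rel R U) I c'"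
    "AE x in cond_space M U. \<forall>i\<in>I. S `` {c i x} = S `` {c' i x} \<and> c' i x \<in> U"
    by (rule choice_functions_restrict[OF inc U c(1)])
  have "AE x in cond_space M U. \<forall>y. (x, y) \<in> R \<longrightarrow> (\<forall>i\<in>I. \<forall>j\<in>I. \<Omega> (x, y) i = j \<longleftrightarrow> S `` {c j x} = S `` {c i y})"
    unfolding R.AE_MU using c(2) by eventually_elim blast
  then have "AE x in cond_space M U. \<forall>y. (x, y) \<in> restrict_rel R U \<longrightarrow> (\<forall>i\<in>I. \<forall>j\<in>I.
      restrict \<Omega> (restrict_rel R U) (x, y) i = j \<longleftrightarrow> restrict_rel S U `` {c' j x} = restrict_rel S U `` {c' i y})"
    using c'(2) R.RU.AE_class[OF c'(2)]
  proof eventually_elim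
    case (elim x)
    show ?case
    proof (intro allI impI ballI)
      fix y i j assume xy: "(x, y) \<in> restrict_rel R U" and i: "i \<in> I" and j: "j \<in> I"
      have cj: "S `` {c j x} = S `` {c' j x}" "c' j x \<in> U" using elim(2) j by auto
      have ci: "S `` {c i y} = S `` {c' i y}" "c' i y \<in> U" using elim(3) xy i by auto
      have "restrict_rel S U `` {c' j x} = restrict_rel S U `` {c' i y} \<longleftrightarrow> S `` {c' j x} = S `` {c' i y}"
      proof
        assume eq: "restrict_rel S U `` {c' j x} = restrict_rel S U `` {c' i y}"
        have "c' j x \<in> restrict_rel S U `` {c' j x}"
          using cj(2) R.U_space S.R_refl by (auto simp: restrict_rel_def)
        then have "(c' i y, c' j x) \<in> S" unfolding eq by (auto simp: restrict_rel_def)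
        then show "S `` {c' j x} = S `` {c' i y}" using equiv_class_eq[OF S.R_equiv] by metis
      next
        assume "S `` {c' j x} = S `` {c' i y}"
        then show "restrict_rel S U `` {c' j x} = restrict_rel S U `` {c' i y}"
          using cj(2) ci(2) unfolding restrict_rel_def by blast
      qed
      moreover have "\<Omega> (x, y) i = j \<longleftrightarrow> S `` {c j x} = S `` {c i y}"
        using elim(1) xy i j by (simp add: R.RU_iff)
      ultimately show "restrict \<Omega> (restrict_rel R U) (x, y) i = j \<longleftrightarrow> restrict_rel S U `` {c' j x} = restrict_rel S U `` {c' i y}"
        using cj(1) ci(1) xy by simp
    qed
  qed
  then have "index_cocycle (cond_space M U) (restrict_rel S U) (restrict_rel R U) I (restrict \<Omega> (restrict_rel R U))"
    using eU c'(1) unfolding index_cocycle_def ergodic_cocycle_def by blast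
  then show "ergodic_index_cocycle (cond_space M U) (restrict_rel S U) (restrict_rel R U) I (restrict \<Omega> (restrict_rel R U))"
    using eU unfolding ergodic_index_cocycle_def by blast
qed

section \<open>Transport along an isomorphism\<close>

locale pmp_isomorphism = M: prob_space M + N: prob_space N
  for M :: "'a measure" and N :: "'b measure" and X0 :: "'a set" and \<phi> :: "'a \<Rightarrow> 'b" +
  assumes iso: "pmp_iso M N X0 \<phi>"
begin

abbreviation "\<psi> \<equiv> the_inv_into X0 \<phi>"
abbreviation "Y0 \<equiv> \<phi> ` X0"

lemma X0: "X0 \<in> sets M" "AE x in M. x \<in> X0" and Y0: "Y0 \<in> sets N" "AE y in N. y \<in> Y0" and inj: "inj_on \<phi> X0"
  using iso by (auto simp: pmp_iso_def)

lemma X0_space: "x \<in> X0 \<Longrightarrow> x \<in> space M" using sets.sets_into_space[OF X0(1)] by blast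
lemma Y0_space: "y \<in> Y0 \<Longrightarrow> y \<in> space N" using sets.sets_into_space[OF Y0(1)] by blast

lemma \<psi>_\<phi>: "x \<in> X0 \<Longrightarrow> \<psi> (\<phi> x) = x" using inj by (rule the_inv_into_f_f)
lemma \<phi>_\<psi>: "y \<in> Y0 \<Longrightarrow> \<phi> (\<psi> y) = y" using inj by (rule f_the_inv_into_f)
lemma \<psi>_X0: "y \<in> Y0 \<Longrightarrow> \<psi> y \<in> X0" by (rule the_inv_into_into[OF inj _ order_refl])

lemma preimage_sets:
  assumes B: "B \<in> sets N"
  shows "{x \<in> X0. \<phi> x \<in> B} \<in> sets M"
proof -
  have "\<phi> \<in> restrict_space M X0 \<rightarrow>\<^sub>M N" using iso by (simp add: pmp_iso_def)
  from measurable_sets[OF this B] have "\<phi> -` B \<inter> X0 \<in> sets (restrict_space M X0)"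
    using X0_space by (simp add: space_restrict_space Int_absorb2 subset_iff)
  then have "\<phi> -` B \<inter> X0 \<in> sets M" using X0(1) by (subst (asm) sets_restrict_space_iff) auto
  moreover have "\<phi> -` B \<inter> X0 = {x \<in> X0. \<phi> x \<in> B}" by blast
  ultimately show ?thesis by simp
qed

lemma image_sets:
  assumes A: "A \<in> sets M"
  shows "{y \<in> Y0. \<psi> y \<in> A} \<in> sets N"
proof -
  have "\<psi> \<in> restrict_space N Y0 \<rightarrow>\<^sub>M M" using iso by (simp add: pmp_iso_def)
  from measurable_sets[OF this A] have "\<psi> -` A \<inter> Y0 \<in> sets (restrict_space N Y0)"
    using Y0_space by (simp add: space_restrict_space Int_absorb2 subset_iff)
  then have "\<psi> -` A \<inter> Y0 \<in> sets N" using Y0(1) by (subst (asm) sets_restrict_space_iff) auto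
  moreover have "\<psi> -` A \<inter> Y0 = {y \<in> Y0. \<psi> y \<in> A}" by blast
  ultimately show ?thesis by simp
qed

lemma emeasure_N:
  assumes B: "B \<in> sets N"
  shows "emeasure N B = emeasure M {x \<in> X0. \<phi> x \<in> B}"
proof -
  have meas: "\<phi> \<in> restrict_space M X0 \<rightarrow>\<^sub>M N" and d: "distr (restrict_space M X0) N \<phi> = N"
    using iso by (simp_all add: pmp_iso_def)
  have "emeasure N B = emeasure (restrict_space M X0) (\<phi> -` B \<inter> space (restrict_space M X0))"
    using emeasure_distr[OF meas B] d by simp
  also have "\<phi> -` B \<inter> space (restrict_space M X0) = {x \<in> X0. \<phi> x \<in> B}"
    using X0_space by (auto simp: space_restrict_space)
  also have "emeasure (restrict_space M X0) {x \<in> X0. \<phi> x \<in> B} = emeasure M {x \<in> X0. \<phi> x \<in> B}"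
    using X0(1) by (subst emeasure_restrict_space) auto
  finally show ?thesis .
qed

lemma AE_push:
  assumes "AE x in M. P x"
  shows "AE y in N. y \<in> Y0 \<and> P (\<psi> y)"
proof -
  obtain Z where Z: "{x \<in> space M. \<not> P x} \<subseteq> Z" "emeasure M Z = 0" "Z \<in> sets M"
    using AE_E[OF assms] by blast
  have im: "{y \<in> Y0. \<psi> y \<in> Z} \<in> sets N" by (rule image_sets[OF Z(3)])
  have "emeasure N {y \<in> Y0. \<psi> y \<in> Z} \<le> emeasure M Z"
    unfolding emeasure_N[OF im]
  proof (rule emeasure_mono[OF subsetI Z(3)])
    fix x assume "x \<in> {x \<in> X0. \<phi> x \<in> {y \<in> Y0. \<psi> y \<in> Z}}"
    then have "x \<in> X0" "\<psi> (\<phi> x) \<in> Z" by blast+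
    then show "x \<in> Z" by (simp add: \<psi>_\<phi>)
  qed
  then have "{y \<in> Y0. \<psi> y \<in> Z} \<in> null_sets N" using im Z(2) by (intro null_setsI) auto
  from AE_not_in[OF this] Y0(2) show ?thesis
  proof eventually_elim
    case (elim y)
    then show ?case using Z(1) X0_space[OF \<psi>_X0] by blast
  qed
qed

lemma AE_pull:
  assumes "AE y in N. P y"
  shows "AE x in M. x \<in> X0 \<and> P (\<phi> x)"
proof -
  obtain Z where Z: "{y \<in> space N. \<not> P y} \<subseteq> Z" "emeasure N Z = 0" "Z \<in> sets N"
    using AE_E[OF assms] by blast
  have "{x \<in> X0. \<phi> x \<in> Z} \<in> null_sets M"
    using preimage_sets[OF Z(3)] emeasure_N[OF Z(3)] Z(2) by (intro null_setsI) auto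
  from AE_not_in[OF this] X0(2) show ?thesis
  proof eventually_elim
    case (elim x)
    then have "\<phi> x \<in> space N" using Y0_space by blast
    then show ?case using elim Z(1) by blast
  qed
qed

lemma pair_sets_push:
  assumes V: "V \<in> sets (M \<Otimes>\<^sub>M M)"
  shows "{(y, z) \<in> Y0 \<times> Y0. (\<psi> y, \<psi> z) \<in> V} \<in> sets (N \<Otimes>\<^sub>M N)"
proof -
  obtain x0 where x0: "x0 \<in> space M" using M.not_empty by blast
  define f where "f y = (if y \<in> Y0 then \<psi> y else x0)" for y
  have "f \<in> N \<rightarrow>\<^sub>M M"
  proof (rule measurableI)
    show "f y \<in> space M" for y using x0 X0_space[OF \<psi>_X0] by (simp add: f_def)
    fix A assume A: "A \<in> sets M"
    have "f -` A \<inter> space N = {y \<in> Y0. \<psi> y \<in> A} \<union> (if x0 \<in> A then space N - Y0 else {})"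
      using Y0_space by (auto simp: f_def split: if_splits)
    then show "f -` A \<inter> space N \<in> sets N" using image_sets[OF A] Y0(1) by simp
  qed
  from measurable_sets[OF measurable_pair_map[OF this this] V]
  have "map_prod f f -` V \<inter> space (N \<Otimes>\<^sub>M N) \<in> sets (N \<Otimes>\<^sub>M N)" .
  from sets.Int[OF this pair_measureI[OF Y0(1) Y0(1)]]
  have "map_prod f f -` V \<inter> space (N \<Otimes>\<^sub>M N) \<inter> Y0 \<times> Y0 \<in> sets (N \<Otimes>\<^sub>M N)" .
  moreover have "map_prod f f -` V \<inter> space (N \<Otimes>\<^sub>M N) \<inter> Y0 \<times> Y0 = {(y, z) \<in> Y0 \<times> Y0. (\<psi> y, \<psi> z) \<in> V}"
    using Y0_space by (auto simp: f_def space_pair_measure)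
  ultimately show ?thesis by simp
qed

lemma rel_image_iff:
  "y \<in> Y0 \<Longrightarrow> z \<in> rel_image X0 \<phi> V `` {y} \<longleftrightarrow> z \<in> Y0 \<and> (\<psi> y, \<psi> z) \<in> V"
proof
  assume "y \<in> Y0" "z \<in> rel_image X0 \<phi> V `` {y}"
  then obtain a b where "a \<in> X0" "b \<in> X0" "(a, b) \<in> V" "y = \<phi> a" "z = \<phi> b"
    by (auto simp: rel_image_def restrict_rel_def)
  then show "z \<in> Y0 \<and> (\<psi> y, \<psi> z) \<in> V" by (simp add: \<psi>_\<phi>)
next
  assume y: "y \<in> Y0" and z: "z \<in> Y0 \<and> (\<psi> y, \<psi> z) \<in> V"
  then have "(\<psi> y, \<psi> z) \<in> restrict_rel V X0" by (simp add: restrict_rel_def \<psi>_X0)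
  then have "map_prod \<phi> \<phi> (\<psi> y, \<psi> z) \<in> rel_image X0 \<phi> V" unfolding rel_image_def by (rule imageI)
  then show "z \<in> rel_image X0 \<phi> V `` {y}" using y z by (simp add: \<phi>_\<psi>)
qed

lemma AE_rel:
  assumes "rel_eq_ae N (rel_image X0 \<phi> V) W"
  shows "AE y in N. y \<in> Y0 \<and> (\<forall>z. (y, z) \<in> W \<longleftrightarrow> z \<in> Y0 \<and> (\<psi> y, \<psi> z) \<in> V)"
  using assms[unfolded rel_eq_ae_def] Y0(2)
proof eventually_elim
  case (elim y)
  have "(y, z) \<in> W \<longleftrightarrow> z \<in> Y0 \<and> (\<psi> y, \<psi> z) \<in> V" for z
  proof -
    have "(y, z) \<in> W \<longleftrightarrow> z \<in> W `` {y}" by simp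
    also have "\<dots> \<longleftrightarrow> z \<in> Y0 \<and> (\<psi> y, \<psi> z) \<in> V" unfolding elim(1)[symmetric] by (rule rel_image_iff[OF elim(2)])
    finally show ?thesis .
  qed
  then show ?case using elim(2) by blast
qed

end

locale pmp_relation_isomorphism = pmp_isomorphism M N X0 \<phi> + R: pmp_relation M R + T: pmp_relation N T
  for M :: "'a measure" and N :: "'b measure" and X0 \<phi> R T +
  assumes RT: "rel_eq_ae N (rel_image X0 \<phi> R) T"
begin

lemmas AE_T = AE_rel[OF RT]

lemma AE_R: "AE x in M. x \<in> X0 \<and> (\<forall>z. (x, z) \<in> R \<longrightarrow> z \<in> X0 \<and> (\<phi> x, \<phi> z) \<in> T)"
  using AE_pull[OF AE_T] R.AE_class[OF X0(2)]
proof eventually_elim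
  case (elim x)
  then show ?case by (auto simp: \<psi>_\<phi>)
qed

lemma AE_cocycle_pull:
  assumes "AE y in N. \<forall>z. (y, z) \<in> T \<longrightarrow> P (\<psi> y) (\<psi> z)"
  shows "AE x in M. \<forall>z. (x, z) \<in> R \<longrightarrow> P x z"
  using AE_pull[OF assms] AE_R
proof eventually_elim
  case (elim x)
  show ?case
  proof (intro allI impI)
    fix z assume "(x, z) \<in> R"
    then have "z \<in> X0" "(\<phi> x, \<phi> z) \<in> T" using elim(2) by auto
    then have "P (\<psi> (\<phi> x)) (\<psi> (\<phi> z))" using elim(1) by blast
    then show "P x z" using elim(1) \<open>z \<in> X0\<close> by (simp add: \<psi>_\<phi>)
  qed
qed

lemma AE_cocycle_push:
  assumes "AE x in M. \<forall>z. (x, z) \<in> R \<longrightarrow> P x z"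
  shows "AE y in N. \<forall>z. (y, z) \<in> T \<longrightarrow> P (\<psi> y) (\<psi> z)"
  using AE_push[OF assms] AE_T
proof eventually_elim
  case (elim y)
  show ?case
  proof (intro allI impI)
    fix z assume "(y, z) \<in> T"
    then have "(\<psi> y, \<psi> z) \<in> R" using elim(2) by blast
    then show "P (\<psi> y) (\<psi> z)" using elim(1) by blast
  qed
qed

text \<open>A Borel version of the transported cocycle has to be defined on all of \<open>T\<close>.
  It takes the identity permutation as default value off the image of \<open>R\<close>, where no
  pair in \<open>T\<close> with a generic first point lies.\<close>

lemma cocycle_push:
  assumes coc: "cocycle M R (BijGroup I) (sym_topology I) \<Omega>"
  shows "cocycle N T (BijGroup I) (sym_topology I) (\<Omega> \<circ> map_prod \<psi> \<psi>)"
proof -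
  obtain \<Omega>' where \<Omega>': "\<forall>W\<in>sets (borel_of (sym_topology I)). {p \<in> R. \<Omega>' p \<in> W} \<in> sets (M \<Otimes>\<^sub>M M)"
    "\<forall>p\<in>R. \<Omega>' p \<in> topspace (sym_topology I)" "AE x in M. \<forall>y. (x, y) \<in> R \<longrightarrow> \<Omega> (x, y) = \<Omega>' (x, y)"
    by (rule R.cocycle_version[OF coc])
  define one where "one = (\<lambda>i\<in>I. i)"
  define D where "D = {(y, z) \<in> Y0 \<times> Y0. (\<psi> y, \<psi> z) \<in> R}"
  define \<Theta> where "\<Theta> p = (if p \<in> D then \<Omega>' (map_prod \<psi> \<psi> p) else one)" for p
  have D: "D \<in> sets (N \<Otimes>\<^sub>M N)" unfolding D_def by (rule pair_sets_push[OF R.R_sets])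
  show ?thesis
  proof (rule T.cocycleI[of _ \<Theta>])
    fix W assume W: "W \<in> sets (borel_of (sym_topology I))"
    define V where "V = {(y, z) \<in> Y0 \<times> Y0. (\<psi> y, \<psi> z) \<in> {p \<in> R. \<Omega>' p \<in> W}}"
    have V: "V \<in> sets (N \<Otimes>\<^sub>M N)" unfolding V_def using \<Omega>'(1) W by (intro pair_sets_push) blast
    have "{p \<in> T. \<Theta> p \<in> W} = (T \<inter> V) \<union> (if one \<in> W then T - D else {})"
      by (auto simp: \<Theta>_def V_def D_def split: if_splits)
    then show "{p \<in> T. \<Theta> p \<in> W} \<in> sets (N \<Otimes>\<^sub>M N)" using T.R_sets V D by simp
  next
    show "\<Theta> p \<in> topspace (sym_topology I)" for p
      using \<Omega>'(2) id_Bij by (auto simp: \<Theta>_def D_def one_def)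
    show "AE y in N. \<forall>z. (y, z) \<in> T \<longrightarrow> (\<Omega> \<circ> map_prod \<psi> \<psi>) (y, z) = \<Theta> (y, z)"
      using AE_cocycle_push[OF \<Omega>'(3)] AE_T
    proof eventually_elim
      case (elim y)
      then show ?case by (auto simp: \<Theta>_def D_def)
    qed
    have mult: "AE x in M. \<forall>y z. (x, y) \<in> R \<longrightarrow> (y, z) \<in> R \<longrightarrow> \<Omega> (x, z) = \<Omega> (x, y) \<otimes>\<^bsub>BijGroup I\<^esub> \<Omega> (y, z)"
      using coc unfolding cocycle_def by blast
    show "AE y in N. \<forall>z w. (y, z) \<in> T \<longrightarrow> (z, w) \<in> T \<longrightarrow>
        (\<Omega> \<circ> map_prod \<psi> \<psi>) (y, w) = (\<Omega> \<circ> map_prod \<psi> \<psi>) (y, z) \<otimes>\<^bsub>BijGroup I\<^esub> (\<Omega> \<circ> map_prod \<psi> \<psi>) (z, w)"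
      using AE_push[OF mult] AE_T
    proof eventually_elim
      case (elim y)
      show ?case
      proof (intro allI impI)
        fix z w assume yz: "(y, z) \<in> T" and zw: "(z, w) \<in> T"
        then have "(y, w) \<in> T" by (rule T.R_trans)
        then have yw: "(\<psi> y, \<psi> w) \<in> R" using elim(2) by blast
        have yz': "(\<psi> y, \<psi> z) \<in> R" using elim(2) yz by blast
        have "(\<psi> z, \<psi> w) \<in> R" using R.R_trans[OF R.R_sym[OF yz'] yw] .
        then show "(\<Omega> \<circ> map_prod \<psi> \<psi>) (y, w) = (\<Omega> \<circ> map_prod \<psi> \<psi>) (y, z) \<otimes>\<^bsub>BijGroup I\<^esub> (\<Omega> \<circ> map_prod \<psi> \<psi>) (z, w)"
          using elim(1) yz' by simp
      qed
    qed
  qed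
qed

lemma ergodic_cocycle_push:
  assumes coc: "ergodic_cocycle M R (BijGroup I) (sym_topology I) \<Omega>"
  shows "ergodic_cocycle N T (BijGroup I) (sym_topology I) (\<Omega> \<circ> map_prod \<psi> \<psi>)"
  unfolding ergodic_cocycle_def
proof (intro conjI allI impI)
  show "cocycle N T (BijGroup I) (sym_topology I) (\<Omega> \<circ> map_prod \<psi> \<psi>)"
    using coc by (intro cocycle_push) (simp add: ergodic_cocycle_def)
  fix K A assume K: "subgroup K (BijGroup I) \<and> openin (sym_topology I) K"
  show "invariant_borel_set N {p \<in> T. (\<Omega> \<circ> map_prod \<psi> \<psi>) p \<in> K} A \<longleftrightarrow> invariant_borel_set N T A"
  proof
    assume "invariant_borel_set N T A"
    then show "invariant_borel_set N {p \<in> T. (\<Omega> \<circ> map_prod \<psi> \<psi>) p \<in> K} A"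
      unfolding invariant_borel_set_def by (auto elim!: eventually_mono)
  next
    assume A: "invariant_borel_set N {p \<in> T. (\<Omega> \<circ> map_prod \<psi> \<psi>) p \<in> K} A"
    then have AN: "A \<in> sets N"
      and inv: "AE y in N. \<forall>z. (y, z) \<in> {p \<in> T. (\<Omega> \<circ> map_prod \<psi> \<psi>) p \<in> K} \<longrightarrow> (y \<in> A \<longleftrightarrow> z \<in> A)"
      unfolding invariant_borel_set_def by blast+
    define B where "B = {x \<in> X0. \<phi> x \<in> A}"
    have B: "B \<in> sets M" unfolding B_def by (rule preimage_sets[OF AN])
    have BA: "\<psi> y \<in> B \<longleftrightarrow> y \<in> A" if "y \<in> Y0" for y using \<psi>_X0[OF that] \<phi>_\<psi>[OF that] by (simp add: B_def)
    have "AE y in N. \<forall>z. (y, z) \<in> T \<longrightarrow> \<Omega> (\<psi> y, \<psi> z) \<in> K \<longrightarrow> (\<psi> y \<in> B \<longleftrightarrow> \<psi> z \<in> B)"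
      using inv AE_T by eventually_elim (use BA in auto)
    from AE_cocycle_pull[where P = "\<lambda>x z. \<Omega> (x, z) \<in> K \<longrightarrow> (x \<in> B \<longleftrightarrow> z \<in> B)", OF this]
    have "invariant_borel_set M {p \<in> R. \<Omega> p \<in> K} B"
      unfolding invariant_borel_set_def using B by (auto elim!: eventually_mono)
    then have "invariant_borel_set M R B" using coc K unfolding ergodic_cocycle_def by blast
    then have "AE x in M. \<forall>z. (x, z) \<in> R \<longrightarrow> (x \<in> B \<longleftrightarrow> z \<in> B)" unfolding invariant_borel_set_def by blast
    from AE_cocycle_push[OF this]
    have "AE y in N. \<forall>z. (y, z) \<in> T \<longrightarrow> (y \<in> A \<longleftrightarrow> z \<in> A)"
      using AE_T
    proof eventually_elim
      case (elim y)
      then show ?case using BA by blast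
    qed
    then show "invariant_borel_set N T A" unfolding invariant_borel_set_def using AN by blast
  qed
qed

lemma essential_image_push:
  assumes coc: "cocycle M R (BijGroup I) (sym_topology I) \<Omega>" and I: "countable I"
  shows "essential_image N T (sym_topology I) (\<Omega> \<circ> map_prod \<psi> \<psi>) = essential_image M R (sym_topology I) \<Omega>"
    (is "?HN = ?H")
proof
  note H = R.essential_image_properties[OF coc I]
    and HN = T.essential_image_properties[OF cocycle_push[OF coc] I]
  have 1: "AE y in N. \<forall>z. (y, z) \<in> T \<longrightarrow> \<Omega> (\<psi> y, \<psi> z) \<in> ?H" by (rule AE_cocycle_push[OF H(2)])
  show "?HN \<subseteq> ?H" by (rule HN(3)[OF H(1)]) (use 1 in simp)
  have 2: "AE y in N. \<forall>z. (y, z) \<in> T \<longrightarrow> \<Omega> (\<psi> y, \<psi> z) \<in> ?HN" using HN(2) by simp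
  show "?H \<subseteq> ?HN" by (rule H(3)[OF HN(1) AE_cocycle_pull[OF 2]])
qed

text \<open>The conjugate of an element of the full group is in general only partially defined. Its
  range is conull because partial isomorphisms preserve the measure.\<close>

lemma full_group_push:
  assumes c: "c \<in> full_group M R"
  obtains A where "partial_iso N T A (\<phi> \<circ> c \<circ> \<psi>)" "AE y in N. y \<in> A" "AE y in N. y \<in> (\<phi> \<circ> c \<circ> \<psi>) ` A"
    "A \<subseteq> Y0" "\<forall>y\<in>A. c (\<psi> y) \<in> X0"
proof -
  let ?g = "\<phi> \<circ> c \<circ> \<psi>"
  note cD = full_groupD[OF c]
  have cp: "partial_iso M R (space M) c" using c by (rule full_group_partial_iso) simp
  obtain G where G: "G \<in> sets N" "AE y in N. y \<in> G"
    "\<forall>y\<in>G. y \<in> Y0 \<and> (\<forall>z. (y, z) \<in> T \<longleftrightarrow> z \<in> Y0 \<and> (\<psi> y, \<psi> z) \<in> R)" "\<forall>y\<in>G. \<forall>z. (y, z) \<in> T \<longrightarrow> z \<in> G"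
    by (rule T.invariant_core[OF AE_T])
  define C where "C B = {x \<in> space M. c x \<in> {x \<in> X0. \<phi> x \<in> B}}" for B
  have C: "C B \<in> sets M" if "B \<in> sets N" for B
    unfolding C_def by (rule partial_isoD(4)[OF cp preimage_sets[OF that]])
  define A where "A = G \<inter> {y \<in> Y0. \<psi> y \<in> C (space N)}"
  have A: "A \<in> sets N" unfolding A_def using G(1) image_sets[OF C[OF sets.top]] by (rule sets.Int)
  have AD: "y \<in> G" "y \<in> Y0" "\<psi> y \<in> X0" "c (\<psi> y) \<in> X0" if "y \<in> A" for y
    using that \<psi>_X0 by (auto simp: A_def C_def)
  have gY: "?g y \<in> Y0" "\<psi> (?g y) = c (\<psi> y)" if "y \<in> A" for y
    using AD[OF that] by (auto simp: \<psi>_\<phi>)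
  have g: "partial_iso N T A ?g"
  proof (rule partial_isoI[OF A])
    show "inj_on ?g A"
    proof (rule inj_onI)
      fix y z assume y: "y \<in> A" and z: "z \<in> A" and eq: "?g y = ?g z"
      have "c (\<psi> y) = \<psi> (?g y)" by (rule gY(2)[OF y, symmetric])
      also have "\<dots> = \<psi> (?g z)" by (simp only: eq)
      also have "\<dots> = c (\<psi> z)" by (rule gY(2)[OF z])
      finally have "c (\<psi> y) = c (\<psi> z)" .
      then have "\<psi> y = \<psi> z"
        using inj_onD[OF partial_isoD(2)[OF cp]] X0_space AD(3)[OF y] AD(3)[OF z] by blast
      then have "\<phi> (\<psi> y) = \<phi> (\<psi> z)" by (rule arg_cong)
      then show "y = z" unfolding \<phi>_\<psi>[OF AD(2)[OF y]] \<phi>_\<psi>[OF AD(2)[OF z]] .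
    qed
    show "(y, ?g y) \<in> T" if y: "y \<in> A" for y
      using G(3) AD(1)[OF y] gY[OF y] cD(2)[OF X0_space[OF AD(3)[OF y]]] by simp
  next
    fix B assume B: "B \<in> sets N"
    have "{y \<in> A. ?g y \<in> B} = A \<inter> {y \<in> Y0. \<psi> y \<in> C B}"
      using AD X0_space by (auto simp: C_def)
    then show "{y \<in> A. ?g y \<in> B} \<in> sets N" using sets.Int[OF A image_sets[OF C[OF B]]] by simp
  next
    fix B assume B: "B \<in> sets N" "B \<subseteq> A"
    have "?g ` B = {z \<in> Y0. \<psi> z \<in> c ` {x \<in> X0. \<phi> x \<in> B}}"
    proof (intro equalityI subsetI)
      fix z assume "z \<in> ?g ` B"
      then obtain y where y: "y \<in> B" "z = ?g y" by blast
      then have yA: "y \<in> A" using B(2) by blast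
      have "\<psi> y \<in> {x \<in> X0. \<phi> x \<in> B}" using AD[OF yA] y(1) by (simp add: \<phi>_\<psi>)
      then show "z \<in> {z \<in> Y0. \<psi> z \<in> c ` {x \<in> X0. \<phi> x \<in> B}}" using gY[OF yA] y(2) by auto
    next
      fix z assume "z \<in> {z \<in> Y0. \<psi> z \<in> c ` {x \<in> X0. \<phi> x \<in> B}}"
      then obtain x where x: "z \<in> Y0" "x \<in> X0" "\<phi> x \<in> B" "\<psi> z = c x" by auto
      have "?g (\<phi> x) = \<phi> (\<psi> z)" using x by (simp add: \<psi>_\<phi>)
      then have "?g (\<phi> x) = z" using \<phi>_\<psi>[OF x(1)] by simp
      then show "z \<in> ?g ` B" using x(3) by blast
    qed
    moreover have "c ` {x \<in> X0. \<phi> x \<in> B} \<in> sets M"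
      using preimage_sets[OF B(1)] X0_space by (intro partial_isoD(5)[OF cp]) auto
    ultimately show "?g ` B \<in> sets N" using image_sets by simp
  qed
  have dom: "AE y in N. y \<in> A"
    using G(2) AE_push[OF AE_R]
  proof eventually_elim
    case (elim y)
    have "(\<psi> y, c (\<psi> y)) \<in> R" using cD(2) X0_space elim(2) by blast
    then have "c (\<psi> y) \<in> X0" using elim(2) by blast
    moreover from this have "\<phi> (c (\<psi> y)) \<in> space N" using Y0_space by blast
    ultimately show ?case using elim X0_space by (auto simp: A_def C_def)
  qed
  have "emeasure N (?g ` A) = emeasure N A" by (rule T.partial_iso_emeasure[OF g])
  moreover have "?g ` A \<in> sets N" by (rule partial_isoD(5)[OF g A order_refl])
  ultimately have "AE y in N. y \<in> ?g ` A"
    using dom A by (simp add: N.AE_in_set_eq_1 N.emeasure_eq_measure)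
  with g dom show ?thesis using AD by (intro that[of A]) auto
qed

end

text \<open>The conjugates of the choice functions, corrected on a null set, are choice functions
  for the transported inclusion, and they lead to the transported index cocycle.\<close>

theorem ergodic_index_cocycle_push:
  fixes N :: "'b measure" and M :: "'a measure"
  assumes incM: "ergodic_pmp_inclusion M S R" and incN: "ergodic_pmp_inclusion N U T"
    and iso: "pmp_iso M N X0 \<phi>"
    and eqS: "rel_eq_ae N (rel_image X0 \<phi> S) U" and eqR: "rel_eq_ae N (rel_image X0 \<phi> R) T"
    and o: "ergodic_index_cocycle M S R I \<Omega>"
  shows "ergodic_index_cocycle N U T I (\<Omega> \<circ> map_prod (the_inv_into X0 \<phi>) (the_inv_into X0 \<phi>))"
    and "essential_image N T (sym_topology I) (\<Omega> \<circ> map_prod (the_inv_into X0 \<phi>) (the_inv_into X0 \<phi>))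
      = essential_image M R (sym_topology I) \<Omega>"
proof -
  have MR: "pmp_relation M R" and NT: "pmp_relation N T" by (rule ergodic_pmp_inclusionD(2)[OF incM], rule ergodic_pmp_inclusionD(2)[OF incN])
  interpret pmp_relation_isomorphism M N X0 \<phi> R T
    using MR NT iso eqR
    by (simp add: pmp_relation_isomorphism_def pmp_relation_isomorphism_axioms_def pmp_isomorphism_def
        pmp_isomorphism_axioms_def pmp_relation_def)
  interpret S: pmp_relation M S by (rule ergodic_pmp_inclusionD(1)[OF incM])
  interpret U: pmp_relation N U by (rule ergodic_pmp_inclusionD(1)[OF incN])
  have e: "ergodic_cocycle M R (BijGroup I) (sym_topology I) \<Omega>" using o by (simp add: ergodic_index_cocycle_def)
  have eN: "ergodic_cocycle N T (BijGroup I) (sym_topology I) (\<Omega> \<circ> map_prod \<psi> \<psi>)"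
    by (rule ergodic_cocycle_push[OF e])
  obtain c where c: "choice_functions M S R I c"
    "AE x in M. \<forall>y. (x, y) \<in> R \<longrightarrow> (\<forall>i\<in>I. \<forall>j\<in>I. \<Omega> (x, y) i = j \<longleftrightarrow> S `` {c j x} = S `` {c i y})"
    using o unfolding ergodic_index_cocycle_def index_cocycle_def by blast
  note cD = choice_functionsD[OF c(1)]
  show "essential_image N T (sym_topology I) (\<Omega> \<circ> map_prod \<psi> \<psi>) = essential_image M R (sym_topology I) \<Omega>"
    using e cD(1) by (intro essential_image_push) (simp_all add: ergodic_cocycle_def)
  obtain i0 where i0: "i0 \<in> I" "\<forall>x\<in>space M. c i0 x = x" using cD(3) by blast
  define good where "good i A \<longleftrightarrow> partial_iso N T A (\<phi> \<circ> c i \<circ> \<psi>) \<and> (AE y in N. y \<in> A) \<and>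
      (AE y in N. y \<in> (\<phi> \<circ> c i \<circ> \<psi>) ` A) \<and> A \<subseteq> Y0 \<and> (\<forall>y\<in>A. c i (\<psi> y) \<in> X0)" for i A
  have "\<exists>A. good i A" if i: "i \<in> I" for i
  proof -
    obtain A where "partial_iso N T A (\<phi> \<circ> c i \<circ> \<psi>)" "AE y in N. y \<in> A" "AE y in N. y \<in> (\<phi> \<circ> c i \<circ> \<psi>) ` A"
      "A \<subseteq> Y0" "\<forall>y\<in>A. c i (\<psi> y) \<in> X0"
      by (rule full_group_push[OF cD(2)[OF i]])
    then have "good i A" by (simp add: good_def)
    then show ?thesis ..
  qed
  then have "\<forall>i\<in>I. \<exists>A. good i A" by blast
  from bchoice[OF this] obtain A where A: "\<forall>i\<in>I. good i (A i)" by blast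
  have g0: "AE y in N. (\<phi> \<circ> c i0 \<circ> \<psi>) y = y"
    using Y0(2) by eventually_elim (use i0(2) X0_space[OF \<psi>_X0] \<phi>_\<psi> in simp)
  have Ai: "i \<in> I \<Longrightarrow> partial_iso N T (A i) (\<phi> \<circ> c i \<circ> \<psi>)" and Ad: "i \<in> I \<Longrightarrow> AE y in N. y \<in> A i"
    and Ar: "i \<in> I \<Longrightarrow> AE y in N. y \<in> (\<phi> \<circ> c i \<circ> \<psi>) ` A i" and AX: "i \<in> I \<Longrightarrow> \<forall>y\<in>A i. c i (\<psi> y) \<in> X0" for i
    using A by (auto simp: good_def)
  obtain d where d: "\<forall>i\<in>I. d i \<in> full_group N T" "\<exists>i\<in>I. \<forall>x\<in>space N. d i x = x"
    "AE y in N. \<forall>i\<in>I. d i y = (\<phi> \<circ> c i \<circ> \<psi>) y"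
    by (rule T.choice_family_from_partial_isos[where g = "\<lambda>i. \<phi> \<circ> c i \<circ> \<psi>", OF i0(1) cD(1) g0 Ai Ad Ar])
  have "AE y in N. \<forall>i\<in>I. y \<in> A i" using Ad cD(1) by (intro AE_ball_countable')
  define ok where "ok y \<longleftrightarrow> y \<in> Y0 \<and> (\<forall>z. (y, z) \<in> T \<longleftrightarrow> z \<in> Y0 \<and> (\<psi> y, \<psi> z) \<in> R) \<and>
      (\<forall>z. (y, z) \<in> U \<longleftrightarrow> z \<in> Y0 \<and> (\<psi> y, \<psi> z) \<in> S) \<and>
      (\<forall>i\<in>I. d i y = \<phi> (c i (\<psi> y)) \<and> c i (\<psi> y) \<in> X0)" for y
  have "AE y in N. ok y"
    using AE_T AE_rel[OF eqS] d(3) \<open>AE y in N. \<forall>i\<in>I. y \<in> A i\<close>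
    by eventually_elim (use AX in \<open>simp add: ok_def\<close>)
  then obtain Y where Y: "Y \<in> sets N" "AE y in N. y \<in> Y" "\<forall>y\<in>Y. ok y" "\<forall>y\<in>Y. \<forall>z. (y, z) \<in> T \<longrightarrow> z \<in> Y"
    by (rule T.invariant_core)
  have ok: "y \<in> Y0" "(y, z) \<in> T \<longleftrightarrow> z \<in> Y0 \<and> (\<psi> y, \<psi> z) \<in> R" "(y, z) \<in> U \<longleftrightarrow> z \<in> Y0 \<and> (\<psi> y, \<psi> z) \<in> S"
    "i \<in> I \<Longrightarrow> d i y = \<phi> (c i (\<psi> y)) \<and> c i (\<psi> y) \<in> X0" if "y \<in> Y" for y z i
    using bspec[OF Y(3) that] unfolding ok_def by blast+
  have dY: "d i y \<in> Y" "\<psi> (d i y) = c i (\<psi> y)" if y: "y \<in> Y" and i: "i \<in> I" for i y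
  proof -
    have "d i \<in> full_group N T" using d(1) i by blast
    then have "(y, d i y) \<in> T" using Y0_space[OF ok(1)[OF y]] by (rule full_groupD(2))
    then show "d i y \<in> Y" using Y(4) y by blast
    show "\<psi> (d i y) = c i (\<psi> y)" using ok(4)[OF y i] by (simp add: \<psi>_\<phi>)
  qed
  have Ud: "z \<in> U `` {d i y} \<longleftrightarrow> z \<in> Y0 \<and> \<psi> z \<in> S `` {c i (\<psi> y)}" if "y \<in> Y" "i \<in> I" for i y z
    using ok(3)[OF dY(1)[OF that]] dY(2)[OF that] by simp
  have "AE y in N. T `` {y} = (\<Union>i\<in>I. U `` {d i y}) \<and> disjoint_family_on (\<lambda>i. U `` {d i y}) I"
    using Y(2) AE_push[OF cD(4)]
  proof eventually_elim
    case (elim y)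
    have "z \<in> T `` {y} \<longleftrightarrow> z \<in> (\<Union>i\<in>I. U `` {d i y})" for z
    proof -
      have "z \<in> T `` {y} \<longleftrightarrow> z \<in> Y0 \<and> \<psi> z \<in> R `` {\<psi> y}" using ok(2)[OF elim(1)] by simp
      also have "\<dots> \<longleftrightarrow> z \<in> Y0 \<and> (\<exists>i\<in>I. \<psi> z \<in> S `` {c i (\<psi> y)})" using elim(2) by simp
      also have "\<dots> \<longleftrightarrow> z \<in> (\<Union>i\<in>I. U `` {d i y})" using Ud[OF elim(1)] by blast
      finally show ?thesis .
    qed
    then have "T `` {y} = (\<Union>i\<in>I. U `` {d i y})" by blast
    moreover have "disjoint_family_on (\<lambda>i. U `` {d i y}) I"
      using elim(2) Ud[OF elim(1)] unfolding disjoint_family_on_def by blast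
    ultimately show ?case ..
  qed
  then have choice: "choice_functions N U T I d" using d(1,2) cD(1) unfolding choice_functions_def by blast
  have "AE y in N. \<forall>z. (y, z) \<in> T \<longrightarrow> (\<forall>i\<in>I. \<forall>j\<in>I. (\<Omega> \<circ> map_prod \<psi> \<psi>) (y, z) i = j \<longleftrightarrow> U `` {d j y} = U `` {d i z})"
    using Y(2) AE_cocycle_push[OF c(2)]
  proof eventually_elim
    case (elim y)
    show ?case
    proof (intro allI impI ballI)
      fix z i j assume yz: "(y, z) \<in> T" and i: "i \<in> I" and j: "j \<in> I"
      have z: "z \<in> Y" using Y(4) elim(1) yz by blast
      have "U `` {d j y} = U `` {d i z} \<longleftrightarrow> S `` {c j (\<psi> y)} = S `` {c i (\<psi> z)}"
      proof
        assume eq: "U `` {d j y} = U `` {d i z}"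
        have "d i z \<in> U `` {d i z}" using U.R_refl[OF Y0_space[OF ok(1)[OF dY(1)[OF z i]]]] by simp
        then have "d i z \<in> U `` {d j y}" using eq by simp
        then have "c i (\<psi> z) \<in> S `` {c j (\<psi> y)}" using Ud[OF elim(1) j] dY(2)[OF z i] by simp
        then show "S `` {c j (\<psi> y)} = S `` {c i (\<psi> z)}" using equiv_class_eq[OF S.R_equiv] by simp
      next
        assume "S `` {c j (\<psi> y)} = S `` {c i (\<psi> z)}"
        then have "w \<in> U `` {d j y} \<longleftrightarrow> w \<in> U `` {d i z}" for w
          using Ud[OF elim(1) j] Ud[OF z i] by simp
        then show "U `` {d j y} = U `` {d i z}" by blast
      qed
      moreover have "\<Omega> (\<psi> y, \<psi> z) i = j \<longleftrightarrow> S `` {c j (\<psi> y)} = S `` {c i (\<psi> z)}"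
        using elim(2) yz i j by blast
      ultimately show "(\<Omega> \<circ> map_prod \<psi> \<psi>) (y, z) i = j \<longleftrightarrow> U `` {d j y} = U `` {d i z}" by simp
    qed
  qed
  then have "index_cocycle N U T I (\<Omega> \<circ> map_prod \<psi> \<psi>)"
    using eN choice unfolding index_cocycle_def ergodic_cocycle_def by blast
  then show "ergodic_index_cocycle N U T I (\<Omega> \<circ> map_prod \<psi> \<psi>)"
    using eN unfolding ergodic_index_cocycle_def by blast
qed

section \<open>Stable orbit equivalence invariance\<close>

lemma aperiodic_inclusionI:
  fixes \<Omega> :: "'a \<times> 'a \<Rightarrow> nat \<Rightarrow> nat"
  assumes "ergodic_pmp_inclusion M S R" "ergodic_index_cocycle M S R I \<Omega>"
  shows "aperiodic_inclusion M S R"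
  using assms unfolding aperiodic_inclusion_def by blast

lemma represents_H_unique:
  assumes inc: "ergodic_pmp_inclusion M S R"
    and "represents_H M S R J H" "represents_H M S R K L"
  shows "perm_group_iso J H K L"
  using ergodic_index_cocycle_image_unique[OF inc] assms(2,3) unfolding represents_H_def by blast

lemma represents_H_push:
  assumes "ergodic_pmp_inclusion M S R" "ergodic_pmp_inclusion N U T" "pmp_iso M N X0 \<phi>"
    "rel_eq_ae N (rel_image X0 \<phi> S) U" "rel_eq_ae N (rel_image X0 \<phi> R) T"
    and H: "represents_H M S R J H"
  shows "represents_H N U T J H"
proof -
  obtain \<Omega> where \<Omega>: "ergodic_index_cocycle M S R J \<Omega>" "H = essential_image M R (sym_topology J) \<Omega>"
    using H unfolding represents_H_def by blast
  note push = ergodic_index_cocycle_push[OF assms(1-5) \<Omega>(1)]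
  show ?thesis unfolding represents_H_def
    by (intro exI conjI, rule push(1)) (simp add: push(2) \<Omega>(2))
qed

lemma represents_H_restrict:
  assumes "ergodic_pmp_inclusion M S R" "U \<in> sets M" "emeasure M U > 0"
    and H: "represents_H M S R J H"
  shows "represents_H (cond_space M U) (restrict_rel S U) (restrict_rel R U) J H"
proof -
  obtain \<Omega> where \<Omega>: "ergodic_index_cocycle M S R J \<Omega>" "H = essential_image M R (sym_topology J) \<Omega>"
    using H unfolding represents_H_def by blast
  note restr = ergodic_index_cocycle_restrict[OF assms(1-3) \<Omega>(1)]
  show ?thesis unfolding represents_H_def
    by (intro exI conjI, rule restr(1)) (simp add: restr(2) \<Omega>(2))
qed

text \<open>In every part one representative is transported or restricted to the space of the other
  one, where uniqueness applies. Aperiodicity is shown with the index cocycle on a set of natural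
  numbers that the aperiodicity of the given inclusion provides.\<close>

theorem proposition3p7:
  fixes M :: "'a measure" and S R :: "('a \<times> 'a) set"
    and I :: "'i set" and \<Omega> :: "'a \<times> 'a \<Rightarrow> 'i \<Rightarrow> 'i"
  assumes "aperiodic_inclusion M S R"
    and "ergodic_index_cocycle M S R I \<Omega>"
  shows
    "(\<forall>(N :: 'b measure) U T X0 \<phi>.
        ergodic_pmp_inclusion N U T \<and> pmp_iso M N X0 \<phi> \<and>
        rel_eq_ae N (rel_image X0 \<phi> S) U \<and> rel_eq_ae N (rel_image X0 \<phi> R) T \<longrightarrow>
          ergodic_index_cocycle N U T I
            (\<Omega> \<circ> map_prod (the_inv_into X0 \<phi>) (the_inv_into X0 \<phi>)) \<and>
          aperiodic_inclusion N U T \<and>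
          (\<forall>(J :: 'j set) H (K :: 'k set) L.
             represents_H M S R J H \<and> represents_H N U T K L \<longrightarrow> perm_group_iso J H K L)) \<and>
     (\<forall>U\<in>sets M. emeasure M U > 0 \<longrightarrow>
        ergodic_index_cocycle (cond_space M U) (restrict_rel S U) (restrict_rel R U) I
          (restrict \<Omega> (restrict_rel R U)) \<and>
        aperiodic_inclusion (cond_space M U) (restrict_rel S U) (restrict_rel R U) \<and>
        (\<forall>(J :: 'j set) H (K :: 'k set) L.
           represents_H (cond_space M U) (restrict_rel S U) (restrict_rel R U) J H \<and>
           represents_H M S R K L \<longrightarrow> perm_group_iso J H K L)) \<and>
     (\<forall>(N :: 'b measure) \<U> \<T> U V X0 \<phi>.
        aperiodic_inclusion N \<U> \<T> \<and>
        U \<in> sets M \<and> emeasure M U > 0 \<and> V \<in> sets N \<and> emeasure N V > 0 \<and>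
        pmp_iso (cond_space M U) (cond_space N V) X0 \<phi> \<and>
        rel_eq_ae (cond_space N V) (rel_image X0 \<phi> (restrict_rel S U)) (restrict_rel \<U> V) \<and>
        rel_eq_ae (cond_space N V) (rel_image X0 \<phi> (restrict_rel R U)) (restrict_rel \<T> V) \<longrightarrow>
          (\<forall>(J :: 'j set) H (K :: 'k set) L.
             represents_H M S R J H \<and> represents_H N \<U> \<T> K L \<longrightarrow> perm_group_iso J H K L))"
proof -
  have inc: "ergodic_pmp_inclusion M S R" using assms(1) by (simp add: aperiodic_inclusion_def)
  obtain I' :: "nat set" and \<Omega>' where \<Omega>': "ergodic_index_cocycle M S R I' \<Omega>'"
    using assms(1) unfolding aperiodic_inclusion_def by blast
  show ?thesis
  proof (intro conjI allI impI ballI)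
    fix N :: "'b measure" and U T X0 \<phi>
    assume "ergodic_pmp_inclusion N U T \<and> pmp_iso M N X0 \<phi> \<and>
      rel_eq_ae N (rel_image X0 \<phi> S) U \<and> rel_eq_ae N (rel_image X0 \<phi> R) T"
    then have incN: "ergodic_pmp_inclusion N U T" and iso: "pmp_iso M N X0 \<phi>"
      "rel_eq_ae N (rel_image X0 \<phi> S) U" "rel_eq_ae N (rel_image X0 \<phi> R) T"
      by auto
    show "ergodic_index_cocycle N U T I (\<Omega> \<circ> map_prod (the_inv_into X0 \<phi>) (the_inv_into X0 \<phi>))"
      by (rule ergodic_index_cocycle_push(1)[OF inc incN iso assms(2)])
    show "aperiodic_inclusion N U T"
      by (rule aperiodic_inclusionI[OF incN ergodic_index_cocycle_push(1)[OF inc incN iso \<Omega>']])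
    fix J :: "'j set" and H and K :: "'k set" and L
    assume "represents_H M S R J H \<and> represents_H N U T K L"
    then show "perm_group_iso J H K L"
      using represents_H_unique[OF incN] represents_H_push[OF inc incN iso] by blast
  next
    fix U assume U: "U \<in> sets M" "emeasure M U > 0"
    have incU: "ergodic_pmp_inclusion (cond_space M U) (restrict_rel S U) (restrict_rel R U)"
      by (rule ergodic_pmp_inclusion_restrict[OF inc U])
    show "ergodic_index_cocycle (cond_space M U) (restrict_rel S U) (restrict_rel R U) I
        (restrict \<Omega> (restrict_rel R U))"
      by (rule ergodic_index_cocycle_restrict(1)[OF inc U assms(2)])
    show "aperiodic_inclusion (cond_space M U) (restrict_rel S U) (restrict_rel R U)"
      by (rule aperiodic_inclusionI[OF incU ergodic_index_cocycle_restrict(1)[OF inc U \<Omega>']])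
    fix J :: "'j set" and H and K :: "'k set" and L
    assume "represents_H (cond_space M U) (restrict_rel S U) (restrict_rel R U) J H \<and> represents_H M S R K L"
    then show "perm_group_iso J H K L"
      using represents_H_unique[OF incU] represents_H_restrict[OF inc U] by blast
  next
    fix N :: "'b measure" and \<U> \<T> U V X0 \<phi> and J :: "'j set" and H and K :: "'k set" and L
    assume a: "aperiodic_inclusion N \<U> \<T> \<and>
        U \<in> sets M \<and> emeasure M U > 0 \<and> V \<in> sets N \<and> emeasure N V > 0 \<and>
        pmp_iso (cond_space M U) (cond_space N V) X0 \<phi> \<and>
        rel_eq_ae (cond_space N V) (rel_image X0 \<phi> (restrict_rel S U)) (restrict_rel \<U> V) \<and>
        rel_eq_ae (cond_space N V) (rel_image X0 \<phi> (restrict_rel R U)) (restrict_rel \<T> V)"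
      and HL: "represents_H M S R J H \<and> represents_H N \<U> \<T> K L"
    have incN: "ergodic_pmp_inclusion N \<U> \<T>" using a by (simp add: aperiodic_inclusion_def)
    have U: "U \<in> sets M" "emeasure M U > 0" and V: "V \<in> sets N" "emeasure N V > 0"
      and iso: "pmp_iso (cond_space M U) (cond_space N V) X0 \<phi>"
        "rel_eq_ae (cond_space N V) (rel_image X0 \<phi> (restrict_rel S U)) (restrict_rel \<U> V)"
        "rel_eq_ae (cond_space N V) (rel_image X0 \<phi> (restrict_rel R U)) (restrict_rel \<T> V)"
      using a by auto
    have incU: "ergodic_pmp_inclusion (cond_space M U) (restrict_rel S U) (restrict_rel R U)"
      by (rule ergodic_pmp_inclusion_restrict[OF inc U])
    have incV: "ergodic_pmp_inclusion (cond_space N V) (restrict_rel \<U> V) (restrict_rel \<T> V)"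
      by (rule ergodic_pmp_inclusion_restrict[OF incN V])
    have "represents_H (cond_space N V) (restrict_rel \<U> V) (restrict_rel \<T> V) J H"
      by (rule represents_H_push[OF incU incV iso represents_H_restrict[OF inc U conjunct1[OF HL]]])
    moreover have "represents_H (cond_space N V) (restrict_rel \<U> V) (restrict_rel \<T> V) K L"
      by (rule represents_H_restrict[OF incN V conjunct2[OF HL]])
    ultimately show "perm_group_iso J H K L" by (rule represents_H_unique[OF incV])
  qed
qed

end
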